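(* Assume that the initial states $x_i(0)=x_{i0}$, $i=1,\dots,N$, are mutually independent with common mean $\mathbb{E}x_i(0)=\bar x_0$ and $\max_{1\le i\le N}\mathbb{E}\|x_i(0)\|^2<C_0$ with $C_0$ independent of $N$, and that the matrix differential equations on $[0,T]$ $$\rho P=\dot P+A^TP+PA+Q-PBR^{-1}B^TP,\quad P(T)=0,$$ $$\rho K=\dot K+(A+G)^TK+K(A+G)+G^TP+PG-(P+K)BR^{-1}B^T(P+K)+PBR^{-1}B^TP-\Xi,\quad K(T)=0,$$ admit a solution, respectively. Then Problem (P1), i.e. the minimization of $J^{\rm F}_{\rm soc}(u)$ over $u\in L^2_{\mathcal F}(0,T;\mathbb{R}^{nr})$, has an optimal control $$\check u_i(t)=-R^{-1}B^T\big[P(t)x_i(t)+K(t)x^{(N)}(t)+s(t)\big],\quad i=1,\dots,N,$$ where $P$ solves $\rho P=\dot P+A^TP+PA+Q-PBR^{-1}B^TP$, $P(T)=0$, $K$ solves $\rho K=\dot K+(A+G)^TK+K(A+G)+G^TP+PG-(P+K)BR^{-1}B^T(P+K)+PBR^{-1}B^TP-\Xi$, $K(T)=0$, and $s$ solves $$\rho s=\dot s+[A+G-BR^{-1}B^T(P+K)]^Ts+(P+K)f-\bar\eta,\quad s(T)=0.$$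
   Context: Fix $T>0$, $\rho>0$, and $N$ agents. $A,G,\Gamma,Q\in\mathbb{R}^{n\times n}$, $B\in\mathbb{R}^{n\times r}$, $R\in\mathbb{R}^{r\times r}$ are constant matrices, $Q,R$ symmetric, $Q$ possibly indefinite, $R>0$. For a vector $z$ and symmetric matrix $S$, $\|z\|_S^2=z^TSz$. $f,\sigma,\eta\in C_{\rho/2}([0,\infty),\mathbb{R}^n)$, the space of continuous $h:[0,\infty)\to\mathbb{R}^n$ with $\int_0^\infty e^{-\rho t}\|h(t)\|^2dt<\infty$. $W_1,\dots,W_N$ are independent one-dimensional Brownian motions on a complete filtered probability space, with filtration $\mathcal F_t=\sigma(\bigcup_{i=1}^N\mathcal F_t^i)$, $\mathcal F^i_t=\sigma(x_i(0),W_i(s),0\le s\le t)$. $L^2_{\mathcal F}(0,T;\mathbb{R}^k)$ is the space of $\mathcal F_t$-adapted $\mathbb{R}^k$-valued processes $x$ with $\mathbb{E}\int_0^T\|x(t)\|^2dt<\infty$; a control profile is $u=(u_1,\dots,u_N)$ with $u_i\in L^2_{\mathcal F}(0,T;\mathbb{R}^r)$ (the space of profiles is denoted $L^2_{\mathcal F}(0,T;\mathbb{R}^{nr})$). Agent $i$ has state $x_i\in\mathbb{R}^n$ and control $u_i\in\mathbb{R}^r$ with $$dx_i=[Ax_i+Bu_i+Gx^{(N)}+f]dt+\sigma dW_i,\quad x_i(0)=x_{i0},\quad x^{(N)}=\tfrac1N\sum_{j=1}^Nx_j,$$ and finite-horizon cost $$J_i^{\rm F}(u)=\mathbb{E}\int_0^Te^{-\rho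 t}\big\{\|x_i-\Gamma x^{(N)}-\eta\|_Q^2+\|u_i\|_R^2\big\}dt,\qquad J^{\rm F}_{\rm soc}(u)=\sum_{i=1}^NJ_i^{\rm F}(u).$$ Notation: $\Xi=\Gamma^TQ+Q\Gamma-\Gamma^TQ\Gamma$, $\bar\eta=Q\eta-\Gamma^TQ\eta$. *)

theory Defs
  imports "HOL-Probability.Probability"
begin

text \<open>
  A stochastic process is a function of time and sample point, \<open>X t \<omega>\<close>; a filtration is a family
  of \<open>\<sigma>\<close>-algebras (as measures) indexed by time. Agents are numbered \<open>1, ..., N\<close>.
\<close>

definition positive_definite :: "real^'k^'k \<Rightarrow> bool" where
  "positive_definite S \<longleftrightarrow> (\<forall>v. v \<noteq> 0 \<longrightarrow> v \<bullet> (S *v v) > 0)"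

definition wnorm2 :: "real^'k^'k \<Rightarrow> real^'k \<Rightarrow> real" where
  "wnorm2 S z = z \<bullet> (S *v z)"

text \<open>This is the space usually written \<open>C\<^bsub>\<rho>/2\<^esub>([0, \<infinity>))\<close>.\<close>

definition weighted_C :: "real \<Rightarrow> (real \<Rightarrow> 'v::euclidean_space) set" where
  "weighted_C \<rho> = {h. continuous_on {0..} h \<and>
     set_integrable lborel {0..} (\<lambda>t. exp (- \<rho> * t) * (norm (h t))\<^sup>2)}"

definition agent_sigma ::
  "'w measure \<Rightarrow> ('w \<Rightarrow> 'v::euclidean_space) \<Rightarrow> (real \<Rightarrow> 'w \<Rightarrow> real) \<Rightarrow> real \<Rightarrow> 'w measure" where
  "agent_sigma M \<xi> w t = sigma (space M)
     ({\<xi> -` S \<inter> space M | S. S \<in> sets borel} \<union>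
      {w \<tau> -` S \<inter> space M | \<tau> S. 0 \<le> \<tau> \<and> \<tau> \<le> t \<and> S \<in> sets borel})"

text \<open>
  The filtered probability space is complete, so the null sets of \<open>M\<close> belong to every
  \<open>\<sigma>\<close>-algebra of the filtration.
\<close>

definition agents_filtration ::
  "'w measure \<Rightarrow> nat \<Rightarrow> (nat \<Rightarrow> 'w \<Rightarrow> 'v::euclidean_space) \<Rightarrow> (nat \<Rightarrow> real \<Rightarrow> 'w \<Rightarrow> real) \<Rightarrow>
   real \<Rightarrow> 'w measure" where
  "agents_filtration M N x0 W t = sigma (space M)
     ((\<Union>i\<in>{1..N}. sets (agent_sigma M (x0 i) (W i) t)) \<union> null_sets M)"

text \<open>
  Joint measurability is what gives a meaning to the time integrals of an adapted process.
\<close>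

definition adapted_process ::
  "'w measure \<Rightarrow> (real \<Rightarrow> 'w measure) \<Rightarrow> real \<Rightarrow> (real \<Rightarrow> 'w \<Rightarrow> 'v::euclidean_space) \<Rightarrow> bool" where
  "adapted_process M F T X \<longleftrightarrow>
     (\<lambda>(t, \<omega>). X t \<omega>) \<in> borel_measurable (restrict_space borel {0..T} \<Otimes>\<^sub>M M) \<and>
     (\<forall>t\<in>{0..T}. X t \<in> borel_measurable (F t))"

definition L2_adapted ::
  "'w measure \<Rightarrow> (real \<Rightarrow> 'w measure) \<Rightarrow> real \<Rightarrow> (real \<Rightarrow> 'w \<Rightarrow> 'v::euclidean_space) set" where
  "L2_adapted M F T = {X. adapted_process M F T X \<and>
     (\<integral>\<^sup>+\<omega>. (\<integral>\<^sup>+t\<in>{0..T}. ennreal ((norm (X t \<omega>))\<^sup>2) \<partial>lborel) \<partial>M) < \<infinity>}"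

text \<open>
  Brownian motion relative to a filtration: the increments after time \<open>s\<close> are independent of the
  whole of \<open>F s\<close>, not only of the past of \<open>w\<close>.
\<close>

definition brownian_motion ::
  "'w measure \<Rightarrow> (real \<Rightarrow> 'w measure) \<Rightarrow> (real \<Rightarrow> 'w \<Rightarrow> real) \<Rightarrow> bool" where
  "brownian_motion M F w \<longleftrightarrow>
     (\<forall>t\<ge>0. w t \<in> borel_measurable M \<and> w t \<in> borel_measurable (F t)) \<and>
     (AE \<omega> in M. w 0 \<omega> = 0) \<and>
     (AE \<omega> in M. continuous_on {0..} (\<lambda>t. w t \<omega>)) \<and>
     (\<forall>s t. 0 \<le> s \<and> s < t \<longrightarrow>
        distributed M lborel (\<lambda>\<omega>. w t \<omega> - w s \<omega>) (normal_density 0 (sqrt (t - s))) \<and>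
        prob_space.indep_set M (sets (F s))
          {(\<lambda>\<omega>. w t \<omega> - w s \<omega>) -` S \<inter> space M | S. S \<in> sets borel})"

text \<open>
  A list of triples \<open>(a, b, \<xi>)\<close> represents the simple process that is the sum of the
  \<open>\<xi> 1\<^bsub>(a, b]\<^esub>\<close>; the intervals may overlap.
\<close>

definition simple_process ::
  "'w measure \<Rightarrow> (real \<Rightarrow> 'w measure) \<Rightarrow> real \<Rightarrow>
   (real \<times> real \<times> ('w \<Rightarrow> 'v::euclidean_space)) list \<Rightarrow> bool" where
  "simple_process M F T \<Phi> \<longleftrightarrow> (\<forall>(a, b, \<xi>) \<in> set \<Phi>.
     0 \<le> a \<and> a \<le> b \<and> b \<le> T \<and> \<xi> \<in> borel_measurable (F a) \<and> bounded (\<xi> ` space M))"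

definition simple_value ::
  "(real \<times> real \<times> ('w \<Rightarrow> 'v::euclidean_space)) list \<Rightarrow> real \<Rightarrow> 'w \<Rightarrow> 'v" where
  "simple_value \<Phi> t \<omega> = (\<Sum>(a, b, \<xi>)\<leftarrow>\<Phi>. indicator {a<..b} t *\<^sub>R \<xi> \<omega>)"

definition simple_integral ::
  "(real \<Rightarrow> 'w \<Rightarrow> real) \<Rightarrow> (real \<times> real \<times> ('w \<Rightarrow> 'v::euclidean_space)) list \<Rightarrow>
   real \<Rightarrow> 'w \<Rightarrow> 'v" where
  "simple_integral w \<Phi> t \<omega> = (\<Sum>(a, b, \<xi>)\<leftarrow>\<Phi>. (w (min t b) \<omega> - w (min t a) \<omega>) *\<^sub>R \<xi> \<omega>)"

text \<open>
  \<open>I\<close> is a version, with almost surely continuous paths, of the process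
  \<open>\<integral>\<^sub>0\<^sup>t \<phi> dw\<close>, \<open>t \<in> [0, T]\<close>, obtained by mean-square approximation with simple processes.
\<close>

definition ito_integral ::
  "'w measure \<Rightarrow> (real \<Rightarrow> 'w measure) \<Rightarrow> real \<Rightarrow> (real \<Rightarrow> 'w \<Rightarrow> real) \<Rightarrow>
   (real \<Rightarrow> 'w \<Rightarrow> 'v::euclidean_space) \<Rightarrow> (real \<Rightarrow> 'w \<Rightarrow> 'v) \<Rightarrow> bool" where
  "ito_integral M F T w \<phi> I \<longleftrightarrow>
     \<phi> \<in> L2_adapted M F T \<and>
     adapted_process M F T I \<and>
     (AE \<omega> in M. continuous_on {0..T} (\<lambda>t. I t \<omega>)) \<and>
     (\<exists>\<Phi> :: nat \<Rightarrow> (real \<times> real \<times> ('w \<Rightarrow> 'v)) list.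
        (\<forall>m. simple_process M F T (\<Phi> m)) \<and>
        (\<lambda>m. \<integral>\<^sup>+\<omega>. (\<integral>\<^sup>+t\<in>{0..T}. ennreal ((norm (simple_value (\<Phi> m) t \<omega> - \<phi> t \<omega>))\<^sup>2) \<partial>lborel) \<partial>M)
          \<longlonglongrightarrow> 0 \<and>
        (\<forall>t\<in>{0..T}.
          (\<lambda>m. \<integral>\<^sup>+\<omega>. ennreal ((norm (simple_integral w (\<Phi> m) t \<omega> - I t \<omega>))\<^sup>2) \<partial>M)
            \<longlonglongrightarrow> 0))"

definition agents_mean ::
  "nat \<Rightarrow> (nat \<Rightarrow> real \<Rightarrow> 'w \<Rightarrow> 'v::real_vector) \<Rightarrow> real \<Rightarrow> 'w \<Rightarrow> 'v" where
  "agents_mean N x t \<omega> = (1 / real N) *\<^sub>R (\<Sum>j\<in>{1..N}. x j t \<omega>)"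

definition admissible ::
  "'w measure \<Rightarrow> (real \<Rightarrow> 'w measure) \<Rightarrow> real \<Rightarrow> nat \<Rightarrow>
   (nat \<Rightarrow> real \<Rightarrow> 'w \<Rightarrow> real^'r) \<Rightarrow> bool" where
  "admissible M F T N u \<longleftrightarrow> (\<forall>i\<in>{1..N}. u i \<in> L2_adapted M F T)"

text \<open>
  \<open>x\<close> is a strong solution on \<open>[0, T]\<close> of the coupled state equations under the profile \<open>u\<close>.
\<close>

definition state_process ::
  "'w measure \<Rightarrow> (real \<Rightarrow> 'w measure) \<Rightarrow> real \<Rightarrow> nat \<Rightarrow>
   (nat \<Rightarrow> real \<Rightarrow> 'w \<Rightarrow> real) \<Rightarrow> (nat \<Rightarrow> 'w \<Rightarrow> real^'n) \<Rightarrow>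
   real^'n^'n \<Rightarrow> real^'r^'n \<Rightarrow> real^'n^'n \<Rightarrow> (real \<Rightarrow> real^'n) \<Rightarrow> (real \<Rightarrow> real^'n) \<Rightarrow>
   (nat \<Rightarrow> real \<Rightarrow> 'w \<Rightarrow> real^'r) \<Rightarrow> (nat \<Rightarrow> real \<Rightarrow> 'w \<Rightarrow> real^'n) \<Rightarrow> bool" where
  "state_process M F T N W x0 A B G f \<sigma> u x \<longleftrightarrow>
     (\<forall>i\<in>{1..N}.
        adapted_process M F T (x i) \<and>
        (AE \<omega> in M. continuous_on {0..T} (\<lambda>t. x i t \<omega>)) \<and>
        (\<exists>I. ito_integral M F T (W i) (\<lambda>t \<omega>. \<sigma> t) I \<and>
          (AE \<omega> in M. \<forall>t\<in>{0..T}.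
             x i t \<omega> = x0 i \<omega> +
               (LBINT \<tau>:{0..t}. A *v x i \<tau> \<omega> + B *v u i \<tau> \<omega> + G *v agents_mean N x \<tau> \<omega> + f \<tau>) +
               I t \<omega>)))"

definition agent_cost ::
  "'w measure \<Rightarrow> real \<Rightarrow> nat \<Rightarrow> real \<Rightarrow> real^'n^'n \<Rightarrow> real^'n^'n \<Rightarrow> real^'r^'r \<Rightarrow>
   (real \<Rightarrow> real^'n) \<Rightarrow> (nat \<Rightarrow> real \<Rightarrow> 'w \<Rightarrow> real^'r) \<Rightarrow> (nat \<Rightarrow> real \<Rightarrow> 'w \<Rightarrow> real^'n) \<Rightarrow>
   nat \<Rightarrow> real" where
  "agent_cost M T N \<rho> \<Gamma> Q R \<eta> u x i =
     (LINT \<omega>|M. (LBINT t:{0..T}. exp (- \<rho> * t) *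
        (wnorm2 Q (x i t \<omega> - \<Gamma> *v agents_mean N x t \<omega> - \<eta> t) + wnorm2 R (u i t \<omega>))))"

definition social_cost ::
  "'w measure \<Rightarrow> real \<Rightarrow> nat \<Rightarrow> real \<Rightarrow> real^'n^'n \<Rightarrow> real^'n^'n \<Rightarrow> real^'r^'r \<Rightarrow>
   (real \<Rightarrow> real^'n) \<Rightarrow> (nat \<Rightarrow> real \<Rightarrow> 'w \<Rightarrow> real^'r) \<Rightarrow> (nat \<Rightarrow> real \<Rightarrow> 'w \<Rightarrow> real^'n) \<Rightarrow>
   real" where
  "social_cost M T N \<rho> \<Gamma> Q R \<eta> u x = (\<Sum>i\<in>{1..N}. agent_cost M T N \<rho> \<Gamma> Q R \<eta> u x i)"

text \<open>
  The cost of a profile is evaluated along the state it generates. That state is determined up to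
  indistinguishability only, hence the quantification over all versions.
\<close>

definition optimal_control ::
  "'w measure \<Rightarrow> (real \<Rightarrow> 'w measure) \<Rightarrow> real \<Rightarrow> nat \<Rightarrow>
   (nat \<Rightarrow> real \<Rightarrow> 'w \<Rightarrow> real) \<Rightarrow> (nat \<Rightarrow> 'w \<Rightarrow> real^'n) \<Rightarrow>
   real^'n^'n \<Rightarrow> real^'r^'n \<Rightarrow> real^'n^'n \<Rightarrow> (real \<Rightarrow> real^'n) \<Rightarrow> (real \<Rightarrow> real^'n) \<Rightarrow>
   real \<Rightarrow> real^'n^'n \<Rightarrow> real^'n^'n \<Rightarrow> real^'r^'r \<Rightarrow> (real \<Rightarrow> real^'n) \<Rightarrow>
   (nat \<Rightarrow> real \<Rightarrow> 'w \<Rightarrow> real^'r) \<Rightarrow> bool" where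
  "optimal_control M F T N W x0 A B G f \<sigma> \<rho> \<Gamma> Q R \<eta> u \<longleftrightarrow>
     admissible M F T N u \<and>
     (\<exists>x. state_process M F T N W x0 A B G f \<sigma> u x) \<and>
     (\<forall>x v y. state_process M F T N W x0 A B G f \<sigma> u x \<longrightarrow>
        admissible M F T N v \<longrightarrow> state_process M F T N W x0 A B G f \<sigma> v y \<longrightarrow>
        social_cost M T N \<rho> \<Gamma> Q R \<eta> u x \<le> social_cost M T N \<rho> \<Gamma> Q R \<eta> v y)"

definition Xi_matrix :: "real^'n^'n \<Rightarrow> real^'n^'n \<Rightarrow> real^'n^'n" where
  "Xi_matrix \<Gamma> Q = transpose \<Gamma> ** Q + Q ** \<Gamma> - transpose \<Gamma> ** Q ** \<Gamma>"

definition eta_bar :: "real^'n^'n \<Rightarrow> real^'n^'n \<Rightarrow> (real \<Rightarrow> real^'n) \<Rightarrow> real \<Rightarrow> real^'n" where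
  "eta_bar \<Gamma> Q \<eta> t = Q *v \<eta> t - (transpose \<Gamma> ** Q) *v \<eta> t"

definition solves_P ::
  "real \<Rightarrow> real \<Rightarrow> real^'n^'n \<Rightarrow> real^'r^'n \<Rightarrow> real^'n^'n \<Rightarrow> real^'r^'r \<Rightarrow>
   (real \<Rightarrow> real^'n^'n) \<Rightarrow> bool" where
  "solves_P T \<rho> A B Q R P \<longleftrightarrow> P T = 0 \<and>
     (\<forall>t\<in>{0..T}. \<exists>D. (P has_vector_derivative D) (at t within {0..T}) \<and>
        \<rho> *\<^sub>R P t = D + transpose A ** P t + P t ** A + Q
          - P t ** B ** matrix_inv R ** transpose B ** P t)"

definition solves_K ::
  "real \<Rightarrow> real \<Rightarrow> real^'n^'n \<Rightarrow> real^'r^'n \<Rightarrow> real^'n^'n \<Rightarrow> real^'n^'n \<Rightarrow> real^'n^'n \<Rightarrow>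
   real^'r^'r \<Rightarrow> (real \<Rightarrow> real^'n^'n) \<Rightarrow> (real \<Rightarrow> real^'n^'n) \<Rightarrow> bool" where
  "solves_K T \<rho> A B G \<Gamma> Q R P K \<longleftrightarrow> K T = 0 \<and>
     (\<forall>t\<in>{0..T}. \<exists>D. (K has_vector_derivative D) (at t within {0..T}) \<and>
        \<rho> *\<^sub>R K t = D + transpose (A + G) ** K t + K t ** (A + G)
          + transpose G ** P t + P t ** G
          - (P t + K t) ** B ** matrix_inv R ** transpose B ** (P t + K t)
          + P t ** B ** matrix_inv R ** transpose B ** P t - Xi_matrix \<Gamma> Q)"

definition solves_s ::
  "real \<Rightarrow> real \<Rightarrow> real^'n^'n \<Rightarrow> real^'r^'n \<Rightarrow> real^'n^'n \<Rightarrow> real^'n^'n \<Rightarrow> real^'n^'n \<Rightarrow>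
   real^'r^'r \<Rightarrow> (real \<Rightarrow> real^'n) \<Rightarrow> (real \<Rightarrow> real^'n) \<Rightarrow>
   (real \<Rightarrow> real^'n^'n) \<Rightarrow> (real \<Rightarrow> real^'n^'n) \<Rightarrow> (real \<Rightarrow> real^'n) \<Rightarrow> bool" where
  "solves_s T \<rho> A B G \<Gamma> Q R f \<eta> P K s \<longleftrightarrow> s T = 0 \<and>
     (\<forall>t\<in>{0..T}. \<exists>d. (s has_vector_derivative d) (at t within {0..T}) \<and>
        \<rho> *\<^sub>R s t = d
          + transpose (A + G - B ** matrix_inv R ** transpose B ** (P t + K t)) *v s t
          + (P t + K t) *v f t - eta_bar \<Gamma> Q \<eta> t)"

definition feedback ::
  "nat \<Rightarrow> real^'r^'n \<Rightarrow> real^'r^'r \<Rightarrow>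
   (real \<Rightarrow> real^'n^'n) \<Rightarrow> (real \<Rightarrow> real^'n^'n) \<Rightarrow> (real \<Rightarrow> real^'n) \<Rightarrow>
   (nat \<Rightarrow> real \<Rightarrow> 'w \<Rightarrow> real^'n) \<Rightarrow> nat \<Rightarrow> real \<Rightarrow> 'w \<Rightarrow> real^'r" where
  "feedback N B R P K s x i t \<omega> =
     - ((matrix_inv R ** transpose B) *v (P t *v x i t \<omega> + K t *v agents_mean N x t \<omega> + s t))"

end

theory Submission
  imports Defs
begin

text \<open>
  Let \<open>x\<close> be the state under the feedback \<open>u\<close>, let \<open>y\<close> be the state under any other profile \<open>v\<close>, and put
  \<open>h = y - x\<close>, \<open>z = x + y\<close>. The noise cancels in \<open>h\<close>, so its paths are absolutely continuous, and the
  difference of the costs is bilinear in \<open>(h, v - u)\<close> and \<open>(z, u + v)\<close>. With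
  \<open>\<gamma>\<^sub>i = e\<^bsup>-\<rho>t\<^esup> (P h\<^sub>i + K h\<^bsup>(N)\<^esup>)\<close>, which vanishes at both ends of \<open>[0, T]\<close>, integration by parts of
  \<open>\<Sum>\<^sub>i (z\<^sub>i - 2 I\<^sub>i) \<bullet> \<gamma>\<^sub>i + 2 e\<^bsup>-\<rho>t\<^esup> h\<^sub>i \<bullet> s\<close> along a single path, where \<open>I\<^sub>i\<close> is the noise of agent \<open>i\<close>, and the
  equations for \<open>P\<close>, \<open>K\<close>, \<open>s\<close> turn this difference into the discounted time integral of the squares
  \<open>\<parallel>v\<^sub>i - u\<^sub>i + R\<inverse> B\<^sup>T (P h\<^sub>i + K h\<^bsup>(N)\<^esup>)\<parallel>\<^sub>R\<^sup>2\<close> minus twice the integral of \<open>\<Sum>\<^sub>i I\<^sub>i \<bullet> \<gamma>\<^sub>i'\<close>. The latter has mean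
  zero: \<open>\<gamma>\<^sub>i' t\<close> is known at time \<open>t\<close> and \<open>I\<^sub>i\<close> is a martingale, so \<open>I\<^sub>i t\<close> may be replaced by \<open>I\<^sub>i T\<close>, and
  \<open>\<gamma>\<^sub>i'\<close> integrates to zero. Thus no differential calculus for semimartingales is needed, only the
  isometry, the martingale property and a maximal inequality for integrals of simple processes.

  The closed loop is solved path by path with a fundamental matrix: first the average of the states,
  then the deviations of the agents from it.
\<close>

section \<open>Linear differential equations\<close>

text \<open>The form of \<open>\<gamma>\<close> reflects the symmetry between the agents: a
  quadratic value function of the population that is invariant under permutations has one block
  \<open>P\<close> for the own state and one block \<open>K\<close> for the average, and P x + K
  x^(N) + s is then the costate of an agent. Differences of quadratic forms factor as a - b against
  S(a + b), and the first factor is free of noise; this is why no second-order correction terms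
  arise. The second factor carries the noise twice, hence 2 I. The controls are merely square
  integrable in time, so the paths of \<open>h\<close> are absolutely continuous instead of
  continuously differentiable, and the product rule has to come from Fubini's theorem. In the closed
  loop the average satisfies an equation of its own and the deviations from it are not coupled, so
  matrices of size n suffice for a system of Nn unknowns. The maximal inequality serves to construct
  a noise with continuous paths.\<close>

lemma bounded_bilinear_matrix_vector_mult:
  "bounded_bilinear ((*v) :: real^'n^'m \<Rightarrow> real^'n \<Rightarrow> real^'m)"
proof -
  have "bilinear ((*v) :: real^'n^'m \<Rightarrow> real^'n \<Rightarrow> real^'m)"
    unfolding bilinear_def
    by (auto intro!: linearI simp: matrix_vector_mult_def vec_eq_iff algebra_simps sum.distrib
        sum_distrib_left)
  then show ?thesis
    by (simp add: bilinear_conv_bounded_bilinear)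
qed

lemma bounded_bilinear_matrix_matrix_mult:
  "bounded_bilinear ((**) :: real^'n^'m \<Rightarrow> real^'k^'n \<Rightarrow> real^'k^'m)"
proof -
  have "bilinear ((**) :: real^'n^'m \<Rightarrow> real^'k^'n \<Rightarrow> real^'k^'m)"
    unfolding bilinear_def
    by (auto intro!: linearI simp: matrix_matrix_mult_def vec_eq_iff algebra_simps sum.distrib
        sum_distrib_left)
  then show ?thesis
    by (simp add: bilinear_conv_bounded_bilinear)
qed

lemmas continuous_on_matrix_vector [continuous_intros] =
  bounded_bilinear.continuous_on [OF bounded_bilinear_matrix_vector_mult]

lemmas continuous_on_matrix_matrix [continuous_intros] =
  bounded_bilinear.continuous_on [OF bounded_bilinear_matrix_matrix_mult]

lemma bounded_linear_transpose: "bounded_linear (transpose :: real^'n^'m \<Rightarrow> real^'m^'n)"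
proof -
  have "linear (transpose :: real^'n^'m \<Rightarrow> real^'m^'n)"
    by (auto intro!: linearI simp: transpose_def vec_eq_iff)
  then show ?thesis by (simp add: linear_conv_bounded_linear)
qed

lemma bounded_bilinear_pos_bound:
  fixes prod :: "'a::real_normed_vector \<Rightarrow> 'b::real_normed_vector \<Rightarrow> 'c::real_normed_vector"
  assumes "bounded_bilinear prod"
  obtains c where "c > 0" "\<And>a b. norm (prod a b) \<le> c * (norm a * norm b)"
  using bounded_bilinear.pos_bounded[OF assms] by (auto simp: mult.commute mult.left_commute)

lemma continuous_on_interval_bound:
  fixes c :: "real \<Rightarrow> 'a::real_normed_vector"
  assumes "continuous_on {0..T} c"
  shows "\<exists>l>0. \<forall>t\<in>{0..T}. norm (c t) \<le> l"
proof -
  have "compact (c ` {0..T})" by (intro compact_continuous_image assms compact_Icc)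
  then have "bounded (c ` {0..T})" by (rule compact_imp_bounded)
  then show ?thesis unfolding bounded_pos by auto
qed

text \<open>With \<open>Z\<close> the integral of \<open>y\<close>, the function
  \<open>exp (- C * t) * Z t\<close> minus the integral of \<open>a\<close> is nonincreasing. The
  resulting bound is cruder than the usual one with an exponential kernel, but it is linear in
  \<open>a\<close>, so square integrability of \<open>a\<close> passes to it.\<close>

lemma gronwall_integral:
  fixes y a :: "real \<Rightarrow> real"
  assumes y: "continuous_on {0..T} y" and a: "continuous_on {0..T} a"
    and C: "C \<ge> 0" and a0: "\<And>t. t \<in> {0..T} \<Longrightarrow> a t \<ge> 0"
    and le: "\<And>t. t \<in> {0..T} \<Longrightarrow> y t \<le> a t + C * integral {0..t} y"
    and t: "t \<in> {0..T}"
  shows "y t \<le> a t + C * exp (C * T) * integral {0..T} a"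
proof -
  define Z where "Z = (\<lambda>t. integral {0..t} y)"
  define U where "U = (\<lambda>t. exp (- C * t) * Z t - integral {0..t} a)"
  have Z: "(Z has_real_derivative y x) (at x within {0..T})" if "x \<in> {0..T}" for x
    using integral_has_vector_derivative[OF y that]
    by (simp add: Z_def has_real_derivative_iff_has_vector_derivative)
  have A: "((\<lambda>t. integral {0..t} a) has_real_derivative a x) (at x within {0..T})"
    if "x \<in> {0..T}" for x
    using integral_has_vector_derivative[OF a that]
    by (simp add: has_real_derivative_iff_has_vector_derivative)
  have U: "(U has_real_derivative exp (- C * x) * (y x - C * Z x) - a x) (at x within {0..T})"
    if "x \<in> {0..T}" for x
    unfolding U_def using Z[OF that] A[OF that]
    by (auto intro!: derivative_eq_intros simp: algebra_simps)
  have Upos: "exp (- C * x) * (y x - C * Z x) - a x \<le> 0" if "x \<in> {0..T}" for x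
  proof -
    have "exp (- C * x) * (y x - C * Z x) \<le> exp (- C * x) * a x"
      using le[OF that] by (intro mult_left_mono) (auto simp: Z_def)
    also have "\<dots> \<le> 1 * a x"
      using a0[OF that] C that by (intro mult_right_mono) auto
    finally show ?thesis by simp
  qed
  have "U 0 \<ge> U t"
  proof (cases "t = 0")
    case False
    with t have "0 \<le> t" by auto
    then show ?thesis
    proof (rule DERIV_nonpos_imp_decreasing_open)
      fix x assume x: "0 < x" "x < t"
      then have "x \<in> {0..T}" using t by auto
      moreover have "at x within {0..T} = at x"
        using x t by (intro at_within_interior) (auto simp: interior_atLeastAtMost_real)
      ultimately show "\<exists>y. (U has_real_derivative y) (at x) \<and> y \<le> 0"
        using U[of x] Upos[of x] by auto
    next
      have "continuous_on {0..T} U"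
        using U by (rule DERIV_continuous_on)
      then show "continuous_on {0..t} U"
        by (rule continuous_on_subset) (use t in auto)
    qed
  qed simp
  then have "exp (- C * t) * Z t \<le> integral {0..t} a"
    by (simp add: U_def Z_def)
  also have "\<dots> \<le> integral {0..T} a"
    using t a0 a by (intro integral_subset_le) (auto intro!: integrable_continuous_real
        intro: continuous_on_subset)
  finally have "Z t \<le> exp (C * t) * integral {0..T} a"
    by (simp add: exp_minus field_simps)
  also have "\<dots> \<le> exp (C * T) * integral {0..T} a"
    using t C a0 a by (intro mult_right_mono Henstock_Kurzweil_Integration.integral_nonneg) 
       (auto intro!: integrable_continuous_real mult_left_mono)
  finally have "C * Z t \<le> C * (exp (C * T) * integral {0..T} a)"
    using C by (intro mult_left_mono)
  then show ?thesis using le[OF t] by (simp add: Z_def mult.assoc)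
qed

text \<open>Backward uniqueness: \<open>exp (2 * C * t)\<close> times the squared norm cannot
  decrease, and it vanishes at \<open>T\<close>. Only a bound of the derivative by the value enters,
  so the lemma serves any linear equation with bounded coefficients.\<close>

lemma norm_linear_ode_terminal_zero:
  fixes D :: "real \<Rightarrow> 'a::real_inner"
  assumes D: "\<And>t. t \<in> {0..T} \<Longrightarrow> \<exists>d. (D has_vector_derivative d) (at t within {0..T}) \<and> norm d \<le> C * norm (D t)"
    and T: "D T = 0" and t: "t \<in> {0..T}"
  shows "D t = 0"
proof -
  define V where "V = (\<lambda>t. - exp (2 * C * t) * (D t \<bullet> D t))"
  have V: "\<exists>v. (V has_real_derivative v) (at x within {0..T}) \<and> v \<le> 0" if x: "x \<in> {0..T}" for x
  proof -
    obtain d where d: "(D has_vector_derivative d) (at x within {0..T})" "norm d \<le> C * norm (D x)"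
      using D[OF x] by auto
    have "((\<lambda>t. D t \<bullet> D t) has_vector_derivative (D x \<bullet> d + d \<bullet> D x)) (at x within {0..T})"
      by (rule bounded_bilinear.has_vector_derivative[OF bounded_bilinear_inner d(1) d(1)])
    then have 1: "((\<lambda>t. D t \<bullet> D t) has_real_derivative (2 * (D x \<bullet> d))) (at x within {0..T})"
      by (simp add: has_real_derivative_iff_has_vector_derivative inner_commute)
    have "(V has_real_derivative - exp (2 * C * x) * (2 * (C * (D x \<bullet> D x) + D x \<bullet> d))) (at x within {0..T})"
      unfolding V_def by (rule derivative_eq_intros 1 refl | simp add: algebra_simps)+
    moreover have "\<bar>D x \<bullet> d\<bar> \<le> norm (D x) * norm d" by (rule Cauchy_Schwarz_ineq2)
    then have "\<bar>D x \<bullet> d\<bar> \<le> C * (D x \<bullet> D x)"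
      using mult_left_mono[OF d(2), of "norm (D x)"]
      by (simp add: power2_norm_eq_inner[symmetric] power2_eq_square mult_ac)
    ultimately show ?thesis
      by (intro exI[of _ "- exp (2 * C * x) * (2 * (C * (D x \<bullet> D x) + D x \<bullet> d))"])
        (auto simp: mult_le_0_iff)
  qed
  have "V t \<ge> V T"
  proof (cases "t = T")
    case False
    with t have "t \<le> T" by auto
    then show ?thesis
    proof (rule DERIV_nonpos_imp_decreasing_open)
      fix x assume x: "t < x" "x < T"
      then have "x \<in> {0..T}" using t by auto
      moreover have "at x within {0..T} = at x"
        using x t by (intro at_within_interior) (auto simp: interior_atLeastAtMost_real)
      ultimately show "\<exists>y. (V has_real_derivative y) (at x) \<and> y \<le> 0"
        using V[of x] by auto
    next
      have "continuous_on {0..T} V"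
        using V by (meson has_real_derivative_imp_continuous_on DERIV_continuous continuous_on_eq_continuous_within)
      then show "continuous_on {t..T} V"
        by (rule continuous_on_subset) (use t in auto)
    qed
  qed simp
  then have "exp (2 * C * t) * (D t \<bullet> D t) \<le> 0"
    by (simp add: V_def T)
  then have "D t \<bullet> D t \<le> 0"
    by (simp add: mult_le_0_iff)
  then show ?thesis by (metis inner_eq_zero_iff inner_ge_zero order_antisym)
qed

text \<open>The fundamental matrix is the sum of the iterated integrals \<open>u m\<close> of
  \<open>L\<close> (Peano-Baker series). The factorial bound makes the series converge uniformly,
  and the integral equation of the partial sums passes to the limit.\<close>

lemma linear_matrix_ode:
  fixes L :: "real \<Rightarrow> real^'n^'n"
  assumes T: "T \<ge> 0" and L: "continuous_on {0..T} L"
  obtains \<Phi> where "\<Phi> 0 = mat 1"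
    "\<And>t. t \<in> {0..T} \<Longrightarrow> (\<Phi> has_vector_derivative L t ** \<Phi> t) (at t within {0..T})"
proof -
  obtain k where k: "k > 0" "\<And>a b. norm ((a::real^'n^'n) ** (b::real^'n^'n)) \<le> k * (norm a * norm b)"
    using bounded_bilinear_pos_bound[OF bounded_bilinear_matrix_matrix_mult] by blast
  obtain l where l: "l > 0" "\<And>t. t \<in> {0..T} \<Longrightarrow> norm (L t) \<le> l"
    using continuous_on_interval_bound[OF L] by blast
  \<comment> \<open>\<open>k\<close> bounds the matrix product as a bilinear map, so it is
    immaterial whether the norm is submultiplicative.\<close>
  define c where "c = k * l"
  have c: "c > 0" using k l by (simp add: c_def)
  define u where "u = rec_nat (\<lambda>t::real. mat 1 :: real^'n^'n) (\<lambda>m v t. integral {0..t} (\<lambda>\<tau>. L \<tau> ** v \<tau>))"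
  have u0: "u 0 = (\<lambda>t. mat 1)" and uS: "u (Suc m) = (\<lambda>t. integral {0..t} (\<lambda>\<tau>. L \<tau> ** u m \<tau>))" for m
    by (simp_all add: u_def)
  have cont: "continuous_on {0..T} (u m)" for m
  proof (induction m)
    case (Suc m)
    then show ?case unfolding uS
      by (intro indefinite_integral_continuous_1 integrable_continuous_real continuous_intros L)
  qed (simp add: u0)
  have contLu: "continuous_on {0..T} (\<lambda>\<tau>. L \<tau> ** u m \<tau>)" for m
    by (intro continuous_intros L cont)
  define a where "a = norm (mat 1 :: real^'n^'n)"
  have bound: "t \<in> {0..T} \<Longrightarrow> norm (u m t) \<le> a * (c * t) ^ m / fact m" for m t
  proof (induction m arbitrary: t)
    case 0
    then show ?case by (simp add: u0 a_def)
  next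
    case (Suc m)
    \<comment> \<open>The coefficient of \<open>t ^ Suc m\<close> in the claimed bound;
      differentiating that power reproduces the bound on the integrand.\<close>
    define d where "d = a * c ^ Suc m / fact (Suc m)"
    have d: "d * (real (Suc m) * \<tau> ^ m) = a * c ^ Suc m * \<tau> ^ m / fact m" for \<tau>
    proof -
      have "(fact (Suc m) :: real) = real (Suc m) * fact m" by (simp only: fact_Suc of_nat_mult)
      then show ?thesis by (simp add: d_def field_simps del: of_nat_Suc fact_Suc)
    qed
    have "((\<lambda>\<tau>. d * (real (Suc m) * \<tau> ^ m)) has_integral d * t ^ Suc m - d * 0 ^ Suc m) {0..t}"
    proof (rule fundamental_theorem_of_calculus)
      fix \<tau> assume "\<tau> \<in> {0..t}"
      have "((\<lambda>\<tau>. d * \<tau> ^ Suc m) has_real_derivative d * (real (Suc m) * \<tau> ^ m)) (at \<tau> within {0..t})"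
        by (rule derivative_eq_intros refl)+ simp
      then show "((\<lambda>\<tau>. d * \<tau> ^ Suc m) has_vector_derivative d * (real (Suc m) * \<tau> ^ m)) (at \<tau> within {0..t})"
        by (simp only: has_real_derivative_iff_has_vector_derivative)
    qed (use Suc.prems in auto)
    then have I: "((\<lambda>\<tau>. a * c ^ Suc m * \<tau> ^ m / fact m) has_integral
        a * (c * t) ^ Suc m / fact (Suc m)) {0..t}"
      unfolding d by (simp add: d_def power_mult_distrib mult_ac)
    have "norm (integral {0..t} (\<lambda>\<tau>. L \<tau> ** u m \<tau>)) \<le> integral {0..t} (\<lambda>\<tau>. a * c ^ Suc m * \<tau> ^ m / fact m)"
    proof (rule integral_norm_bound_integral)
      show "(\<lambda>\<tau>. L \<tau> ** u m \<tau>) integrable_on {0..t}"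
        using Suc.prems by (intro integrable_continuous_real continuous_on_subset[OF contLu]) auto
      show "(\<lambda>\<tau>. a * c ^ Suc m * \<tau> ^ m / fact m) integrable_on {0..t}"
        using I by blast
      fix \<tau> assume \<tau>: "\<tau> \<in> {0..t}"
      then have \<tau>T: "\<tau> \<in> {0..T}" using Suc.prems by auto
      have "norm (L \<tau> ** u m \<tau>) \<le> k * (norm (L \<tau>) * norm (u m \<tau>))" by (rule k)
      also have "\<dots> \<le> k * (l * (a * (c * \<tau>) ^ m / fact m))"
        using k l \<tau>T Suc.IH[OF \<tau>T] by (intro mult_left_mono mult_mono) auto
      finally show "norm (L \<tau> ** u m \<tau>) \<le> a * c ^ Suc m * \<tau> ^ m / fact m"
        by (simp add: c_def power_mult_distrib mult_ac)
    qed
    also have "\<dots> = a * (c * t) ^ Suc m / fact (Suc m)"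
      using I by blast
    finally show ?case by (simp add: uS)
  qed
  define S where "S = (\<lambda>m t. \<Sum>i<m. u i t)"
  define \<Phi> where "\<Phi> = (\<lambda>t. suminf (\<lambda>i. u i t))"
  have ul: "uniform_limit {0..T} S \<Phi> sequentially"
    unfolding S_def \<Phi>_def
  proof (rule Weierstrass_m_test)
    fix m t assume t: "t \<in> {0..T}"
    have "norm (u m t) \<le> a * (c * t) ^ m / fact m" by (rule bound[OF t])
    also have "\<dots> \<le> a * (c * T) ^ m / fact m"
      using t c by (intro divide_right_mono mult_left_mono power_mono) (auto simp: a_def)
    finally show "norm (u m t) \<le> a * ((c * T) ^ m / fact m)" by simp
  next
    have "summable (\<lambda>m. (c * T) ^ m / fact m)"
      using summable_exp[of "c * T"] by (simp add: field_simps)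
    then show "summable (\<lambda>m. a * ((c * T) ^ m / fact m))"
      by (rule summable_mult)
  qed
  have Scont: "continuous_on {0..T} (S m)" for m
    unfolding S_def by (intro continuous_intros cont)
  have \<Phi>cont: "continuous_on {0..T} \<Phi>"
    by (rule uniform_limit_theorem[OF _ ul]) (auto simp: Scont)
  have ulL: "uniform_limit {0..T} (\<lambda>m t. L t ** S m t) (\<lambda>t. L t ** \<Phi> t) sequentially"
  proof (rule uniform_limitI)
    fix e :: real assume e: "e > 0"
    have "\<forall>\<^sub>F m in sequentially. \<forall>t\<in>{0..T}. dist (S m t) (\<Phi> t) < e / c"
      using uniform_limitD[OF ul, of "e / c"] e c by auto
    then show "\<forall>\<^sub>F m in sequentially. \<forall>t\<in>{0..T}. dist (L t ** S m t) (L t ** \<Phi> t) < e"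
    proof (eventually_elim, intro ballI)
      fix m t assume A: "\<forall>t\<in>{0..T}. dist (S m t) (\<Phi> t) < e / c" and t: "t \<in> {0..T}"
      have "dist (L t ** S m t) (L t ** \<Phi> t) = norm (L t ** (S m t - \<Phi> t))"
        by (simp add: dist_norm bounded_bilinear.diff_right[OF bounded_bilinear_matrix_matrix_mult])
      also have "\<dots> \<le> k * (norm (L t) * norm (S m t - \<Phi> t))" by (rule k)
      also have "\<dots> \<le> k * (l * norm (S m t - \<Phi> t))"
        using k l t by (intro mult_left_mono mult_right_mono) auto
      also have "\<dots> = c * dist (S m t) (\<Phi> t)" by (simp add: c_def dist_norm)
      also have "\<dots> < e" using A t c by (auto simp: field_simps)
      finally show "dist (L t ** S m t) (L t ** \<Phi> t) < e" .
    qed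
  qed
  have Sint: "S (Suc m) t = mat 1 + integral {0..t} (\<lambda>\<tau>. L \<tau> ** S m \<tau>)" if t: "t \<in> {0..T}" for m t
  proof -
    have "integral {0..t} (\<lambda>\<tau>. L \<tau> ** S m \<tau>) = integral {0..t} (\<lambda>\<tau>. \<Sum>i<m. L \<tau> ** u i \<tau>)"
      by (simp add: S_def bounded_bilinear.sum_right[OF bounded_bilinear_matrix_matrix_mult])
    also have "\<dots> = (\<Sum>i<m. u (Suc i) t)"
      unfolding uS using t
      by (intro Henstock_Kurzweil_Integration.integral_sum integrable_continuous_real continuous_on_subset[OF contLu]) auto
    finally show ?thesis
      by (simp add: S_def sum.lessThan_Suc_shift u0 del: sum.lessThan_Suc)
  qed
  have \<Phi>int: "\<Phi> t = mat 1 + integral {0..t} (\<lambda>\<tau>. L \<tau> ** \<Phi> \<tau>)" if t: "t \<in> {0..T}" for t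
  proof -
    have ul': "uniform_limit {0..t} (\<lambda>m t. L t ** S m t) (\<lambda>t. L t ** \<Phi> t) sequentially"
      using ulL by (rule uniform_limit_on_subset) (use t in auto)
    obtain I J where IJ: "\<And>m. ((\<lambda>\<tau>. L \<tau> ** S m \<tau>) has_integral I m) {0..t}"
        "((\<lambda>\<tau>. L \<tau> ** \<Phi> \<tau>) has_integral J) {0..t}" "(I \<longlongrightarrow> J) sequentially"
    proof (rule uniform_limit_integral[OF ul'])
      show "continuous_on {0..t} (\<lambda>\<tau>. L \<tau> ** S m \<tau>)" for m
        by (rule continuous_on_subset[of "{0..T}"]) (use t in \<open>auto intro!: continuous_intros L Scont\<close>)
    qed auto
    have "(\<lambda>m. integral {0..t} (\<lambda>\<tau>. L \<tau> ** S m \<tau>)) \<longlonglongrightarrow> integral {0..t} (\<lambda>\<tau>. L \<tau> ** \<Phi> \<tau>)"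
      using IJ by (metis (no_types, lifting) ext integral_unique)
    then have "(\<lambda>m. S (Suc m) t) \<longlonglongrightarrow> mat 1 + integral {0..t} (\<lambda>\<tau>. L \<tau> ** \<Phi> \<tau>)"
      unfolding Sint[OF t] by (intro tendsto_intros)
    moreover have "(\<lambda>m. S (Suc m) t) \<longlonglongrightarrow> \<Phi> t"
      using tendsto_uniform_limitI[OF ul t] by (rule LIMSEQ_Suc)
    ultimately show ?thesis by (rule LIMSEQ_unique[rotated])
  qed
  show thesis
  proof (rule that)
    show "\<Phi> 0 = mat 1" using \<Phi>int[of 0] T by simp
    fix t assume t: "t \<in> {0..T}"
    have "((\<lambda>t. mat 1 + integral {0..t} (\<lambda>\<tau>. L \<tau> ** \<Phi> \<tau>)) has_vector_derivative L t ** \<Phi> t) (at t within {0..T})"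
      using integral_has_vector_derivative[of 0 T "\<lambda>\<tau>. L \<tau> ** \<Phi> \<tau>" t] t
      by (auto intro!: derivative_eq_intros continuous_intros L \<Phi>cont)
    then show "(\<Phi> has_vector_derivative L t ** \<Phi> t) (at t within {0..T})"
      by (rule has_vector_derivative_transform[rotated -1]) (use t \<Phi>int in auto)
  qed
qed

section \<open>Absolutely continuous paths\<close>

text \<open>\<open>g'\<close> is integrable and determined almost everywhere: the controls are no
  better than square integrable in time, so a state path minus its noise need not have a derivative
  at every point. The derivative is an explicit argument because the later computation manipulates
  it.\<close>

definition abs_cont :: "real \<Rightarrow> (real \<Rightarrow> 'a::euclidean_space) \<Rightarrow> (real \<Rightarrow> 'a) \<Rightarrow> bool" where
  "abs_cont T g g' \<longleftrightarrow> set_integrable lborel {0..T} g' \<and>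
     (\<forall>t\<in>{0..T}. g t = g 0 + (LBINT \<tau>:{0..t}. g' \<tau>))"

lemma abs_cont_set_integrable: "abs_cont T g g' \<Longrightarrow> set_integrable lborel {0..T} g'"
  by (simp add: abs_cont_def)

lemma abs_cont_eq: "abs_cont T g g' \<Longrightarrow> t \<in> {0..T} \<Longrightarrow> g t = g 0 + (LBINT \<tau>:{0..t}. g' \<tau>)"
  unfolding abs_cont_def by blast

lemma set_integrable_continuous_interval:
  fixes g :: "real \<Rightarrow> 'a::euclidean_space"
  assumes "continuous_on {a..b} g"
  shows "set_integrable lborel {a..b} g"
  unfolding set_integrable_def
  by (rule borel_integrable_compact[OF compact_Icc assms])

lemma continuous_on_LBINT:
  fixes g :: "real \<Rightarrow> 'a::euclidean_space"
  assumes "set_integrable lborel {0..T} g"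
  shows "continuous_on {0..T} (\<lambda>t. LBINT \<tau>:{0..t}. g \<tau>)"
proof -
  have "continuous_on {0..T} (\<lambda>t. integral {0..t} g)"
    by (rule indefinite_integral_continuous_1[OF set_borel_integral_eq_integral(1)[OF assms]])
  then show ?thesis
    by (rule continuous_on_eq)
      (auto intro!: set_borel_integral_eq_integral(2)[symmetric] set_integrable_subset[OF assms])
qed

lemma abs_cont_continuous_on:
  assumes "abs_cont T g g'"
  shows "continuous_on {0..T} g"
proof -
  have "continuous_on {0..T} (\<lambda>t. g 0 + (LBINT \<tau>:{0..t}. g' \<tau>))"
    by (intro continuous_intros continuous_on_LBINT abs_cont_set_integrable[OF assms])
  then show ?thesis
    by (rule continuous_on_eq) (rule abs_cont_eq[OF assms, symmetric])
qed

lemma abs_contI: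
  assumes "\<And>t. t \<in> {0..T} \<Longrightarrow> (g has_vector_derivative g' t) (at t within {0..T})"
    and "continuous_on {0..T} g'"
  shows "abs_cont T g g'"
  unfolding abs_cont_def
proof (intro conjI ballI)
  show "set_integrable lborel {0..T} g'"
    by (rule set_integrable_continuous_interval) fact
  fix t assume t: "t \<in> {0..T}"
  have "set_integrable lborel {0..t} g'"
    by (intro set_integrable_continuous_interval continuous_on_subset[OF assms(2)]) (use t in auto)
  then have "(LBINT \<tau>:{0..t}. g' \<tau>) = integral {0..t} g'"
    by (rule set_borel_integral_eq_integral)
  also have "(g' has_integral g t - g 0) {0..t}"
  proof (rule fundamental_theorem_of_calculus)
    fix x assume "x \<in> {0..t}"
    then show "(g has_vector_derivative g' x) (at x within {0..t})"
      using t by (intro has_vector_derivative_within_subset[OF assms(1)]) auto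
  qed (use t in auto)
  then have "integral {0..t} g' = g t - g 0" by blast
  finally show "g t = g 0 + (LBINT \<tau>:{0..t}. g' \<tau>)" by simp
qed

lemma abs_cont_add:
  assumes "abs_cont T a a'" "abs_cont T b b'"
  shows "abs_cont T (\<lambda>t. a t + b t) (\<lambda>t. a' t + b' t)"
  unfolding abs_cont_def
proof (intro conjI ballI)
  show "set_integrable lborel {0..T} (\<lambda>t. a' t + b' t)"
    using assms by (simp add: abs_cont_set_integrable)
  fix t assume t: "t \<in> {0..T}"
  have "set_integrable lborel {0..t} a'" "set_integrable lborel {0..t} b'"
    using t by (auto intro: set_integrable_subset[OF abs_cont_set_integrable[OF assms(1)]]
      set_integrable_subset[OF abs_cont_set_integrable[OF assms(2)]])
  then show "a t + b t = a 0 + b 0 + (LBINT \<tau>:{0..t}. a' \<tau> + b' \<tau>)"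
    using abs_cont_eq[OF assms(1) t] abs_cont_eq[OF assms(2) t] by simp
qed

lemma abs_cont_const: "abs_cont T (\<lambda>t. c) (\<lambda>t. 0)"
  by (simp add: abs_cont_def set_integrable_def)

lemma abs_cont_sum:
  assumes "\<And>i. i \<in> I \<Longrightarrow> abs_cont T (a i) (a' i)"
  shows "abs_cont T (\<lambda>t. \<Sum>i\<in>I. a i t) (\<lambda>t. \<Sum>i\<in>I. a' i t)"
  using assms
proof (induction I rule: infinite_finite_induct)
  case (insert i I)
  then show ?case by (simp add: abs_cont_add)
qed (simp_all add: abs_cont_const)

lemma abs_cont_bounded_linear:
  assumes "bounded_linear L" "abs_cont T a a'"
  shows "abs_cont T (\<lambda>t. L (a t)) (\<lambda>t. L (a' t))"
  unfolding abs_cont_def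
proof (intro conjI ballI)
  have *: "indicator A t *\<^sub>R L (a' t) = L (indicator A t *\<^sub>R a' t)" for t :: real and A
    by (simp add: linear_scale[OF bounded_linear.linear[OF assms(1)]])
  show "set_integrable lborel {0..T} (\<lambda>t. L (a' t))"
    using abs_cont_set_integrable[OF assms(2)] assms(1) unfolding set_integrable_def *
    by (rule integrable_bounded_linear[rotated])
  fix t assume t: "t \<in> {0..T}"
  have "set_integrable lborel {0..t} a'"
    using t by (intro set_integrable_subset[OF abs_cont_set_integrable[OF assms(2)]]) auto
  then have "(LBINT \<tau>:{0..t}. L (a' \<tau>)) = L (LBINT \<tau>:{0..t}. a' \<tau>)"
    using assms(1) unfolding set_integrable_def set_lebesgue_integral_def *
    by (intro integral_bounded_linear)
  then show "L (a t) = L (a 0) + (LBINT \<tau>:{0..t}. L (a' \<tau>))"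
    using abs_cont_eq[OF assms(2) t] by (simp add: linear_add[OF bounded_linear.linear[OF assms(1)]])
qed

lemma borel_measurable_bounded_bilinear:
  fixes prod :: "'a::euclidean_space \<Rightarrow> 'b::euclidean_space \<Rightarrow> 'c::euclidean_space"
  assumes bil: "bounded_bilinear prod"
    and "f \<in> borel_measurable M" "g \<in> borel_measurable M"
  shows "(\<lambda>x. prod (f x) (g x)) \<in> borel_measurable M"
  using assms(2,3)
  by (rule borel_measurable_continuous_Pair)
    (intro bounded_bilinear.continuous_on[OF bil] continuous_intros)

lemma set_integrable_bilinear_continuous:
  fixes prod :: "'a::euclidean_space \<Rightarrow> 'b::euclidean_space \<Rightarrow> 'c::euclidean_space"
  assumes bil: "bounded_bilinear prod" and a: "set_integrable lborel {0..T::real} a"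
    and b: "continuous_on {0..T} b"
  shows "set_integrable lborel {0..T} (\<lambda>t. prod (a t) (b t))"
proof -
  obtain k where k: "k > 0" "\<And>a b. norm (prod a b) \<le> k * (norm a * norm b)"
    using bounded_bilinear_pos_bound[OF bil] by blast
  obtain l where l: "l > 0" "\<And>t. t \<in> {0..T} \<Longrightarrow> norm (b t) \<le> l"
    using continuous_on_interval_bound[OF b] by blast
  have eq: "indicator {0..T} t *\<^sub>R prod (a t) (b t) =
      prod (indicator {0..T} t *\<^sub>R a t) (indicator {0..T} t *\<^sub>R b t)" for t
    by (simp add: indicator_def bounded_bilinear.zero_left[OF bil])
  have bm: "(\<lambda>t. indicator {0..T} t *\<^sub>R b t) \<in> borel_measurable lborel"
    using set_integrable_continuous_interval[OF b] unfolding set_integrable_def by auto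
  have am: "(\<lambda>t. indicator {0..T} t *\<^sub>R a t) \<in> borel_measurable lborel"
    using a unfolding set_integrable_def by auto
  show ?thesis unfolding set_integrable_def
  proof (rule Bochner_Integration.integrable_bound)
    show "integrable lborel (\<lambda>t. k * l * norm (indicator {0..T} t *\<^sub>R a t))"
      using a unfolding set_integrable_def by (intro integrable_mult_right integrable_norm)
    show "(\<lambda>t. indicator {0..T} t *\<^sub>R prod (a t) (b t)) \<in> borel_measurable lborel"
      unfolding eq by (rule borel_measurable_bounded_bilinear[OF bil am bm])
    show "AE t in lborel. norm (indicator {0..T} t *\<^sub>R prod (a t) (b t))
        \<le> norm (k * l * norm (indicator {0..T} t *\<^sub>R a t))"
    proof (rule AE_I2)
      fix t
      show "norm (indicator {0..T} t *\<^sub>R prod (a t) (b t))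
        \<le> norm (k * l * norm (indicator {0..T} t *\<^sub>R a t))"
      proof (cases "t \<in> {0..T}")
        case True
        have "norm (prod (a t) (b t)) \<le> k * (norm (a t) * norm (b t))" by (rule k)
        also have "\<dots> \<le> k * (norm (a t) * l)"
          using k l True by (intro mult_left_mono) auto
        finally show ?thesis using True k l by (simp add: abs_mult mult_ac)
      qed simp
    qed
  qed
qed

text \<open>Fubini's theorem on the two triangles \<open>s \<le> t\<close> and \<open>t < s\<close>,
  which partition the plane.\<close>

lemma integral_triangle_bilinear:
  fixes prod :: "'a::euclidean_space \<Rightarrow> 'b::euclidean_space \<Rightarrow> 'c::euclidean_space"
  assumes bil: "bounded_bilinear prod"
    and a: "integrable lborel a" and b: "integrable lborel (b :: real \<Rightarrow> _)"
  shows "(LBINT t. prod (a t) (LBINT s:{..t}. b s)) + (LBINT s. prod (LBINT t:{..s}. a t) (b s))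
    = prod (LBINT t. a t) (LBINT s. b s)"
proof -
  obtain k where k: "k > 0" "\<And>a b. norm (prod a b) \<le> k * (norm a * norm b)"
    using bounded_bilinear_pos_bound[OF bil] by blast
  have am[measurable]: "a \<in> borel_measurable borel" and bm[measurable]: "b \<in> borel_measurable borel"
    using a b by auto
  have abm[measurable]: "(\<lambda>z. prod (a (fst z)) (b (snd z))) \<in> borel_measurable (lborel \<Otimes>\<^sub>M lborel)"
    by (rule borel_measurable_bounded_bilinear[OF bil]) measurable
  have int: "integrable (lborel \<Otimes>\<^sub>M lborel) (\<lambda>z. prod (a (fst z)) (b (snd z)))"
  proof (rule Bochner_Integration.integrable_bound)
    show "integrable (lborel \<Otimes>\<^sub>M lborel) (\<lambda>z. k * (norm (a (fst z)) * norm (b (snd z))))"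
    proof (rule integrable_mult_right, rule lborel_pair.Fubini_integrable)
      show "(\<lambda>z. norm (a (fst z)) * norm (b (snd z))) \<in> borel_measurable (lborel \<Otimes>\<^sub>M lborel)"
        by measurable
      show "integrable lborel (\<lambda>x. LINT y|lborel. norm (norm (a (fst (x, y))) * norm (b (snd (x, y)))))"
        using a by (simp add: abs_mult)
      show "AE x in lborel. integrable lborel (\<lambda>y. norm (a (fst (x, y))) * norm (b (snd (x, y))))"
        using b by simp
    qed
    show "AE z in lborel \<Otimes>\<^sub>M lborel. norm (prod (a (fst z)) (b (snd z)))
        \<le> norm (k * (norm (a (fst z)) * norm (b (snd z))))"
      using k by (simp add: abs_mult)
  qed measurable
  define f1 where "f1 = (\<lambda>z::real \<times> real. indicator {..fst z} (snd z) *\<^sub>R prod (a (fst z)) (b (snd z)))"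
  \<comment> \<open>Strict on this side, so that the diagonal is counted once. The closed half-line
    is restored in \<open>null\<close>, a single point having measure zero.\<close>
  define f2 where "f2 = (\<lambda>z::real \<times> real. indicator {..<snd z} (fst z) *\<^sub>R prod (a (fst z)) (b (snd z)))"
  have f1m: "f1 \<in> borel_measurable (lborel \<Otimes>\<^sub>M lborel)"
  proof -
    have "(\<lambda>z::real \<times> real. if snd z \<le> fst z then 1 else 0 :: real) \<in> borel_measurable (lborel \<Otimes>\<^sub>M lborel)"
      by measurable
    from borel_measurable_scaleR[OF this abm] show ?thesis
      by (simp add: f1_def indicator_def)
  qed
  have f2m: "f2 \<in> borel_measurable (lborel \<Otimes>\<^sub>M lborel)"
  proof -
    have "(\<lambda>z::real \<times> real. if fst z < snd z then 1 else 0 :: real) \<in> borel_measurable (lborel \<Otimes>\<^sub>M lborel)"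
      by measurable
    from borel_measurable_scaleR[OF this abm] show ?thesis
      by (simp add: f2_def indicator_def)
  qed
  have i1: "integrable (lborel \<Otimes>\<^sub>M lborel) f1"
    by (rule Bochner_Integration.integrable_bound[OF int f1m]) (auto simp: f1_def indicator_def)
  have i2: "integrable (lborel \<Otimes>\<^sub>M lborel) f2"
    by (rule Bochner_Integration.integrable_bound[OF int f2m]) (auto simp: f2_def indicator_def)
  have L: "(LBINT t. prod x (g t)) = prod x (LBINT t. g t)" if "integrable lborel g" for x g
    by (rule integral_bounded_linear[OF bounded_bilinear.bounded_linear_right[OF bil] that])
  have R: "(LBINT t. prod (g t) x) = prod (LBINT t. g t) x" if "integrable lborel g" for x g
    by (rule integral_bounded_linear[OF bounded_bilinear.bounded_linear_left[OF bil] that])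
  have ia: "integrable lborel (\<lambda>t. indicator A t *\<^sub>R a t)" if "A \<in> sets borel" for A
    using integrable_mult_indicator[OF _ a, of A] that by simp
  have ib: "integrable lborel (\<lambda>t. indicator A t *\<^sub>R b t)" if "A \<in> sets borel" for A
    using integrable_mult_indicator[OF _ b, of A] that by simp
  have e1: "integral\<^sup>L (lborel \<Otimes>\<^sub>M lborel) f1 = (LBINT t. prod (a t) (LBINT s:{..t}. b s))"
  proof -
    have "integral\<^sup>L (lborel \<Otimes>\<^sub>M lborel) f1 = (LBINT t. LBINT s. f1 (t, s))"
      by (rule lborel_pair.integral_fst'[OF i1, symmetric])
    also have "\<dots> = (LBINT t. LBINT s. prod (a t) (indicator {..t} s *\<^sub>R b s))"
      by (simp add: f1_def bounded_bilinear.scaleR_right[OF bil])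
    also have "\<dots> = (LBINT t. prod (a t) (LBINT s:{..t}. b s))"
      unfolding set_lebesgue_integral_def by (simp add: L[OF ib])
    finally show ?thesis .
  qed
  have e2: "integral\<^sup>L (lborel \<Otimes>\<^sub>M lborel) f2 = (LBINT s. prod (LBINT t:{..s}. a t) (b s))"
  proof -
    have null: "(LBINT t:{..<s}. a t) = (LBINT t:{..s}. a t)" for s
      unfolding set_lebesgue_integral_def
      by (rule integral_cong_AE)
        (use AE_lborel_singleton[of s] in \<open>auto simp: indicator_def elim!: eventually_mono\<close>)
    have "integral\<^sup>L (lborel \<Otimes>\<^sub>M lborel) f2 = (LBINT s. LBINT t. f2 (t, s))"
      using lborel_pair.integral_snd[of "\<lambda>x y. f2 (x, y)"] i2 by simp
    also have "\<dots> = (LBINT s. LBINT t. prod (indicator {..<s} t *\<^sub>R a t) (b s))"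
      by (simp add: f2_def bounded_bilinear.scaleR_left[OF bil])
    also have "\<dots> = (LBINT s. prod (LBINT t:{..<s}. a t) (b s))"
      unfolding set_lebesgue_integral_def by (simp add: R[OF ia])
    finally show ?thesis by (simp add: null)
  qed
  have "f1 z + f2 z = prod (a (fst z)) (b (snd z))" for z
    by (auto simp: f1_def f2_def indicator_def)
  then have "integral\<^sup>L (lborel \<Otimes>\<^sub>M lborel) f1 + integral\<^sup>L (lborel \<Otimes>\<^sub>M lborel) f2
      = integral\<^sup>L (lborel \<Otimes>\<^sub>M lborel) (\<lambda>z. prod (a (fst z)) (b (snd z)))"
    using i1 i2 by (simp flip: Bochner_Integration.integral_add)
  also have "\<dots> = (LBINT t. LBINT s. prod (a t) (b s))"
    using lborel_pair.integral_fst'[OF int] by simp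
  also have "\<dots> = prod (LBINT t. a t) (LBINT s. b s)"
    by (simp add: L[OF b] R[OF a])
  finally show ?thesis unfolding e1 e2 .
qed

text \<open>The product rule. Truncating both derivatives to \<open>{0..t}\<close> turns the inner
  integrals of the triangle formula into the increments \<open>a s - a 0\<close> and
  \<open>b s - b 0\<close>; the boundary values \<open>a 0\<close> and \<open>b 0\<close> account
  for the two extra integrals computed in \<open>c1\<close> and \<open>c2\<close>.\<close>

lemma abs_cont_bilinear:
  fixes prod :: "'a::euclidean_space \<Rightarrow> 'b::euclidean_space \<Rightarrow> 'c::euclidean_space"
  assumes bil: "bounded_bilinear prod" and a: "abs_cont T a a'" and b: "abs_cont T b b'"
  shows "abs_cont T (\<lambda>t. prod (a t) (b t)) (\<lambda>t. prod (a' t) (b t) + prod (a t) (b' t))"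
  unfolding abs_cont_def
proof (intro conjI ballI)
  have i1: "set_integrable lborel {0..T} (\<lambda>t. prod (a' t) (b t))"
    by (intro set_integrable_bilinear_continuous[OF bil] abs_cont_set_integrable[OF a]
        abs_cont_continuous_on[OF b])
  have i2: "set_integrable lborel {0..T} (\<lambda>t. prod (a t) (b' t))"
    by (rule set_integrable_bilinear_continuous[OF bounded_bilinear.flip[OF bil]
          abs_cont_set_integrable[OF b] abs_cont_continuous_on[OF a]])
  show "set_integrable lborel {0..T} (\<lambda>t. prod (a' t) (b t) + prod (a t) (b' t))"
    by (intro set_integral_add i1 i2)
  fix t assume t: "t \<in> {0..T}"
  define \<alpha> where "\<alpha> = (\<lambda>s. indicator {0..t} s *\<^sub>R a' s)"
  define \<beta> where "\<beta> = (\<lambda>s. indicator {0..t} s *\<^sub>R b' s)"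
  have \<alpha>: "integrable lborel \<alpha>" and \<beta>: "integrable lborel \<beta>"
    using set_integrable_subset[OF abs_cont_set_integrable[OF a], of "{0..t}"]
      set_integrable_subset[OF abs_cont_set_integrable[OF b], of "{0..t}"] t
    by (auto simp: set_integrable_def \<alpha>_def \<beta>_def)
  have ts: "(LBINT r:{..s}. \<alpha> r) = a s - a 0" "(LBINT r:{..s}. \<beta> r) = b s - b 0" if "s \<in> {0..t}" for s
  proof -
    have "(LBINT r:{..s}. \<alpha> r) = (LBINT r:{0..s}. a' r)" "(LBINT r:{..s}. \<beta> r) = (LBINT r:{0..s}. b' r)"
      unfolding set_lebesgue_integral_def \<alpha>_def \<beta>_def using that
      by (auto intro!: Bochner_Integration.integral_cong simp: indicator_def)
    then show "(LBINT r:{..s}. \<alpha> r) = a s - a 0" "(LBINT r:{..s}. \<beta> r) = b s - b 0"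
      using abs_cont_eq[OF a, of s] abs_cont_eq[OF b, of s] that t by simp_all
  qed
  have s1: "set_integrable lborel {0..t} (\<lambda>s. prod (a' s) (b s))"
      "set_integrable lborel {0..t} (\<lambda>s. prod (a s) (b' s))"
      "set_integrable lborel {0..t} (\<lambda>s. prod (a' s) (b 0))"
      "set_integrable lborel {0..t} (\<lambda>s. prod (a 0) (b' s))"
  proof -
    show "set_integrable lborel {0..t} (\<lambda>s. prod (a' s) (b s))"
      by (rule set_integrable_subset[OF i1]) (use t in auto)
    show "set_integrable lborel {0..t} (\<lambda>s. prod (a s) (b' s))"
      by (rule set_integrable_subset[OF i2]) (use t in auto)
    have "set_integrable lborel {0..T} (\<lambda>s. prod (a' s) (b 0))"
      by (intro set_integrable_bilinear_continuous[OF bil] abs_cont_set_integrable[OF a]) auto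
    then show "set_integrable lborel {0..t} (\<lambda>s. prod (a' s) (b 0))"
      by (rule set_integrable_subset) (use t in auto)
    have "set_integrable lborel {0..T} (\<lambda>s. prod (a 0) (b' s))"
      by (rule set_integrable_bilinear_continuous[OF bounded_bilinear.flip[OF bil]
          abs_cont_set_integrable[OF b], of "\<lambda>_. a 0"]) auto
    then show "set_integrable lborel {0..t} (\<lambda>s. prod (a 0) (b' s))"
      by (rule set_integrable_subset) (use t in auto)
  qed
  have c1: "(LBINT s:{0..t}. prod (a' s) (b 0)) = prod (a t - a 0) (b 0)"
  proof -
    have "(LBINT s:{0..t}. prod (a' s) (b 0)) = (LBINT s. prod (\<alpha> s) (b 0))"
      by (simp add: \<alpha>_def set_lebesgue_integral_def bounded_bilinear.scaleR_left[OF bil])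
    also have "\<dots> = prod (LBINT s. \<alpha> s) (b 0)"
      by (rule integral_bounded_linear[OF bounded_bilinear.bounded_linear_left[OF bil] \<alpha>])
    finally show ?thesis using abs_cont_eq[OF a t] by (simp add: \<alpha>_def set_lebesgue_integral_def)
  qed
  have c2: "(LBINT s:{0..t}. prod (a 0) (b' s)) = prod (a 0) (b t - b 0)"
  proof -
    have "(LBINT s:{0..t}. prod (a 0) (b' s)) = (LBINT s. prod (a 0) (\<beta> s))"
      by (simp add: \<beta>_def set_lebesgue_integral_def bounded_bilinear.scaleR_right[OF bil])
    also have "\<dots> = prod (a 0) (LBINT s. \<beta> s)"
      by (rule integral_bounded_linear[OF bounded_bilinear.bounded_linear_right[OF bil] \<beta>])
    finally show ?thesis using abs_cont_eq[OF b t] by (simp add: \<beta>_def set_lebesgue_integral_def)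
  qed
  have "(LBINT s. prod (\<alpha> s) (LBINT r:{..s}. \<beta> r)) = (LBINT s:{0..t}. prod (a' s) (b s) - prod (a' s) (b 0))"
    unfolding set_lebesgue_integral_def[of lborel "{0..t}"]
    by (intro Bochner_Integration.integral_cong)
      (auto simp: ts \<alpha>_def indicator_def bounded_bilinear.zero_left[OF bil] bounded_bilinear.diff_right[OF bil])
  moreover have "(LBINT s. prod (LBINT r:{..s}. \<alpha> r) (\<beta> s)) = (LBINT s:{0..t}. prod (a s) (b' s) - prod (a 0) (b' s))"
    unfolding set_lebesgue_integral_def[of lborel "{0..t}"]
    by (intro Bochner_Integration.integral_cong)
      (auto simp: ts \<beta>_def indicator_def bounded_bilinear.zero_right[OF bil] bounded_bilinear.diff_left[OF bil])
  moreover have "(LBINT s. \<alpha> s) = a t - a 0" "(LBINT s. \<beta> s) = b t - b 0"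
    using abs_cont_eq[OF a t] abs_cont_eq[OF b t] by (simp_all add: \<alpha>_def \<beta>_def set_lebesgue_integral_def)
  ultimately have "(LBINT s:{0..t}. prod (a' s) (b s)) - prod (a t - a 0) (b 0)
      + ((LBINT s:{0..t}. prod (a s) (b' s)) - prod (a 0) (b t - b 0)) = prod (a t - a 0) (b t - b 0)"
    using integral_triangle_bilinear[OF bil \<alpha> \<beta>] s1 by (simp add: c1 c2)
  then have "(LBINT s:{0..t}. prod (a' s) (b s)) + (LBINT s:{0..t}. prod (a s) (b' s))
      = prod (a t) (b t) - prod (a 0) (b 0)"
    unfolding bounded_bilinear.diff_left[OF bil] bounded_bilinear.diff_right[OF bil]
    by (simp add: algebra_simps)
  then show "prod (a t) (b t) = prod (a 0) (b 0) + (LBINT \<tau>:{0..t}. prod (a' \<tau>) (b \<tau>) + prod (a \<tau>) (b' \<tau>))"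
    unfolding set_integral_add(2)[OF s1(1,2)] by simp
qed

section \<open>Fundamental matrices and the Riccati equations\<close>

lemma has_vector_derivative_imp_continuous_on:
  assumes "\<And>t. t \<in> S \<Longrightarrow> (X has_vector_derivative X' t) (at t within S)"
  shows "continuous_on S X"
  using assms unfolding continuous_on_eq_continuous_within
  by (blast intro: has_vector_derivative_continuous)

lemma has_vector_derivative_matrix_mult:
  assumes "(\<Phi> has_vector_derivative a) (at t within S)" "(\<Psi> has_vector_derivative b) (at t within S)"
  shows "((\<lambda>t. \<Psi> t ** \<Phi> t :: real^'n^'n) has_vector_derivative \<Psi> t ** a + b ** \<Phi> t) (at t within S)"
  by (rule bounded_bilinear.has_vector_derivative[OF bounded_bilinear_matrix_matrix_mult assms(2,1)])

lemmas matrix_mult_right_diff = bounded_bilinear.diff_right[OF bounded_bilinear_matrix_matrix_mult]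
lemmas matrix_mult_left_diff = bounded_bilinear.diff_left[OF bounded_bilinear_matrix_matrix_mult]
lemmas matrix_mult_right_add = bounded_bilinear.add_right[OF bounded_bilinear_matrix_matrix_mult]
lemmas matrix_mult_left_add = bounded_bilinear.add_left[OF bounded_bilinear_matrix_matrix_mult]
lemmas matrix_mult_right_minus = bounded_bilinear.minus_right[OF bounded_bilinear_matrix_matrix_mult]
lemmas matrix_mult_left_minus = bounded_bilinear.minus_left[OF bounded_bilinear_matrix_matrix_mult]

lemmas matrix_mult_simps = matrix_mult_right_diff matrix_mult_left_diff matrix_mult_right_add
  matrix_mult_left_add matrix_mult_right_minus matrix_mult_left_minus

lemma transpose_add: "transpose (X + Y) = transpose X + transpose (Y :: real^'n^'m)"
  by (simp add: transpose_def vec_eq_iff)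

lemma transpose_minus: "transpose (- X) = - transpose (X :: real^'n^'m)"
  by (simp add: transpose_def vec_eq_iff)

lemma transpose_zero: "transpose (0 :: real^'n^'m) = 0"
  by (simp add: transpose_def vec_eq_iff)

lemma transpose_diff: "transpose (X - Y) = transpose X - transpose (Y :: real^'n^'m)"
  by (simp add: transpose_def vec_eq_iff)

text \<open>The inverse of a fundamental matrix solves the adjoint equation, which after
  transposition has the shape treated in \<open>linear_matrix_ode\<close>. So the inverse is
  constructed instead of proving invertibility: the product of the two solutions is constant, and a
  left inverse of a square matrix is a right inverse.\<close>

lemma linear_matrix_ode_inverse:
  fixes L :: "real \<Rightarrow> real^'n^'n"
  assumes T: "T \<ge> 0" and L: "continuous_on {0..T} L"
  shows "\<exists>\<Phi> \<Psi> :: real \<Rightarrow> real^'n^'n. \<forall>t\<in>{0..T}.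
      (\<Phi> has_vector_derivative L t ** \<Phi> t) (at t within {0..T}) \<and>
      (\<Psi> has_vector_derivative - (\<Psi> t ** L t)) (at t within {0..T}) \<and>
      \<Phi> t ** \<Psi> t = mat 1"
proof -
  obtain \<Phi> where \<Phi>: "\<Phi> 0 = mat 1"
    "\<And>t. t \<in> {0..T} \<Longrightarrow> (\<Phi> has_vector_derivative L t ** \<Phi> t) (at t within {0..T})"
    using linear_matrix_ode[OF T L] by blast
  have "continuous_on {0..T} (\<lambda>t. - transpose (L t))"
    by (intro continuous_intros bounded_linear.continuous_on[OF bounded_linear_transpose] L)
  then obtain \<Theta> where \<Theta>: "\<Theta> 0 = mat 1"
    "\<And>t. t \<in> {0..T} \<Longrightarrow> (\<Theta> has_vector_derivative - transpose (L t) ** \<Theta> t) (at t within {0..T})"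
    using linear_matrix_ode[OF T, of "\<lambda>t. - transpose (L t)"] by blast
  define \<Psi> where "\<Psi> = (\<lambda>t. transpose (\<Theta> t))"
  have \<Psi>: "(\<Psi> has_vector_derivative - (\<Psi> t ** L t)) (at t within {0..T})" if "t \<in> {0..T}" for t
    using bounded_linear.has_vector_derivative[OF bounded_linear_transpose \<Theta>(2)[OF that]]
    by (simp add: \<Psi>_def matrix_mult_simps matrix_transpose_mul transpose_minus)
  have "((\<lambda>t. \<Psi> t ** \<Phi> t) has_vector_derivative 0) (at t within {0..T})" if "t \<in> {0..T}" for t
    using has_vector_derivative_matrix_mult[OF \<Phi>(2)[OF that] \<Psi>[OF that]]
    by (simp add: matrix_mult_simps matrix_mul_assoc)
  then obtain c where c: "\<And>t. t \<in> {0..T} \<Longrightarrow> \<Psi> t ** \<Phi> t = c"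
    using has_vector_derivative_zero_constant[of "{0..T}" "\<lambda>t. \<Psi> t ** \<Phi> t"]
    by (auto simp: convex_real_interval)
  have "c = mat 1" using c[of 0] T by (simp add: \<Psi>_def \<Phi>(1) \<Theta>(1) transpose_mat)
  then have "\<Phi> t ** \<Psi> t = mat 1" if "t \<in> {0..T}" for t
    using c[OF that] by (simp add: matrix_left_right_inverse)
  then show ?thesis
    by (intro exI[of _ \<Phi>] exI[of _ \<Psi>] ballI conjI \<Phi>(2) \<Psi>)
qed

text \<open>Variation of constants for a forcing \<open>b\<close> that is merely continuous. It will
  contain a noise path, which has no derivative, so the integral of \<open>\<Psi>\<close> against
  the derivative of \<open>b\<close> appears in its integrated-by-parts form.\<close>

lemma volterra_solution:
  fixes L :: "real \<Rightarrow> real^'n^'n" and b :: "real \<Rightarrow> real^'n"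
  assumes L: "continuous_on {0..T} L"
    and \<Phi>: "\<And>t. t \<in> {0..T} \<Longrightarrow> (\<Phi> has_vector_derivative L t ** \<Phi> t) (at t within {0..T})"
    and \<Psi>: "continuous_on {0..T} \<Psi>" "\<And>t. t \<in> {0..T} \<Longrightarrow> \<Phi> t ** \<Psi> t = mat 1"
    and b: "continuous_on {0..T} b"
  defines "X \<equiv> (\<lambda>t. b t + \<Phi> t *v integral {0..t} (\<lambda>\<tau>. \<Psi> \<tau> *v (L \<tau> *v b \<tau>)))"
  shows "continuous_on {0..T} X"
    and "\<And>t. t \<in> {0..T} \<Longrightarrow> X t = b t + integral {0..t} (\<lambda>\<tau>. L \<tau> *v X \<tau>)"
proof -
  let ?J = "\<lambda>t. integral {0..t} (\<lambda>\<tau>. \<Psi> \<tau> *v (L \<tau> *v b \<tau>))"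
  have c: "continuous_on {0..T} (\<lambda>\<tau>. \<Psi> \<tau> *v (L \<tau> *v b \<tau>))"
    by (intro continuous_intros L \<Psi> b)
  have J: "(?J has_vector_derivative \<Psi> t *v (L t *v b t)) (at t within {0..T})" if "t \<in> {0..T}" for t
    by (rule integral_has_vector_derivative[OF c that])
  have "continuous_on {0..T} \<Phi>" "continuous_on {0..T} ?J"
    by (rule has_vector_derivative_imp_continuous_on, erule \<Phi> J)+
  then show contX: "continuous_on {0..T} X"
    unfolding X_def by (intro continuous_intros b)
  have "((\<lambda>t. \<Phi> t *v ?J t) has_vector_derivative L t *v X t) (at t within {0..T})" if t: "t \<in> {0..T}" for t
  proof -
    have "((\<lambda>t. \<Phi> t *v ?J t) has_vector_derivative \<Phi> t *v (\<Psi> t *v (L t *v b t)) + (L t ** \<Phi> t) *v ?J t) (at t within {0..T})"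
      by (rule bounded_bilinear.has_vector_derivative[OF bounded_bilinear_matrix_vector_mult \<Phi>[OF t] J[OF t]])
    also have "\<Phi> t *v (\<Psi> t *v (L t *v b t)) = L t *v b t"
      by (metis matrix_vector_mul_assoc \<Psi>(2)[OF t] matrix_vector_mul_lid)
    finally show ?thesis
      by (simp add: X_def matrix_vector_right_distrib matrix_vector_mul_assoc)
  qed
  note d = this
  show "X t = b t + integral {0..t} (\<lambda>\<tau>. L \<tau> *v X \<tau>)" if t: "t \<in> {0..T}" for t
  proof -
    have "((\<lambda>\<tau>. L \<tau> *v X \<tau>) has_integral \<Phi> t *v ?J t - \<Phi> 0 *v ?J 0) {0..t}"
    proof (rule fundamental_theorem_of_calculus)
      fix x assume "x \<in> {0..t}"
      then show "((\<lambda>t. \<Phi> t *v ?J t) has_vector_derivative L x *v X x) (at x within {0..t})"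
        using t by (intro has_vector_derivative_within_subset[OF d]) auto
    qed (use t in simp)
    then have "integral {0..t} (\<lambda>\<tau>. L \<tau> *v X \<tau>) = \<Phi> t *v ?J t"
      by (simp add: integral_unique)
    then show ?thesis unfolding X_def by simp
  qed
qed

text \<open>Variation of constants with the primitive normalised to vanish at \<open>T\<close>
  instead of at 0.\<close>

lemma linear_ode_terminal:
  fixes L :: "real \<Rightarrow> real^'n^'n" and g :: "real \<Rightarrow> real^'n"
  assumes T: "T \<ge> 0" and L: "continuous_on {0..T} L" and g: "continuous_on {0..T} g"
  obtains s where "s T = 0"
    "\<And>t. t \<in> {0..T} \<Longrightarrow> (s has_vector_derivative L t *v s t + g t) (at t within {0..T})"
proof -
  obtain \<Phi> \<Psi> :: "real \<Rightarrow> real^'n^'n" where *: "\<forall>t\<in>{0..T}.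
      (\<Phi> has_vector_derivative L t ** \<Phi> t) (at t within {0..T}) \<and>
      (\<Psi> has_vector_derivative - (\<Psi> t ** L t)) (at t within {0..T}) \<and>
      \<Phi> t ** \<Psi> t = mat 1"
    using linear_matrix_ode_inverse[OF T L] by (elim exE)
  note \<Phi> = *[rule_format, THEN conjunct1] and \<Psi> = *[rule_format, THEN conjunct2, THEN conjunct1]
    and inv = *[rule_format, THEN conjunct2, THEN conjunct2]
  let ?J = "\<lambda>t. integral {0..t} (\<lambda>\<tau>. \<Psi> \<tau> *v g \<tau>)"
  have "continuous_on {0..T} \<Psi>"
    using \<Psi> by (rule has_vector_derivative_imp_continuous_on)
  then have c: "continuous_on {0..T} (\<lambda>\<tau>. \<Psi> \<tau> *v g \<tau>)"
    by (intro continuous_intros g)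
  define s where "s = (\<lambda>t. \<Phi> t *v (?J t - ?J T))"
  show thesis
  proof (rule that)
    show "s T = 0" by (simp add: s_def)
    fix t assume t: "t \<in> {0..T}"
    have "((\<lambda>t. ?J t - ?J T) has_vector_derivative \<Psi> t *v g t) (at t within {0..T})"
      using integral_has_vector_derivative[OF c t] by (auto intro!: derivative_eq_intros)
    then have "(s has_vector_derivative \<Phi> t *v (\<Psi> t *v g t) + (L t ** \<Phi> t) *v (?J t - ?J T)) (at t within {0..T})"
      unfolding s_def
      by (rule bounded_bilinear.has_vector_derivative[OF bounded_bilinear_matrix_vector_mult \<Phi>[OF t]])
    also have "\<Phi> t *v (\<Psi> t *v g t) = g t"
      by (metis matrix_vector_mul_assoc inv[OF t] matrix_vector_mul_lid)
    finally show "(s has_vector_derivative L t *v s t + g t) (at t within {0..T})"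
      by (simp add: s_def matrix_vector_mul_assoc add.commute)
  qed
qed

text \<open>The difference between a solution of a Riccati equation and its transpose satisfies a
  homogeneous linear equation of this kind; this is how symmetry of \<open>P\<close> and
  \<open>K\<close> is obtained.\<close>

lemma lyapunov_terminal_zero:
  fixes D :: "real \<Rightarrow> real^'n^'n"
  assumes D: "\<And>t. t \<in> {0..T} \<Longrightarrow>
      (D has_vector_derivative \<rho> *\<^sub>R D t + U t ** D t + D t ** V t) (at t within {0..T})"
    and U: "continuous_on {0..T} U" and V: "continuous_on {0..T} V"
    and T: "D T = 0" and t: "t \<in> {0..T}"
  shows "D t = 0"
proof -
  obtain k where k: "k > 0" "\<And>a b. norm ((a::real^'n^'n) ** (b::real^'n^'n)) \<le> k * (norm a * norm b)"
    using bounded_bilinear_pos_bound[OF bounded_bilinear_matrix_matrix_mult] by blast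
  obtain u where u: "u > 0" "\<And>t. t \<in> {0..T} \<Longrightarrow> norm (U t) \<le> u"
    using continuous_on_interval_bound[OF U] by blast
  obtain v where v: "v > 0" "\<And>t. t \<in> {0..T} \<Longrightarrow> norm (V t) \<le> v"
    using continuous_on_interval_bound[OF V] by blast
  show ?thesis
  proof (rule norm_linear_ode_terminal_zero[where D=D and C="\<bar>\<rho>\<bar> + k * u + k * v", OF _ T t])
    fix t assume t: "t \<in> {0..T}"
    have "norm (U t ** D t) \<le> k * (u * norm (D t))"
      by (rule order_trans[OF k(2)]) (use k u t in \<open>auto intro!: mult_left_mono mult_right_mono\<close>)
    moreover have "norm (D t ** V t) \<le> k * (v * norm (D t))"
      by (rule order_trans[OF k(2)]) (use k v t in \<open>auto intro!: mult_left_mono simp: mult.commute[of "norm (D t)"] intro!: mult_right_mono\<close>)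
    moreover have "norm (\<rho> *\<^sub>R D t + U t ** D t + D t ** V t)
        \<le> norm (\<rho> *\<^sub>R D t) + norm (U t ** D t) + norm (D t ** V t)"
      by (intro norm_triangle_le add_right_mono norm_triangle_ineq)
    ultimately have "norm (\<rho> *\<^sub>R D t + U t ** D t + D t ** V t) \<le> (\<bar>\<rho>\<bar> + k * u + k * v) * norm (D t)"
      by (simp add: algebra_simps)
    with D[OF t] show "\<exists>d. (D has_vector_derivative d) (at t within {0..T})
        \<and> norm d \<le> (\<bar>\<rho>\<bar> + k * u + k * v) * norm (D t)" by blast
  qed
qed

section \<open>The weight R, and consequences of the equations for P, K and s\<close>

lemma positive_definite_invertible:
  assumes "positive_definite (R :: real^'r^'r)"
  shows "R ** matrix_inv R = mat 1" "matrix_inv R ** R = mat 1"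
proof -
  have "x = 0" if "R *v x = 0" for x
    using assms that unfolding positive_definite_def by (metis inner_zero_right less_irrefl)
  then have "invertible R"
    by (metis invertible_def matrix_left_invertible_ker matrix_left_right_inverse)
  then show "R ** matrix_inv R = mat 1" "matrix_inv R ** R = mat 1"
    unfolding invertible_def matrix_inv_def by (rule someI2_ex, blast)+
qed

lemma transpose_matrix_inv:
  assumes "transpose R = R" "R ** matrix_inv R = mat 1" "matrix_inv R ** (R :: real^'r^'r) = mat 1"
  shows "transpose (matrix_inv R) = matrix_inv R"
proof -
  have "R ** transpose (matrix_inv R) = mat 1"
    using arg_cong[OF assms(3), of transpose] assms(1) by (simp add: matrix_transpose_mul transpose_mat)
  then have "matrix_inv R ** (R ** transpose (matrix_inv R)) = matrix_inv R" by simp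
  then show ?thesis by (simp add: matrix_mul_assoc assms(3))
qed

text \<open>\<open>solves_P\<close> asserts that some derivative exists; solving the equation for it
  exhibits the derivative as an explicit function of time, whose continuity can then be read off.
  The next two lemmas do the same for \<open>K\<close> and \<open>s\<close>.\<close>

lemma solves_P_derivative:
  assumes "solves_P T \<rho> A B Q R P" "t \<in> {0..T}"
  shows "(P has_vector_derivative \<rho> *\<^sub>R P t - transpose A ** P t - P t ** A - Q
      + P t ** (B ** matrix_inv R ** transpose B) ** P t) (at t within {0..T})"
proof -
  obtain D where D: "(P has_vector_derivative D) (at t within {0..T})"
    and eq: "\<rho> *\<^sub>R P t = D + transpose A ** P t + P t ** A + Q
          - P t ** B ** matrix_inv R ** transpose B ** P t"
    using assms unfolding solves_P_def by blast
  have "D = \<rho> *\<^sub>R P t - transpose A ** P t - P t ** A - Q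
      + P t ** (B ** matrix_inv R ** transpose B) ** P t"
    unfolding eq by (simp add: matrix_mul_assoc)
  with D show ?thesis by simp
qed

lemma solves_K_derivative:
  assumes "solves_K T \<rho> A B G \<Gamma> Q R P K" "t \<in> {0..T}"
  shows "(K has_vector_derivative \<rho> *\<^sub>R K t - transpose (A + G) ** K t - K t ** (A + G)
      - transpose G ** P t - P t ** G
      + (P t + K t) ** (B ** matrix_inv R ** transpose B) ** (P t + K t)
      - P t ** (B ** matrix_inv R ** transpose B) ** P t + Xi_matrix \<Gamma> Q) (at t within {0..T})"
    (is "(_ has_vector_derivative ?D) _")
proof -
  obtain D where D: "(K has_vector_derivative D) (at t within {0..T})"
    and eq: "\<rho> *\<^sub>R K t = D + transpose (A + G) ** K t + K t ** (A + G)
          + transpose G ** P t + P t ** G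
          - (P t + K t) ** B ** matrix_inv R ** transpose B ** (P t + K t)
          + P t ** B ** matrix_inv R ** transpose B ** P t - Xi_matrix \<Gamma> Q"
    using assms unfolding solves_K_def by blast
  have "D = ?D"
    unfolding eq by (simp add: matrix_mul_assoc)
  with D show ?thesis by simp
qed

lemma solves_s_derivative:
  assumes "solves_s T \<rho> A B G \<Gamma> Q R f \<eta> P K s" "t \<in> {0..T}"
  shows "(s has_vector_derivative \<rho> *\<^sub>R s t
      - transpose (A + G - B ** matrix_inv R ** transpose B ** (P t + K t)) *v s t
      - (P t + K t) *v f t + eta_bar \<Gamma> Q \<eta> t) (at t within {0..T})"
    (is "(_ has_vector_derivative ?D) _")
proof -
  obtain D where D: "(s has_vector_derivative D) (at t within {0..T})"
    and eq: "\<rho> *\<^sub>R s t = D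
          + transpose (A + G - B ** matrix_inv R ** transpose B ** (P t + K t)) *v s t
          + (P t + K t) *v f t - eta_bar \<Gamma> Q \<eta> t"
    using assms unfolding solves_s_def by blast
  have "D = ?D"
    unfolding eq by simp
  with D show ?thesis by simp
qed

text \<open>Symmetry is not part of \<open>solves_P\<close>. The transpose P' solves the same
  equation, and with S the symmetric matrix \<open>B ** matrix_inv R ** transpose B\<close> the
  quadratic terms split as P S P - P' S P' = P' S (P - P') + (P - P') S P. So the difference solves
  a linear equation with terminal value zero.\<close>

lemma solves_P_symmetric:
  assumes P: "solves_P T \<rho> A B Q R P" and Q: "transpose Q = Q"
    and S: "transpose (matrix_inv R) = matrix_inv R"
    and t: "t \<in> {0..T}"
  shows "transpose (P t) = P t"
proof -
  let ?S = "B ** matrix_inv R ** transpose B"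
  have contP: "continuous_on {0..T} P"
    by (rule has_vector_derivative_imp_continuous_on) (rule solves_P_derivative[OF P])
  have contPt: "continuous_on {0..T} (\<lambda>t. transpose (P t))"
    by (rule bounded_linear.continuous_on[OF bounded_linear_transpose contP])
  have "P t - transpose (P t) = 0"
  proof (rule lyapunov_terminal_zero[OF _ _ _ _ t])
    fix t assume t: "t \<in> {0..T}"
    note d = solves_P_derivative[OF P t]
    have "((\<lambda>t. P t - transpose (P t)) has_vector_derivative
       (\<rho> *\<^sub>R P t - transpose A ** P t - P t ** A - Q + P t ** ?S ** P t)
       - transpose (\<rho> *\<^sub>R P t - transpose A ** P t - P t ** A - Q + P t ** ?S ** P t)) (at t within {0..T})"
      by (intro has_vector_derivative_diff d bounded_linear.has_vector_derivative[OF bounded_linear_transpose d])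
    then show "((\<lambda>t. P t - transpose (P t)) has_vector_derivative
       \<rho> *\<^sub>R (P t - transpose (P t)) + (transpose (P t) ** ?S - transpose A) ** (P t - transpose (P t))
       + (P t - transpose (P t)) ** (?S ** P t - A)) (at t within {0..T})"
      by (rule back_subst[where P="\<lambda>D. (_ has_vector_derivative D) _"])
        (simp add: transpose_add transpose_diff matrix_transpose_mul S Q matrix_mult_simps
          matrix_mul_assoc transpose_scalar scaleR_diff_right algebra_simps)
  next
    show "P T - transpose (P T) = 0"
      using P by (simp add: solves_P_def transpose_zero)
    show "continuous_on {0..T} (\<lambda>t. transpose (P t) ** ?S - transpose A)"
      by (intro continuous_intros contPt)
    show "continuous_on {0..T} (\<lambda>t. ?S ** P t - A)"
      by (intro continuous_intros contP)
  qed
  then show ?thesis by simp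
qed

text \<open>The same splitting with \<open>P + K\<close> in place of \<open>P\<close>. By the
  symmetry of \<open>P\<close>, every term without \<open>K\<close> drops out of the
  difference.\<close>

lemma solves_K_symmetric:
  assumes K: "solves_K T \<rho> A B G \<Gamma> Q R P K" and Q: "transpose Q = Q"
    and Psym: "\<And>t. t \<in> {0..T} \<Longrightarrow> transpose (P t) = P t" and contP: "continuous_on {0..T} P"
    and S: "transpose (matrix_inv R) = matrix_inv R"
    and t: "t \<in> {0..T}"
  shows "transpose (K t) = K t"
proof -
  let ?S = "B ** matrix_inv R ** transpose B"
  have contK: "continuous_on {0..T} K"
    by (rule has_vector_derivative_imp_continuous_on) (rule solves_K_derivative[OF K])
  have contKt: "continuous_on {0..T} (\<lambda>t. transpose (K t))"
    by (rule bounded_linear.continuous_on[OF bounded_linear_transpose contK])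
  have Xi: "transpose (Xi_matrix \<Gamma> Q) = Xi_matrix \<Gamma> Q"
    by (simp add: Xi_matrix_def transpose_add transpose_diff matrix_transpose_mul Q matrix_mul_assoc)
  have "K t - transpose (K t) = 0"
  proof (rule lyapunov_terminal_zero[OF _ _ _ _ t])
    fix t assume t: "t \<in> {0..T}"
    note d = solves_K_derivative[OF K t]
    show "((\<lambda>t. K t - transpose (K t)) has_vector_derivative
       \<rho> *\<^sub>R (K t - transpose (K t)) + ((P t + transpose (K t)) ** ?S - transpose (A + G)) ** (K t - transpose (K t))
       + (K t - transpose (K t)) ** (?S ** (P t + K t) - (A + G))) (at t within {0..T})"
      by (rule back_subst[where P="\<lambda>D. (_ has_vector_derivative D) _",
            OF has_vector_derivative_diff[OF d bounded_linear.has_vector_derivative[OF bounded_linear_transpose d]]])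
        (simp add: transpose_add transpose_diff matrix_transpose_mul S Q Psym[OF t] Xi matrix_mult_simps
          matrix_mul_assoc transpose_scalar scaleR_diff_right algebra_simps)
  next
    show "K T - transpose (K T) = 0"
      using K by (simp add: solves_K_def transpose_zero)
    show "continuous_on {0..T} (\<lambda>t. (P t + transpose (K t)) ** ?S - transpose (A + G))"
      by (intro continuous_intros contKt contP)
    show "continuous_on {0..T} (\<lambda>t. ?S ** (P t + K t) - (A + G))"
      by (intro continuous_intros contK contP)
  qed
  then show ?thesis by simp
qed

lemma solves_s_exists:
  assumes T: "T \<ge> 0" and P: "continuous_on {0..T} P" and K: "continuous_on {0..T} K"
    and f: "continuous_on {0..T} f" and \<eta>: "continuous_on {0..T} \<eta>"
  shows "\<exists>s. solves_s T \<rho> A B G \<Gamma> Q R f \<eta> P K s"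
proof -
  let ?N = "\<lambda>t. transpose (A + G - B ** matrix_inv R ** transpose B ** (P t + K t))"
  have eta: "continuous_on {0..T} (eta_bar \<Gamma> Q \<eta>)"
    unfolding eta_bar_def[abs_def] by (intro continuous_intros \<eta>)
  obtain s where s: "s T = 0"
    "\<And>t. t \<in> {0..T} \<Longrightarrow> (s has_vector_derivative (\<rho> *\<^sub>R mat 1 - ?N t) *v s t
        + (eta_bar \<Gamma> Q \<eta> t - (P t + K t) *v f t)) (at t within {0..T})"
  proof (rule linear_ode_terminal[OF T])
    show "continuous_on {0..T} (\<lambda>t. \<rho> *\<^sub>R mat 1 - ?N t)"
      by (intro continuous_intros bounded_linear.continuous_on[OF bounded_linear_transpose] P K)
    show "continuous_on {0..T} (\<lambda>t. eta_bar \<Gamma> Q \<eta> t - (P t + K t) *v f t)"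
      by (intro continuous_intros P K f eta)
  qed blast
  show ?thesis
    unfolding solves_s_def
    by (intro exI[of _ s] conjI ballI s(1) exI conjI, erule s(2))
      (simp add: matrix_vector_mult_diff_rdistrib scaleR_matrix_vector_assoc[symmetric])
qed

section \<open>Brownian increments\<close>

text \<open>Used with the probability space itself and with its product with time, so that one set
  of closure lemmas serves random variables and processes.\<close>

definition square_integrable :: "'w measure \<Rightarrow> ('w \<Rightarrow> 'v::euclidean_space) \<Rightarrow> bool" where
  "square_integrable M X \<longleftrightarrow> X \<in> borel_measurable M \<and> integrable M (\<lambda>\<omega>. (norm (X \<omega>))\<^sup>2)"

lemma square_integrable_measurable: "square_integrable M X \<Longrightarrow> X \<in> borel_measurable M"
  by (simp add: square_integrable_def)

lemma square_integrable_norm2: "square_integrable M X \<Longrightarrow> integrable M (\<lambda>\<omega>. (norm (X \<omega>))\<^sup>2)"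
  by (simp add: square_integrable_def)

lemma norm_add_squared_le: "(norm (x + y))\<^sup>2 \<le> 2 * (norm x)\<^sup>2 + 2 * (norm (y :: 'a::real_normed_vector))\<^sup>2"
proof -
  have "(norm (x + y))\<^sup>2 \<le> (norm x + norm y)\<^sup>2"
    by (intro power_mono norm_triangle_ineq) auto
  also have "\<dots> \<le> 2 * (norm x)\<^sup>2 + 2 * (norm y)\<^sup>2"
    using sum_squares_bound[of "norm x" "norm y"] by (simp add: power2_sum)
  finally show ?thesis .
qed

lemma norm_mult_le_squares: "a * b \<le> a\<^sup>2 + (b::real)\<^sup>2"
proof -
  have "2 * (a * b) \<le> a\<^sup>2 + b\<^sup>2" using sum_squares_bound[of a b] by (simp add: mult.assoc)
  moreover have "0 \<le> a\<^sup>2" "0 \<le> b\<^sup>2" by auto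
  ultimately show ?thesis by linarith
qed

lemma square_integrable_bounded_bilinear:
  fixes prod :: "'a::euclidean_space \<Rightarrow> 'b::euclidean_space \<Rightarrow> 'c::euclidean_space"
  assumes bil: "bounded_bilinear prod" and X: "square_integrable M X" and Y: "square_integrable M Y"
  shows "integrable M (\<lambda>\<omega>. prod (X \<omega>) (Y \<omega>))"
proof -
  obtain k where k: "k > 0" "\<And>a b. norm (prod a b) \<le> k * (norm a * norm b)"
    using bounded_bilinear_pos_bound[OF bil] by blast
  show ?thesis
  proof (rule Bochner_Integration.integrable_bound)
    show "integrable M (\<lambda>\<omega>. k * ((norm (X \<omega>))\<^sup>2 + (norm (Y \<omega>))\<^sup>2))"
      using X Y by (intro integrable_mult_right Bochner_Integration.integrable_add square_integrable_norm2)
    show "(\<lambda>\<omega>. prod (X \<omega>) (Y \<omega>)) \<in> borel_measurable M"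
      using X Y by (intro borel_measurable_bounded_bilinear[OF bil] square_integrable_measurable)
    show "AE \<omega> in M. norm (prod (X \<omega>) (Y \<omega>)) \<le> norm (k * ((norm (X \<omega>))\<^sup>2 + (norm (Y \<omega>))\<^sup>2))"
    proof (rule AE_I2)
      fix \<omega>
      have "norm (prod (X \<omega>) (Y \<omega>)) \<le> k * (norm (X \<omega>) * norm (Y \<omega>))" by (rule k)
      also have "\<dots> \<le> k * ((norm (X \<omega>))\<^sup>2 + (norm (Y \<omega>))\<^sup>2)"
        using k(1) by (intro mult_left_mono norm_mult_le_squares) auto
      also have "\<dots> \<le> norm \<dots>" by simp
      finally show "norm (prod (X \<omega>) (Y \<omega>)) \<le> norm (k * ((norm (X \<omega>))\<^sup>2 + (norm (Y \<omega>))\<^sup>2))" .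
    qed
  qed
qed

lemmas square_integrable_inner = square_integrable_bounded_bilinear[OF bounded_bilinear_inner]

lemma square_integrable_bound:
  assumes X: "square_integrable M X" and Y: "Y \<in> borel_measurable M"
    and le: "AE \<omega> in M. norm (Y \<omega>) \<le> c * norm (X \<omega>)"
  shows "square_integrable M Y"
  unfolding square_integrable_def
proof (intro conjI Y)
  show "integrable M (\<lambda>\<omega>. (norm (Y \<omega>))\<^sup>2)"
  proof (rule Bochner_Integration.integrable_bound)
    show "integrable M (\<lambda>\<omega>. c\<^sup>2 * (norm (X \<omega>))\<^sup>2)"
      using X by (intro integrable_mult_right square_integrable_norm2)
    show "(\<lambda>\<omega>. (norm (Y \<omega>))\<^sup>2) \<in> borel_measurable M" using Y by measurable
    show "AE \<omega> in M. norm ((norm (Y \<omega>))\<^sup>2) \<le> norm (c\<^sup>2 * (norm (X \<omega>))\<^sup>2)"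
      using le by eventually_elim (metis norm_ge_zero power_mono power_mult_distrib abs_of_nonneg
        real_norm_def zero_le_power2)
  qed
qed

lemma square_integrable_add:
  assumes X: "square_integrable M X" and Y: "square_integrable M Y"
  shows "square_integrable M (\<lambda>\<omega>. X \<omega> + Y \<omega>)"
  unfolding square_integrable_def
proof (intro conjI)
  show m: "(\<lambda>\<omega>. X \<omega> + Y \<omega>) \<in> borel_measurable M"
    using X Y by (intro borel_measurable_add square_integrable_measurable)
  show "integrable M (\<lambda>\<omega>. (norm (X \<omega> + Y \<omega>))\<^sup>2)"
  proof (rule Bochner_Integration.integrable_bound)
    show "integrable M (\<lambda>\<omega>. 2 * (norm (X \<omega>))\<^sup>2 + 2 * (norm (Y \<omega>))\<^sup>2)"
      using X Y by (intro integrable_mult_right Bochner_Integration.integrable_add square_integrable_norm2)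
    show "(\<lambda>\<omega>. (norm (X \<omega> + Y \<omega>))\<^sup>2) \<in> borel_measurable M" using m by measurable
    show "AE \<omega> in M. norm ((norm (X \<omega> + Y \<omega>))\<^sup>2) \<le> norm (2 * (norm (X \<omega>))\<^sup>2 + 2 * (norm (Y \<omega>))\<^sup>2)"
      by (rule AE_I2) (use norm_add_squared_le in auto)
  qed
qed

lemma square_integrable_scaleR:
  assumes "square_integrable M X"
  shows "square_integrable M (\<lambda>\<omega>. c *\<^sub>R X \<omega>)"
  by (rule square_integrable_bound[OF assms, of _ "\<bar>c\<bar>"])
    (use assms in \<open>auto simp: square_integrable_def\<close>)

lemma square_integrable_minus:
  assumes "square_integrable M X"
  shows "square_integrable M (\<lambda>\<omega>. - X \<omega>)"
  using square_integrable_scaleR[OF assms, of "-1"] by simp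

lemma square_integrable_diff:
  assumes X: "square_integrable M X" and Y: "square_integrable M Y"
  shows "square_integrable M (\<lambda>\<omega>. X \<omega> - Y \<omega>)"
  using square_integrable_add[OF X square_integrable_minus[OF Y]] by simp

lemma square_integrable_zero: "square_integrable M (\<lambda>\<omega>. 0)"
  by (simp add: square_integrable_def)

lemma square_integrable_sum:
  assumes "\<And>i. i \<in> I \<Longrightarrow> square_integrable M (X i)"
  shows "square_integrable M (\<lambda>\<omega>. \<Sum>i\<in>I. X i \<omega>)"
  using assms
  by (induction I rule: infinite_finite_induct)
    (auto intro: square_integrable_add square_integrable_zero)

lemma square_integrable_iff_nn_integral:
  assumes "X \<in> borel_measurable M"
  shows "square_integrable M X \<longleftrightarrow> (\<integral>\<^sup>+\<omega>. ennreal ((norm (X \<omega>))\<^sup>2) \<partial>M) < \<infinity>"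
  using assms by (simp add: square_integrable_def integrable_iff_bounded)

lemma nn_integral_square_integrable:
  assumes "square_integrable M X"
  shows "(\<integral>\<^sup>+\<omega>. ennreal ((norm (X \<omega>))\<^sup>2) \<partial>M) = ennreal (LINT \<omega>|M. (norm (X \<omega>))\<^sup>2)"
  using assms by (intro nn_integral_eq_integral square_integrable_norm2) auto

lemma (in finite_measure) square_integrable_bounded:
  assumes "X \<in> borel_measurable M" "\<And>\<omega>. \<omega> \<in> space M \<Longrightarrow> norm (X \<omega>) \<le> c"
  shows "square_integrable M X"
  unfolding square_integrable_def
proof (intro conjI assms(1) integrable_const_bound[of _ "c\<^sup>2"])
  show "AE \<omega> in M. norm ((norm (X \<omega>))\<^sup>2) \<le> c\<^sup>2"
    using assms(2) by (auto intro!: AE_I2 power_mono)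
qed (use assms(1) in measurable)

lemma (in finite_measure) square_integrable_imp_integrable:
  assumes "square_integrable M X"
  shows "integrable M X"
  using square_integrable_bounded_bilinear[OF bounded_bilinear_scaleR
    square_integrable_bounded[of "\<lambda>_. 1::real" 1] assms] by simp

lemma (in finite_measure) integrable_scaleR_bounded:
  fixes X :: "'a \<Rightarrow> real" and \<xi> :: "'a \<Rightarrow> 'v::euclidean_space"
  assumes "integrable M X" "\<xi> \<in> borel_measurable M" "\<And>\<omega>. \<omega> \<in> space M \<Longrightarrow> norm (\<xi> \<omega>) \<le> c"
  shows "integrable M (\<lambda>\<omega>. X \<omega> *\<^sub>R \<xi> \<omega>)"
proof (rule Bochner_Integration.integrable_bound)
  show "integrable M (\<lambda>\<omega>. c * X \<omega>)" using assms by simp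
  show "(\<lambda>\<omega>. X \<omega> *\<^sub>R \<xi> \<omega>) \<in> borel_measurable M" using assms by measurable
  show "AE \<omega> in M. norm (X \<omega> *\<^sub>R \<xi> \<omega>) \<le> norm (c * X \<omega>)"
  proof (rule AE_I2)
    fix \<omega> assume "\<omega> \<in> space M"
    from assms(3)[OF this] have "\<bar>X \<omega>\<bar> * norm (\<xi> \<omega>) \<le> \<bar>X \<omega>\<bar> * \<bar>c\<bar>"
      by (intro mult_left_mono) auto
    then show "norm (X \<omega> *\<^sub>R \<xi> \<omega>) \<le> norm (c * X \<omega>)" by (simp add: abs_mult mult.commute)
  qed
qed

text \<open>\<open>null_sets_F\<close> keeps a limit adapted when its paths are redefined on an
  exceptional null set.\<close>

locale filtered_prob_space = prob_space M for M :: "'w measure" +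
  fixes F :: "real \<Rightarrow> 'w measure"
  assumes space_F: "space (F t) = space M"
    and sets_F: "sets (F t) \<subseteq> sets M"
    and F_mono: "s \<le> t \<Longrightarrow> sets (F s) \<subseteq> sets (F t)"
    and null_sets_F: "null_sets M \<subseteq> sets (F t)"
begin

lemma F_measurable_M: "X \<in> measurable (F t) N \<Longrightarrow> X \<in> measurable M N"
  using sets_F[of t] space_F[of t] unfolding measurable_def by auto

lemma F_measurable_mono: "X \<in> measurable (F s) N \<Longrightarrow> s \<le> t \<Longrightarrow> X \<in> measurable (F t) N"
  using F_mono[of s t] space_F unfolding measurable_def by auto

end

locale brownian_space = filtered_prob_space M F for M :: "'w measure" and F +
  fixes w :: "real \<Rightarrow> 'w \<Rightarrow> real"
  assumes bm: "brownian_motion M F w"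
begin

lemma w_F: "0 \<le> t \<Longrightarrow> t \<le> s \<Longrightarrow> w t \<in> borel_measurable (F s)"
  using bm F_measurable_mono unfolding brownian_motion_def by blast

lemma w_M: "0 \<le> t \<Longrightarrow> w t \<in> borel_measurable M"
  using bm unfolding brownian_motion_def by blast

lemma increment_moments:
  assumes "0 \<le> s" "s \<le> t"
  shows "integrable M (\<lambda>\<omega>. w t \<omega> - w s \<omega>)" "expectation (\<lambda>\<omega>. w t \<omega> - w s \<omega>) = 0"
    "integrable M (\<lambda>\<omega>. (w t \<omega> - w s \<omega>)\<^sup>2)" "expectation (\<lambda>\<omega>. (w t \<omega> - w s \<omega>)\<^sup>2) = t - s"
proof -
  let ?X = "\<lambda>\<omega>. w t \<omega> - w s \<omega>"
  have "integrable M ?X \<and> expectation ?X = 0 \<and> integrable M (\<lambda>\<omega>. (?X \<omega>)\<^sup>2)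
      \<and> expectation (\<lambda>\<omega>. (?X \<omega>)\<^sup>2) = t - s"
  proof (cases "s = t")
    case False
    with assms have st: "s < t" by simp
    then have D: "distributed M lborel ?X (normal_density 0 (sqrt (t - s)))"
      using bm assms unfolding brownian_motion_def by blast
    have p: "0 < sqrt (t - s)" using st by simp
    have e: "expectation ?X = 0"
      by (rule normal_distributed_expectation[OF p D])
    have v: "expectation (\<lambda>\<omega>. (?X \<omega>)\<^sup>2) = t - s"
      using normal_distributed_variance[OF p D] e st by simp
    have i: "integrable M ?X"
      using distributed_integrable[OF D, of "\<lambda>x. x"] integrable_normal_moment[OF p, of 0 1]
      by simp
    have i2: "integrable M (\<lambda>\<omega>. (?X \<omega>)\<^sup>2)"
      using distributed_integrable[OF D, of "\<lambda>x. x\<^sup>2"] integrable_normal_moment[OF p, of 0 2]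
      by simp
    show ?thesis using e v i i2 by simp
  qed simp
  then show "integrable M ?X" "expectation ?X = 0" "integrable M (\<lambda>\<omega>. (?X \<omega>)\<^sup>2)"
    "expectation (\<lambda>\<omega>. (?X \<omega>)\<^sup>2) = t - s" by auto
qed

lemma increment_indep:
  fixes Z :: "'w \<Rightarrow> real"
  assumes st: "0 \<le> s" "s < t" and Z: "Z \<in> borel_measurable (F s)"
  shows "indep_var borel Z borel (\<lambda>\<omega>. w t \<omega> - w s \<omega>)"
  unfolding indep_var_eq
proof (intro conjI)
  let ?X = "\<lambda>\<omega>. w t \<omega> - w s \<omega>"
  let ?I = "{?X -` A \<inter> space M |A. A \<in> sets borel}"
  show "random_variable borel Z" using Z by (rule F_measurable_M)
  show X: "random_variable borel ?X" using w_M st by simp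
  have ind: "indep_set (sets (F s)) ?I"
    using bm st unfolding brownian_motion_def by blast
  have "?I = sets (vimage_algebra (space M) ?X borel)"
    by (subst sets_vimage_algebra2) auto
  \<comment> \<open>The preimages of Borel sets already form a \<sigma>-algebra, so nothing is added
    when \<open>indep_var\<close> generates one from them.\<close>
  then have e: "sigma_sets (space M) ?I = ?I"
    using sets.sigma_sets_eq[of "vimage_algebra (space M) ?X borel"] by simp
  have "sigma_sets (space M) {Z -` A \<inter> space M |A. A \<in> sets borel} \<subseteq> sets (F s)"
    using Z measurable_sets[OF Z] space_F[of s]
    by (intro sets.sigma_sets_subset[of _ "F s", unfolded space_F]) auto
  then show "indep_set (sigma_sets (space M) {Z -` A \<inter> space M |A. A \<in> sets borel})
      (sigma_sets (space M) ?I)"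
    unfolding e using ind unfolding indep_sets2_eq by blast
qed

lemma increment_mult:
  fixes Z :: "'w \<Rightarrow> real"
  assumes st: "0 \<le> s" "s \<le> t" and Z: "Z \<in> borel_measurable (F s)" "integrable M Z"
  shows "integrable M (\<lambda>\<omega>. Z \<omega> * (w t \<omega> - w s \<omega>))" "expectation (\<lambda>\<omega>. Z \<omega> * (w t \<omega> - w s \<omega>)) = 0"
    "integrable M (\<lambda>\<omega>. Z \<omega> * (w t \<omega> - w s \<omega>)\<^sup>2)"
    "expectation (\<lambda>\<omega>. Z \<omega> * (w t \<omega> - w s \<omega>)\<^sup>2) = expectation Z * (t - s)"
proof -
  let ?X = "\<lambda>\<omega>. w t \<omega> - w s \<omega>"
  have "integrable M (\<lambda>\<omega>. Z \<omega> * ?X \<omega>) \<and> expectation (\<lambda>\<omega>. Z \<omega> * ?X \<omega>) = 0 \<and>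
    integrable M (\<lambda>\<omega>. Z \<omega> * (?X \<omega>)\<^sup>2) \<and> expectation (\<lambda>\<omega>. Z \<omega> * (?X \<omega>)\<^sup>2) = expectation Z * (t - s)"
  proof (cases "s = t")
    case False
    with st have lt: "s < t" by simp
    note i = increment_indep[OF st(1) lt Z(1)]
    have i2: "indep_var borel Z borel (\<lambda>\<omega>. (?X \<omega>)\<^sup>2)"
      using indep_var_compose[OF i, of "\<lambda>x. x" borel "\<lambda>x. x\<^sup>2" borel] by (simp add: comp_def)
    note m = increment_moments[OF st]
    show ?thesis
      using indep_var_integrable[OF i Z(2) m(1)] indep_var_lebesgue_integral[OF i Z(2) m(1)]
        indep_var_integrable[OF i2 Z(2) m(3)] indep_var_lebesgue_integral[OF i2 Z(2) m(3)] m(2,4)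
      by simp
  qed simp
  then show "integrable M (\<lambda>\<omega>. Z \<omega> * ?X \<omega>)" "expectation (\<lambda>\<omega>. Z \<omega> * ?X \<omega>) = 0"
    "integrable M (\<lambda>\<omega>. Z \<omega> * (?X \<omega>)\<^sup>2)" "expectation (\<lambda>\<omega>. Z \<omega> * (?X \<omega>)\<^sup>2) = expectation Z * (t - s)"
    by auto
qed

lemma integrable_bounded_mult_increment:
  fixes Z :: "'w \<Rightarrow> real"
  assumes st: "0 \<le> s" "s \<le> t" and Z: "Z \<in> borel_measurable M" "\<And>\<omega>. \<omega> \<in> space M \<Longrightarrow> \<bar>Z \<omega>\<bar> \<le> c"
  shows "integrable M (\<lambda>\<omega>. Z \<omega> * (w t \<omega> - w s \<omega>))"
  using integrable_scaleR_bounded[OF increment_moments(1)[OF st] Z(1), of c] Z(2)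
  by (simp add: mult.commute)

text \<open>Since the intervals of a simple process may overlap, the isometry rests on the
  covariance of two arbitrary increments. If \<open>b \<le> c\<close>, the second increment is
  independent of everything before it. Otherwise both increments are cut at \<open>c\<close> and at
  \<open>e\<close>, the smaller of the right ends: of the resulting products only the square over
  the overlap from \<open>c\<close> to \<open>e\<close> has a mean, and the others pair an increment
  with a factor known when it starts. \<open>Z\<close> need only be known at the later of the two
  left ends.\<close>

lemma increment_product_aux:
  fixes Z :: "'w \<Rightarrow> real"
  assumes ab: "0 \<le> a" "a \<le> b" and cd: "c \<le> d" and ac: "a \<le> c"
    and Z: "Z \<in> borel_measurable (F c)" "\<And>\<omega>. \<omega> \<in> space M \<Longrightarrow> \<bar>Z \<omega>\<bar> \<le> C"
  shows "integrable M (\<lambda>\<omega>. Z \<omega> * (w b \<omega> - w a \<omega>) * (w d \<omega> - w c \<omega>)) \<and>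
    expectation (\<lambda>\<omega>. Z \<omega> * (w b \<omega> - w a \<omega>) * (w d \<omega> - w c \<omega>)) = expectation Z * max 0 (min b d - c)"
proof -
  have ZM: "Z \<in> borel_measurable M" using Z(1) by (rule F_measurable_M)
  have Zi: "integrable M Z"
    using ZM Z(2) by (intro integrable_const_bound[of _ C]) auto
  have c: "0 \<le> c" using ab ac by simp
  have before: "integrable M (\<lambda>\<omega>. (Z \<omega> * (w e \<omega> - w a \<omega>)) * (w d \<omega> - w c \<omega>))"
    "expectation (\<lambda>\<omega>. (Z \<omega> * (w e \<omega> - w a \<omega>)) * (w d \<omega> - w c \<omega>)) = 0" if "a \<le> e" "e \<le> c" for e
  proof -
    have 1: "(\<lambda>\<omega>. Z \<omega> * (w e \<omega> - w a \<omega>)) \<in> borel_measurable (F c)"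
      using Z(1) by (intro borel_measurable_times borel_measurable_diff w_F) (use that ab in auto)
    have 2: "integrable M (\<lambda>\<omega>. Z \<omega> * (w e \<omega> - w a \<omega>))"
      using integrable_bounded_mult_increment[OF _ _ ZM Z(2)] ab that by simp
    show "integrable M (\<lambda>\<omega>. (Z \<omega> * (w e \<omega> - w a \<omega>)) * (w d \<omega> - w c \<omega>))"
      "expectation (\<lambda>\<omega>. (Z \<omega> * (w e \<omega> - w a \<omega>)) * (w d \<omega> - w c \<omega>)) = 0"
      using increment_mult[OF c cd 1 2] by auto
  qed
  have after: "integrable M (\<lambda>\<omega>. (Z \<omega> * (w e \<omega> - w c \<omega>)) * (w g \<omega> - w e \<omega>))"
    "expectation (\<lambda>\<omega>. (Z \<omega> * (w e \<omega> - w c \<omega>)) * (w g \<omega> - w e \<omega>)) = 0" if "c \<le> e" "e \<le> g" for e g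
  proof -
    have 1: "(\<lambda>\<omega>. Z \<omega> * (w e \<omega> - w c \<omega>)) \<in> borel_measurable (F e)"
      using F_measurable_mono[OF Z(1) that(1)]
      by (intro borel_measurable_times borel_measurable_diff w_F) (use that c in auto)
    have 2: "integrable M (\<lambda>\<omega>. Z \<omega> * (w e \<omega> - w c \<omega>))"
      using integrable_bounded_mult_increment[OF _ _ ZM Z(2)] c that by simp
    show "integrable M (\<lambda>\<omega>. (Z \<omega> * (w e \<omega> - w c \<omega>)) * (w g \<omega> - w e \<omega>))"
      "expectation (\<lambda>\<omega>. (Z \<omega> * (w e \<omega> - w c \<omega>)) * (w g \<omega> - w e \<omega>)) = 0"
      using increment_mult[OF _ _ 1 2] c that by auto
  qed
  show ?thesis
  proof (cases "b \<le> c")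
    case True
    then show ?thesis using before[of b] ab by simp
  next
    case False
    define e where "e = min b d"
    define g where "g = max b d"
    have e: "c \<le> e" "e \<le> g" using False cd by (auto simp: e_def g_def)
    have eq: "Z \<omega> * (w b \<omega> - w a \<omega>) * (w d \<omega> - w c \<omega>) =
        (Z \<omega> * (w c \<omega> - w a \<omega>)) * (w d \<omega> - w c \<omega>) + (Z \<omega> * (w e \<omega> - w c \<omega>)\<^sup>2
          + (Z \<omega> * (w e \<omega> - w c \<omega>)) * (w g \<omega> - w e \<omega>))" for \<omega>
      by (cases "b \<le> d") (simp_all add: e_def g_def algebra_simps power2_eq_square)
    note i = before[of c] ac after[OF e] increment_mult(3,4)[OF c e(1) Z(1) Zi]
    show ?thesis
      unfolding eq using i e(1) by (simp add: e_def)
  qed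
qed

lemma increment_product:
  fixes Z :: "'w \<Rightarrow> real"
  assumes ab: "0 \<le> a" "a \<le> b" and cd: "0 \<le> c" "c \<le> d"
    and Z: "Z \<in> borel_measurable (F (max a c))" "\<And>\<omega>. \<omega> \<in> space M \<Longrightarrow> \<bar>Z \<omega>\<bar> \<le> C"
  shows "integrable M (\<lambda>\<omega>. Z \<omega> * (w b \<omega> - w a \<omega>) * (w d \<omega> - w c \<omega>)) \<and>
    expectation (\<lambda>\<omega>. Z \<omega> * (w b \<omega> - w a \<omega>) * (w d \<omega> - w c \<omega>)) = expectation Z * max 0 (min b d - max a c)"
proof (cases "a \<le> c")
  case True
  then show ?thesis using increment_product_aux[OF ab cd(2) True, of Z C] Z by (simp add: max_absorb2)
next
  case False
  then have "c \<le> a" by simp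
  from increment_product_aux[OF cd ab(2) this, of Z C] Z this show ?thesis
    by (simp add: max_absorb1 min.commute mult_ac)
qed

end

section \<open>Integrals of simple processes\<close>

abbreviation left_end :: "(real \<times> real \<times> ('w \<Rightarrow> 'v)) list \<Rightarrow> nat \<Rightarrow> real" where
  "left_end \<Phi> i \<equiv> fst (\<Phi> ! i)"

abbreviation right_end :: "(real \<times> real \<times> ('w \<Rightarrow> 'v)) list \<Rightarrow> nat \<Rightarrow> real" where
  "right_end \<Phi> i \<equiv> fst (snd (\<Phi> ! i))"

abbreviation coefficient :: "(real \<times> real \<times> ('w \<Rightarrow> 'v)) list \<Rightarrow> nat \<Rightarrow> 'w \<Rightarrow> 'v" where
  "coefficient \<Phi> i \<equiv> snd (snd (\<Phi> ! i))"

lemma simple_value_sum: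
  "simple_value \<Phi> t \<omega> =
    (\<Sum>i<length \<Phi>. indicator {left_end \<Phi> i<..right_end \<Phi> i} t *\<^sub>R coefficient \<Phi> i \<omega>)"
  by (simp add: simple_value_def sum_list_sum_nth case_prod_beta atLeast0LessThan)

lemma simple_integral_sum:
  "simple_integral w \<Phi> t \<omega> = (\<Sum>i<length \<Phi>.
    (w (min t (right_end \<Phi> i)) \<omega> - w (min t (left_end \<Phi> i)) \<omega>) *\<^sub>R coefficient \<Phi> i \<omega>)"
  by (simp add: simple_integral_def sum_list_sum_nth case_prod_beta atLeast0LessThan)

lemma simple_processD:
  assumes "simple_process M F T \<Phi>" "i < length \<Phi>"
  shows "0 \<le> left_end \<Phi> i" "left_end \<Phi> i \<le> right_end \<Phi> i" "right_end \<Phi> i \<le> T"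
    "coefficient \<Phi> i \<in> borel_measurable (F (left_end \<Phi> i))"
    "\<exists>C\<ge>0. \<forall>\<omega>\<in>space M. norm (coefficient \<Phi> i \<omega>) \<le> C"
proof -
  have "\<Phi> ! i \<in> set \<Phi>" using assms(2) by simp
  then have *: "0 \<le> left_end \<Phi> i \<and> left_end \<Phi> i \<le> right_end \<Phi> i \<and> right_end \<Phi> i \<le> T \<and>
    coefficient \<Phi> i \<in> borel_measurable (F (left_end \<Phi> i)) \<and> bounded (coefficient \<Phi> i ` space M)"
    using assms(1) unfolding simple_process_def by (metis (mono_tags, lifting) case_prodD prod.collapse)
  then show "0 \<le> left_end \<Phi> i" "left_end \<Phi> i \<le> right_end \<Phi> i" "right_end \<Phi> i \<le> T"
    "coefficient \<Phi> i \<in> borel_measurable (F (left_end \<Phi> i))" by auto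
  from * obtain C where "\<forall>x\<in>coefficient \<Phi> i ` space M. norm x \<le> C"
    unfolding bounded_iff by blast
  then show "\<exists>C\<ge>0. \<forall>\<omega>\<in>space M. norm (coefficient \<Phi> i \<omega>) \<le> C"
    by (intro exI[of _ "max 0 C"]) (auto intro: max.coboundedI2)
qed

text \<open>Because intervals may overlap, a difference of simple processes is a mere concatenation,
  without a common refinement.\<close>

definition simple_minus :: "(real \<times> real \<times> ('w \<Rightarrow> 'v::euclidean_space)) list \<Rightarrow>
    (real \<times> real \<times> ('w \<Rightarrow> 'v)) list \<Rightarrow> (real \<times> real \<times> ('w \<Rightarrow> 'v)) list" where
  "simple_minus \<Phi> \<Psi> = \<Phi> @ map (\<lambda>(a, b, \<xi>). (a, b, \<lambda>\<omega>. - \<xi> \<omega>)) \<Psi>"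

lemma simple_process_minus:
  assumes "simple_process M F T \<Phi>" "simple_process M F T \<Psi>"
  shows "simple_process M F T (simple_minus \<Phi> \<Psi>)"
  using assms unfolding simple_process_def simple_minus_def
  by (fastforce simp: bounded_iff)

lemma simple_value_minus:
  "simple_value (simple_minus \<Phi> \<Psi>) t \<omega> = simple_value \<Phi> t \<omega> - simple_value \<Psi> t \<omega>"
proof -
  have "simple_value (map (\<lambda>(a, b, \<xi>). (a, b, \<lambda>\<omega>. - \<xi> \<omega>)) \<Psi>) t \<omega> = - simple_value \<Psi> t \<omega>"
    by (induction \<Psi>) (auto simp: simple_value_def)
  moreover have "simple_value (\<Phi> @ \<Theta>) t \<omega> = simple_value \<Phi> t \<omega> + simple_value \<Theta> t \<omega>" for \<Theta>
    by (simp add: simple_value_def)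
  ultimately show ?thesis by (simp add: simple_minus_def)
qed

lemma simple_integral_minus:
  "simple_integral w (simple_minus \<Phi> \<Psi>) t \<omega> = simple_integral w \<Phi> t \<omega> - simple_integral w \<Psi> t \<omega>"
proof -
  have "simple_integral w (map (\<lambda>(a, b, \<xi>). (a, b, \<lambda>\<omega>. - \<xi> \<omega>)) \<Psi>) t \<omega> = - simple_integral w \<Psi> t \<omega>"
    by (induction \<Psi>) (auto simp: simple_integral_def)
  moreover have "simple_integral w (\<Phi> @ \<Theta>) t \<omega> = simple_integral w \<Phi> t \<omega> + simple_integral w \<Theta> t \<omega>" for \<Theta>
    by (simp add: simple_integral_def)
  ultimately show ?thesis by (simp add: simple_minus_def)
qed

lemma simple_integral_continuous:
  assumes "simple_process M F T \<Phi>" "continuous_on {0..} (\<lambda>t. w t \<omega>)"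
  shows "continuous_on {0..} (\<lambda>t. simple_integral w \<Phi> t \<omega>)"
  unfolding simple_integral_sum
proof (intro continuous_intros)
  fix i assume "i \<in> {..<length \<Phi>}"
  then have "i < length \<Phi>" by simp
  note D = simple_processD(1,2)[OF assms(1) this]
  have *: "continuous_on {0..} (\<lambda>t. w (min t c) \<omega>)" if "c \<ge> 0" for c
    by (rule continuous_on_compose2[OF assms(2), of _ "\<lambda>t. min t c"])
      (use that in \<open>auto intro!: continuous_intros\<close>)
  show "continuous_on {0..} (\<lambda>t. w (min t (right_end \<Phi> i)) \<omega>)"
    "continuous_on {0..} (\<lambda>t. w (min t (left_end \<Phi> i)) \<omega>)"
    using D by (auto intro!: *)
qed

lemma measure_lborel_Ioc_max: "measure lborel {a<..b::real} = max 0 (b - a)"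
  by (cases "a \<le> b") auto

lemma inner_sum_sum:
  "(norm (\<Sum>i\<in>I. f i))\<^sup>2 = (\<Sum>i\<in>I. \<Sum>j\<in>I. f i \<bullet> (f j :: 'a::real_inner))"
  by (simp add: power2_norm_eq_inner inner_sum_left inner_sum_right) (rule sum.swap)

context brownian_space
begin

lemma simple_integral_measurable:
  assumes \<Phi>: "simple_process M F T \<Phi>" and t: "0 \<le> t"
  shows "simple_integral w \<Phi> t \<in> borel_measurable (F t)"
proof -
  have "(\<lambda>\<omega>. (w (min t (right_end \<Phi> i)) \<omega> - w (min t (left_end \<Phi> i)) \<omega>) *\<^sub>R coefficient \<Phi> i \<omega>)
      \<in> borel_measurable (F t)" if i: "i < length \<Phi>" for i
  proof (cases "left_end \<Phi> i \<le> t")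
    case True
    note D = simple_processD[OF \<Phi> i]
    show ?thesis
      using D t by (intro borel_measurable_scaleR borel_measurable_diff w_F F_measurable_mono[OF D(4) True]) auto
  next
    case False
    \<comment> \<open>A term whose interval starts after \<open>t\<close> has a zero increment. This
      matters because its coefficient need not be known at time \<open>t\<close>.\<close>
    then have "min t (left_end \<Phi> i) = t" "min t (right_end \<Phi> i) = t"
      using simple_processD(2)[OF \<Phi> i] by auto
    then show ?thesis by simp
  qed
  then have "(\<lambda>\<omega>. simple_integral w \<Phi> t \<omega>) \<in> borel_measurable (F t)"
    unfolding simple_integral_sum by (intro borel_measurable_sum) auto
  then show ?thesis by simp
qed

text \<open>The length of the common part of two intervals is written as a Lebesgue measure so that
  it agrees literally with the time integral of the product of their indicators.\<close>

lemma simple_term_product: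
  assumes \<Phi>: "simple_process M F T \<Phi>" and t: "0 \<le> t" and i: "i < length \<Phi>" and j: "j < length \<Phi>"
  defines "X \<equiv> (\<lambda>i \<omega>. (w (min t (right_end \<Phi> i)) \<omega> - w (min t (left_end \<Phi> i)) \<omega>) *\<^sub>R coefficient \<Phi> i \<omega>)"
  shows "integrable M (\<lambda>\<omega>. X i \<omega> \<bullet> X j \<omega>) \<and>
    expectation (\<lambda>\<omega>. X i \<omega> \<bullet> X j \<omega>) = expectation (\<lambda>\<omega>. coefficient \<Phi> i \<omega> \<bullet> coefficient \<Phi> j \<omega>) *
      measure lborel ({left_end \<Phi> i<..right_end \<Phi> i} \<inter> {left_end \<Phi> j<..right_end \<Phi> j} \<inter> {0..t})"
proof -
  note Di = simple_processD[OF \<Phi> i] and Dj = simple_processD[OF \<Phi> j]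
  let ?m = "max (left_end \<Phi> i) (left_end \<Phi> j)"
  have set: "{left_end \<Phi> i<..right_end \<Phi> i} \<inter> {left_end \<Phi> j<..right_end \<Phi> j} \<inter> {0..t} =
      {?m<..min (min t (right_end \<Phi> i)) (min t (right_end \<Phi> j))}"
    using Di Dj by auto
  show ?thesis
  proof (cases "?m < t")
    case True
    obtain Ci where Ci: "Ci \<ge> 0" "\<And>\<omega>. \<omega> \<in> space M \<Longrightarrow> norm (coefficient \<Phi> i \<omega>) \<le> Ci" using Di(5) by blast
    obtain Cj where Cj: "Cj \<ge> 0" "\<And>\<omega>. \<omega> \<in> space M \<Longrightarrow> norm (coefficient \<Phi> j \<omega>) \<le> Cj" using Dj(5) by blast
    let ?Z = "\<lambda>\<omega>. coefficient \<Phi> i \<omega> \<bullet> coefficient \<Phi> j \<omega>"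
    have Z: "?Z \<in> borel_measurable (F ?m)"
      by (intro borel_measurable_inner F_measurable_mono[OF Di(4)] F_measurable_mono[OF Dj(4)]) auto
    have Zb: "\<bar>?Z \<omega>\<bar> \<le> Ci * Cj" if "\<omega> \<in> space M" for \<omega>
      using Cauchy_Schwarz_ineq2[of "coefficient \<Phi> i \<omega>" "coefficient \<Phi> j \<omega>"]
        mult_mono[OF Ci(2)[OF that] Cj(2)[OF that]] Ci(1) by simp
    have m: "min t (left_end \<Phi> i) = left_end \<Phi> i" "min t (left_end \<Phi> j) = left_end \<Phi> j"
      using True by auto
    have eq: "X i \<omega> \<bullet> X j \<omega> = ?Z \<omega> * (w (min t (right_end \<Phi> i)) \<omega> - w (left_end \<Phi> i) \<omega>)
        * (w (min t (right_end \<Phi> j)) \<omega> - w (left_end \<Phi> j) \<omega>)" for \<omega>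
      by (simp add: X_def m)
    show ?thesis
      unfolding eq set measure_lborel_Ioc_max
      by (rule increment_product[OF _ _ _ _ Z Zb]) (use Di Dj True in auto)
  next
    case False
    then have "min t (left_end \<Phi> i) = t \<and> min t (right_end \<Phi> i) = t \<or>
        min t (left_end \<Phi> j) = t \<and> min t (right_end \<Phi> j) = t"
      using Di(2) Dj(2) by auto
    then have "X i \<omega> \<bullet> X j \<omega> = 0" for \<omega> by (auto simp: X_def)
    moreover have "measure lborel {?m<..min (min t (right_end \<Phi> i)) (min t (right_end \<Phi> j))} = 0"
      unfolding measure_lborel_Ioc_max using False by auto
    ultimately show ?thesis unfolding set by simp
  qed
qed

lemma simple_integral_square:
  assumes \<Phi>: "simple_process M F T \<Phi>" and t: "0 \<le> t"
  shows "square_integrable M (simple_integral w \<Phi> t)"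
    and "expectation (\<lambda>\<omega>. (norm (simple_integral w \<Phi> t \<omega>))\<^sup>2) =
      (\<Sum>i<length \<Phi>. \<Sum>j<length \<Phi>. expectation (\<lambda>\<omega>. coefficient \<Phi> i \<omega> \<bullet> coefficient \<Phi> j \<omega>) *
        measure lborel ({left_end \<Phi> i<..right_end \<Phi> i} \<inter> {left_end \<Phi> j<..right_end \<Phi> j} \<inter> {0..t}))"
proof -
  let ?X = "\<lambda>i \<omega>. (w (min t (right_end \<Phi> i)) \<omega> - w (min t (left_end \<Phi> i)) \<omega>) *\<^sub>R coefficient \<Phi> i \<omega>"
  have eq: "(norm (simple_integral w \<Phi> t \<omega>))\<^sup>2 = (\<Sum>i<length \<Phi>. \<Sum>j<length \<Phi>. ?X i \<omega> \<bullet> ?X j \<omega>)" for \<omega>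
    unfolding simple_integral_sum by (rule inner_sum_sum)
  have i: "integrable M (\<lambda>\<omega>. ?X i \<omega> \<bullet> ?X j \<omega>)" if "i < length \<Phi>" "j < length \<Phi>" for i j
    using simple_term_product[OF \<Phi> t that] by blast
  have e: "expectation (\<lambda>\<omega>. ?X i \<omega> \<bullet> ?X j \<omega>) = expectation (\<lambda>\<omega>. coefficient \<Phi> i \<omega> \<bullet> coefficient \<Phi> j \<omega>) *
        measure lborel ({left_end \<Phi> i<..right_end \<Phi> i} \<inter> {left_end \<Phi> j<..right_end \<Phi> j} \<inter> {0..t})"
    if "i < length \<Phi>" "j < length \<Phi>" for i j
    using simple_term_product[OF \<Phi> t that] by blast
  show "square_integrable M (simple_integral w \<Phi> t)"
    unfolding square_integrable_def eq
    by (intro conjI F_measurable_M[OF simple_integral_measurable[OF \<Phi> t]] Bochner_Integration.integrable_sum i) auto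
  have "expectation (\<lambda>\<omega>. (norm (simple_integral w \<Phi> t \<omega>))\<^sup>2) =
      (\<Sum>i<length \<Phi>. \<Sum>j<length \<Phi>. expectation (\<lambda>\<omega>. ?X i \<omega> \<bullet> ?X j \<omega>))"
    unfolding eq
    by (subst Bochner_Integration.integral_sum, (intro Bochner_Integration.integrable_sum i; simp))
      (intro sum.cong refl Bochner_Integration.integral_sum i; simp)
  also have "\<dots> = (\<Sum>i<length \<Phi>. \<Sum>j<length \<Phi>. expectation (\<lambda>\<omega>. coefficient \<Phi> i \<omega> \<bullet> coefficient \<Phi> j \<omega>) *
        measure lborel ({left_end \<Phi> i<..right_end \<Phi> i} \<inter> {left_end \<Phi> j<..right_end \<Phi> j} \<inter> {0..t}))"
    by (intro sum.cong refl e) auto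
  finally show "expectation (\<lambda>\<omega>. (norm (simple_integral w \<Phi> t \<omega>))\<^sup>2) =
      (\<Sum>i<length \<Phi>. \<Sum>j<length \<Phi>. expectation (\<lambda>\<omega>. coefficient \<Phi> i \<omega> \<bullet> coefficient \<Phi> j \<omega>) *
        measure lborel ({left_end \<Phi> i<..right_end \<Phi> i} \<inter> {left_end \<Phi> j<..right_end \<Phi> j} \<inter> {0..t}))" .
qed

text \<open>The second claim cannot be read off the sum, whose terms may be negative: the sum is a
  time integral of squares. It allows \<open>ennreal\<close> to be exchanged with the expectation in
  the isometry.\<close>

lemma simple_value_time_integral:
  fixes t :: real
  shows "(\<integral>\<^sup>+\<tau>\<in>{0..t}. ennreal ((norm (simple_value \<Phi> \<tau> \<omega>))\<^sup>2) \<partial>lborel) =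
    ennreal (\<Sum>i<length \<Phi>. \<Sum>j<length \<Phi>. (coefficient \<Phi> i \<omega> \<bullet> coefficient \<Phi> j \<omega>) *
      measure lborel ({left_end \<Phi> i<..right_end \<Phi> i} \<inter> {left_end \<Phi> j<..right_end \<Phi> j} \<inter> {0..t}))" (is "_ = ennreal ?r")
    and "0 \<le> (\<Sum>i<length \<Phi>. \<Sum>j<length \<Phi>. (coefficient \<Phi> i \<omega> \<bullet> coefficient \<Phi> j \<omega>) *
      measure lborel ({left_end \<Phi> i<..right_end \<Phi> i} \<inter> {left_end \<Phi> j<..right_end \<Phi> j} \<inter> {0..t}))"
proof -
  let ?A = "\<lambda>i j. {left_end \<Phi> i<..right_end \<Phi> i} \<inter> {left_end \<Phi> j<..right_end \<Phi> j} \<inter> {0..t}"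
  have eq: "(norm (simple_value \<Phi> \<tau> \<omega>))\<^sup>2 * indicator {0..t} \<tau> =
      (\<Sum>i<length \<Phi>. \<Sum>j<length \<Phi>. (coefficient \<Phi> i \<omega> \<bullet> coefficient \<Phi> j \<omega>) * indicator (?A i j) \<tau>)" for \<tau>
    unfolding simple_value_sum inner_sum_sum sum_distrib_right
    by (intro sum.cong refl) (auto simp: indicator_def)
  have fin: "emeasure lborel (?A i j) < \<infinity>" for i j
    by (rule le_less_trans[OF emeasure_mono[of _ "{0..t}"]]) (auto simp: emeasure_lborel_Icc_eq)
  have int: "has_bochner_integral lborel (\<lambda>\<tau>. (norm (simple_value \<Phi> \<tau> \<omega>))\<^sup>2 * indicator {0..t} \<tau>) ?r"
    unfolding eq
    by (intro has_bochner_integral_sum has_bochner_integral_mult_right has_bochner_integral_real_indicator fin) auto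
  then have "?r = (LBINT \<tau>. (norm (simple_value \<Phi> \<tau> \<omega>))\<^sup>2 * indicator {0..t} \<tau>)"
    by (simp add: has_bochner_integral_integral_eq)
  also have "\<dots> \<ge> 0" by (intro Bochner_Integration.integral_nonneg) auto
  finally show nn: "0 \<le> ?r" .
  have "(\<integral>\<^sup>+\<tau>\<in>{0..t}. ennreal ((norm (simple_value \<Phi> \<tau> \<omega>))\<^sup>2) \<partial>lborel) =
      (\<integral>\<^sup>+\<tau>. ennreal ((norm (simple_value \<Phi> \<tau> \<omega>))\<^sup>2 * indicator {0..t} \<tau>) \<partial>lborel)"
    by (intro nn_integral_cong) (auto simp: indicator_def)
  also have "\<dots> = ennreal ?r"
    using nn_integral_eq_integral[OF integrable.intros[OF int]] has_bochner_integral_integral_eq[OF int] by simp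
  finally show "(\<integral>\<^sup>+\<tau>\<in>{0..t}. ennreal ((norm (simple_value \<Phi> \<tau> \<omega>))\<^sup>2) \<partial>lborel) = ennreal ?r" .
qed

text \<open>Both sides come down to the same double sum over pairs of terms, on the left by the
  covariance of increments, on the right by integrating products of indicators in time.\<close>

lemma simple_integral_isometry:
  assumes \<Phi>: "simple_process M F T \<Phi>" and t: "0 \<le> t"
  shows "(\<integral>\<^sup>+\<omega>. ennreal ((norm (simple_integral w \<Phi> t \<omega>))\<^sup>2) \<partial>M) =
    (\<integral>\<^sup>+\<omega>. (\<integral>\<^sup>+\<tau>\<in>{0..t}. ennreal ((norm (simple_value \<Phi> \<tau> \<omega>))\<^sup>2) \<partial>lborel) \<partial>M)"
proof -
  let ?A = "\<lambda>i j. {left_end \<Phi> i<..right_end \<Phi> i} \<inter> {left_end \<Phi> j<..right_end \<Phi> j} \<inter> {0..t}"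
  let ?r = "\<lambda>\<omega>. \<Sum>i<length \<Phi>. \<Sum>j<length \<Phi>. (coefficient \<Phi> i \<omega> \<bullet> coefficient \<Phi> j \<omega>) * measure lborel (?A i j)"
  have sq: "square_integrable M (coefficient \<Phi> i)" if i: "i < length \<Phi>" for i
    using simple_processD(4,5)[OF \<Phi> i] square_integrable_bounded[OF F_measurable_M] by blast
  have ii: "integrable M (\<lambda>\<omega>. coefficient \<Phi> i \<omega> \<bullet> coefficient \<Phi> j \<omega>)" if "i < length \<Phi>" "j < length \<Phi>" for i j
    by (intro square_integrable_inner sq that)
  have ir: "integrable M ?r"
    by (intro Bochner_Integration.integrable_sum integrable_mult_left ii) auto
  have "expectation ?r = (\<Sum>i<length \<Phi>. \<Sum>j<length \<Phi>. expectation (\<lambda>\<omega>. coefficient \<Phi> i \<omega> \<bullet> coefficient \<Phi> j \<omega>) * measure lborel (?A i j))"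
    by (subst Bochner_Integration.integral_sum, (intro Bochner_Integration.integrable_sum integrable_mult_left ii; simp))
      (intro sum.cong refl trans[OF Bochner_Integration.integral_sum] integrable_mult_left ii; simp)
  then have e: "expectation (\<lambda>\<omega>. (norm (simple_integral w \<Phi> t \<omega>))\<^sup>2) = expectation ?r"
    by (simp only: simple_integral_square(2)[OF \<Phi> t])
  have "(\<integral>\<^sup>+\<omega>. ennreal (?r \<omega>) \<partial>M) = ennreal (expectation ?r)"
    by (rule nn_integral_eq_integral[OF ir]) (rule AE_I2, rule simple_value_time_integral(2))
  then show ?thesis
    by (simp only: nn_integral_square_integrable[OF simple_integral_square(1)[OF \<Phi> t]] e
        simple_value_time_integral(1))
qed

text \<open>
  The part of the interval of the \<open>i\<close>-th term that lies in \<open>(s, t]\<close> runs from \<open>?c i\<close> to \<open>?e i\<close>, and is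
  empty when the two coincide.
\<close>

lemma simple_integral_martingale:
  assumes \<Phi>: "simple_process M F T \<Phi>" and st: "0 \<le> s" "s \<le> t"
    and Y: "Y \<in> borel_measurable (F s)" "square_integrable M Y"
  shows "expectation (\<lambda>\<omega>. (simple_integral w \<Phi> t \<omega> - simple_integral w \<Phi> s \<omega>) \<bullet> Y \<omega>) = 0"
proof -
  let ?c = "\<lambda>i. max (left_end \<Phi> i) s"
  let ?e = "\<lambda>i. max (?c i) (min t (right_end \<Phi> i))"
  let ?Z = "\<lambda>i \<omega>. coefficient \<Phi> i \<omega> \<bullet> Y \<omega>"
  have eq: "(simple_integral w \<Phi> t \<omega> - simple_integral w \<Phi> s \<omega>) \<bullet> Y \<omega> =
      (\<Sum>i<length \<Phi>. ?Z i \<omega> * (w (?e i) \<omega> - w (?c i) \<omega>))" for \<omega>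
    unfolding simple_integral_sum sum_subtractf[symmetric] inner_sum_left
  proof (intro sum.cong refl)
    fix i assume "i \<in> {..<length \<Phi>}"
    then have i: "i < length \<Phi>" by simp
    have "w (min t (right_end \<Phi> i)) \<omega> - w (min t (left_end \<Phi> i)) \<omega>
        - (w (min s (right_end \<Phi> i)) \<omega> - w (min s (left_end \<Phi> i)) \<omega>) = w (?e i) \<omega> - w (?c i) \<omega>"
      using simple_processD(2)[OF \<Phi> i] st
      by (auto simp: max_def min_def split: if_splits)
    then show "((w (min t (right_end \<Phi> i)) \<omega> - w (min t (left_end \<Phi> i)) \<omega>) *\<^sub>R coefficient \<Phi> i \<omega>
        - (w (min s (right_end \<Phi> i)) \<omega> - w (min s (left_end \<Phi> i)) \<omega>) *\<^sub>R coefficient \<Phi> i \<omega>) \<bullet> Y \<omega>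
        = ?Z i \<omega> * (w (?e i) \<omega> - w (?c i) \<omega>)"
      by (simp flip: scaleR_diff_left)
  qed
  have Z: "integrable M (\<lambda>\<omega>. ?Z i \<omega> * (w (?e i) \<omega> - w (?c i) \<omega>))"
    "expectation (\<lambda>\<omega>. ?Z i \<omega> * (w (?e i) \<omega> - w (?c i) \<omega>)) = 0" if i: "i < length \<Phi>" for i
  proof -
    note D = simple_processD[OF \<Phi> i]
    have m: "?Z i \<in> borel_measurable (F (?c i))"
      by (intro borel_measurable_inner F_measurable_mono[OF D(4)] F_measurable_mono[OF Y(1)]) auto
    obtain C where C: "\<And>\<omega>. \<omega> \<in> space M \<Longrightarrow> norm (coefficient \<Phi> i \<omega>) \<le> C" using D(5) by blast
    have "integrable M (?Z i)"
      by (intro square_integrable_inner Y(2) square_integrable_bounded[OF F_measurable_M[OF D(4)] C])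
    then show "integrable M (\<lambda>\<omega>. ?Z i \<omega> * (w (?e i) \<omega> - w (?c i) \<omega>))"
      "expectation (\<lambda>\<omega>. ?Z i \<omega> * (w (?e i) \<omega> - w (?c i) \<omega>)) = 0"
      using increment_mult(1,2)[OF _ _ m, of "?e i"] D(1) by (auto simp: le_max_iff_disj)
  qed
  show ?thesis
    unfolding eq by (subst Bochner_Integration.integral_sum) (auto simp: Z)
qed

end

section \<open>Time as a finite measure space, joint measurability, and a maximal inequality\<close>

abbreviation time_measure :: "real \<Rightarrow> real measure" where
  "time_measure T \<equiv> restrict_space lborel {0..T}"

lemma finite_measure_time: "finite_measure (time_measure T)"
  by (rule finite_measureI) (simp add: emeasure_restrict_space space_restrict_space emeasure_lborel_Icc_eq)

lemma sigma_finite_time: "sigma_finite_measure (time_measure T)"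
  using finite_measure_time by (rule finite_measure.sigma_finite_measure)

lemma measurable_time_pair:
  "borel_measurable (restrict_space borel {0..T} \<Otimes>\<^sub>M M) = borel_measurable (time_measure T \<Otimes>\<^sub>M M)"
  by (intro measurable_cong_sets sets_pair_measure_cong sets_restrict_space_cong) auto

lemma (in prob_space) pair_sigma_finite_time: "pair_sigma_finite (time_measure T) M"
  using sigma_finite_time sigma_finite_measure_axioms by (rule pair_sigma_finite.intro)

lemma (in prob_space) nn_integral_time_pair:
  assumes "(\<lambda>(t, \<omega>). g t \<omega>) \<in> borel_measurable (time_measure T \<Otimes>\<^sub>M M)"
  shows "(\<integral>\<^sup>+\<omega>. (\<integral>\<^sup>+t\<in>{0..T}. g t \<omega> \<partial>lborel) \<partial>M) = (\<integral>\<^sup>+(t, \<omega>). g t \<omega> \<partial>(time_measure T \<Otimes>\<^sub>M M))"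
proof -
  interpret pair_sigma_finite "time_measure T" M by (rule pair_sigma_finite_time)
  have "(\<integral>\<^sup>+\<omega>. (\<integral>\<^sup>+t\<in>{0..T}. g t \<omega> \<partial>lborel) \<partial>M) = (\<integral>\<^sup>+\<omega>. (\<integral>\<^sup>+t. g t \<omega> \<partial>time_measure T) \<partial>M)"
    by (simp add: nn_integral_restrict_space)
  also have "\<dots> = (\<integral>\<^sup>+(t, \<omega>). g t \<omega> \<partial>(time_measure T \<Otimes>\<^sub>M M))"
    using nn_integral_snd[OF assms] by simp
  finally show ?thesis .
qed

lemma (in prob_space) L2_adapted_iff:
  "X \<in> L2_adapted M F T \<longleftrightarrow> adapted_process M F T X \<and>
    square_integrable (time_measure T \<Otimes>\<^sub>M M) (\<lambda>(t, \<omega>). X t \<omega>)"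
proof (cases "adapted_process M F T X")
  case True
  then have m: "(\<lambda>(t, \<omega>). X t \<omega>) \<in> borel_measurable (time_measure T \<Otimes>\<^sub>M M)"
    unfolding adapted_process_def measurable_time_pair by blast
  then have m2: "(\<lambda>(t, \<omega>). ennreal ((norm (X t \<omega>))\<^sup>2)) \<in> borel_measurable (time_measure T \<Otimes>\<^sub>M M)"
    by (simp add: case_prod_beta)
  show ?thesis
    using True square_integrable_iff_nn_integral[OF m] nn_integral_time_pair[OF m2]
    by (simp add: L2_adapted_def case_prod_unfold)
qed (simp add: L2_adapted_def)

lemma nn_integral_norm_add_le:
  fixes X Y :: "'a \<Rightarrow> 'v::euclidean_space"
  assumes [measurable]: "X \<in> borel_measurable M" "Y \<in> borel_measurable M"
  shows "(\<integral>\<^sup>+\<omega>. ennreal ((norm (X \<omega> + Y \<omega>))\<^sup>2) \<partial>M) \<le>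
    2 * (\<integral>\<^sup>+\<omega>. ennreal ((norm (X \<omega>))\<^sup>2) \<partial>M) + 2 * (\<integral>\<^sup>+\<omega>. ennreal ((norm (Y \<omega>))\<^sup>2) \<partial>M)"
proof -
  have "(\<integral>\<^sup>+\<omega>. ennreal ((norm (X \<omega> + Y \<omega>))\<^sup>2) \<partial>M) \<le>
      (\<integral>\<^sup>+\<omega>. 2 * ennreal ((norm (X \<omega>))\<^sup>2) + 2 * ennreal ((norm (Y \<omega>))\<^sup>2) \<partial>M)"
  proof (rule nn_integral_mono)
    fix \<omega>
    have "ennreal ((norm (X \<omega> + Y \<omega>))\<^sup>2) \<le> ennreal (2 * (norm (X \<omega>))\<^sup>2 + 2 * (norm (Y \<omega>))\<^sup>2)"
      by (intro ennreal_leI norm_add_squared_le)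
    then show "ennreal ((norm (X \<omega> + Y \<omega>))\<^sup>2) \<le> 2 * ennreal ((norm (X \<omega>))\<^sup>2) + 2 * ennreal ((norm (Y \<omega>))\<^sup>2)"
      by (simp add: ennreal_plus ennreal_mult)
  qed
  also have "\<dots> = 2 * (\<integral>\<^sup>+\<omega>. ennreal ((norm (X \<omega>))\<^sup>2) \<partial>M) + 2 * (\<integral>\<^sup>+\<omega>. ennreal ((norm (Y \<omega>))\<^sup>2) \<partial>M)"
    by (subst nn_integral_add) (auto simp: nn_integral_cmult)
  finally show ?thesis .
qed

lemma nn_integral_norm_diff_le:
  fixes X Y :: "'a \<Rightarrow> 'v::euclidean_space"
  assumes [measurable]: "X \<in> borel_measurable M" "Y \<in> borel_measurable M" "Z \<in> borel_measurable M"
  shows "(\<integral>\<^sup>+\<omega>. ennreal ((norm (X \<omega> - Z \<omega>))\<^sup>2) \<partial>M) \<le>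
    2 * (\<integral>\<^sup>+\<omega>. ennreal ((norm (X \<omega> - Y \<omega>))\<^sup>2) \<partial>M) + 2 * (\<integral>\<^sup>+\<omega>. ennreal ((norm (Z \<omega> - Y \<omega>))\<^sup>2) \<partial>M)"
  using nn_integral_norm_add_le[of "\<lambda>\<omega>. X \<omega> - Y \<omega>" M "\<lambda>\<omega>. Y \<omega> - Z \<omega>"]
  by (simp add: norm_minus_commute)

lemma square_integral_inner_le:
  fixes X Y :: "'a \<Rightarrow> 'v::euclidean_space"
  assumes X: "square_integrable M X" and Y: "square_integrable M Y"
  shows "(LINT \<omega>|M. X \<omega> \<bullet> Y \<omega>)\<^sup>2 \<le> (LINT \<omega>|M. (norm (X \<omega>))\<^sup>2) * (LINT \<omega>|M. (norm (Y \<omega>))\<^sup>2)"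
proof -
  have [measurable]: "X \<in> borel_measurable M" "Y \<in> borel_measurable M"
    using X Y by (auto simp: square_integrable_def)
  have "ennreal \<bar>LINT \<omega>|M. X \<omega> \<bullet> Y \<omega>\<bar> \<le> (\<integral>\<^sup>+\<omega>. ennreal (norm (X \<omega> \<bullet> Y \<omega>)) \<partial>M)"
    using integral_norm_bound_ennreal[OF square_integrable_inner[OF X Y]] by simp
  also have "\<dots> \<le> (\<integral>\<^sup>+\<omega>. ennreal (norm (X \<omega>)) * ennreal (norm (Y \<omega>)) \<partial>M)"
    by (intro nn_integral_mono)
      (auto simp: ennreal_mult[symmetric] intro!: ennreal_leI Cauchy_Schwarz_ineq2)
  finally have "(ennreal \<bar>LINT \<omega>|M. X \<omega> \<bullet> Y \<omega>\<bar>)\<^sup>2 \<le>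
      (\<integral>\<^sup>+\<omega>. ennreal (norm (X \<omega>)) * ennreal (norm (Y \<omega>)) \<partial>M)\<^sup>2"
    by (intro power_mono) auto
  also have "\<dots> \<le> (\<integral>\<^sup>+\<omega>. (ennreal (norm (X \<omega>)))\<^sup>2 \<partial>M) * (\<integral>\<^sup>+\<omega>. (ennreal (norm (Y \<omega>)))\<^sup>2 \<partial>M)"
    by (rule Cauchy_Schwarz_nn_integral) measurable
  also have "\<dots> = ennreal ((LINT \<omega>|M. (norm (X \<omega>))\<^sup>2) * (LINT \<omega>|M. (norm (Y \<omega>))\<^sup>2))"
    by (simp add: ennreal_power nn_integral_square_integrable[OF X] nn_integral_square_integrable[OF Y]
        ennreal_mult)
  finally show ?thesis
    by (simp add: ennreal_power)
qed

text \<open>Almost sure statements about single times are collected over the countably many rational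
  times and then extended to all times by continuity. The open interval comes first because a dense
  set is dense in every open set, which may fail for a closed one.\<close>

lemma interval_rational_dense:
  fixes g :: "real \<Rightarrow> 'a::topological_space"
  assumes "0 < T" "continuous_on {0..T} g" "closed S" "\<And>q. q \<in> {0..T} \<inter> \<rat> \<Longrightarrow> g q \<in> S" "t \<in> {0..T}"
  shows "g t \<in> S"
proof -
  have "{0<..<T} \<subseteq> closure ({0<..<T} \<inter> \<rat>)"
    using open_Int_closure_subset[of "{0<..<T}" "\<rat>"] by (simp add: Rats_closure_real)
  then have "closure {0<..<T} \<subseteq> closure ({0<..<T} \<inter> \<rat>)"
    by (rule closure_minimal) auto
  moreover have "closure ({0<..<T} \<inter> \<rat>) \<subseteq> {0..T}"
    by (rule closure_minimal) auto
  ultimately have c: "closure ({0<..<T} \<inter> \<rat>) = {0..T}" using assms(1) by auto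
  have "g ` closure ({0<..<T} \<inter> \<rat>) \<subseteq> S"
    by (rule image_closure_subset) (use assms c in auto)
  then show ?thesis using c assms(5) by auto
qed

text \<open>Moving time down to a grid point leaves countably many random variables, hence joint
  measurability, and continuity of the paths lets the grid be refined. Rounding down keeps the time
  in the interval. \<open>N\<close> is arbitrary because the lemma is applied both to the whole
  space and to \<open>F t\<close>, where it yields progressive measurability.\<close>

lemma caratheodory_measurable:
  fixes X :: "real \<Rightarrow> 'w \<Rightarrow> 'v::euclidean_space"
  assumes X: "\<And>t. t \<in> {0..T} \<Longrightarrow> X t \<in> borel_measurable N"
    and cont: "\<And>\<omega>. \<omega> \<in> space N \<Longrightarrow> continuous_on {0..T} (\<lambda>t. X t \<omega>)"
  shows "(\<lambda>(t, \<omega>). X t \<omega>) \<in> borel_measurable (restrict_space borel {0..T} \<Otimes>\<^sub>M N)"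
proof (rule borel_measurable_LIMSEQ_metric)
  let ?P = "restrict_space borel {0..T} \<Otimes>\<^sub>M N"
  let ?r = "\<lambda>m t. real_of_int \<lfloor>t * real (Suc m)\<rfloor> / real (Suc m)"
  fix m
  show "(\<lambda>z. X (?r m (fst z)) (snd z)) \<in> borel_measurable ?P"
  proof -
    \<comment> \<open>The value 0 is a dummy: nothing is known about \<open>X\<close> at grid points
      outside \<open>{0..T}\<close>, and rounding down never reaches them.\<close>
    have "(\<lambda>z. (if real_of_int i / real (Suc m) \<in> {0..T} then X (real_of_int i / real (Suc m)) (snd z) else 0))
      \<in> borel_measurable ?P" for i
      using X[of "real_of_int i / real (Suc m)"] by (cases "real_of_int i / real (Suc m) \<in> {0..T}") auto
    moreover have "(\<lambda>z. \<lfloor>fst z * real (Suc m)\<rfloor>) \<in> measurable ?P (count_space UNIV)"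
    proof -
      have "fst \<in> borel_measurable ?P"
        using measurable_comp[OF measurable_fst, of "\<lambda>x. x" "restrict_space borel {0..T}" borel N]
        by (simp add: comp_def measurable_restrict_space1)
      then show ?thesis by measurable
    qed
    ultimately have "(\<lambda>z. (if ?r m (fst z) \<in> {0..T} then X (?r m (fst z)) (snd z) else 0)) \<in> borel_measurable ?P"
      by (rule measurable_compose_countable[where f="\<lambda>i z. if real_of_int i / real (Suc m) \<in> {0..T} then X (real_of_int i / real (Suc m)) (snd z) else 0"])
    then show ?thesis
    proof (subst measurable_cong)
      fix z assume "z \<in> space ?P"
      then have z: "fst z \<in> {0..T}" by (auto simp: space_pair_measure space_restrict_space)
      have "0 \<le> ?r m (fst z)" using z by simp
      moreover have "?r m (fst z) \<le> fst z"
        using of_int_floor_le[of "fst z * real (Suc m)"] by (simp add: field_simps del: of_nat_Suc)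
      ultimately have "?r m (fst z) \<in> {0..T}" using z by auto
      then show "X (?r m (fst z)) (snd z) = (if ?r m (fst z) \<in> {0..T} then X (?r m (fst z)) (snd z) else 0)"
        by simp
    qed
  qed
next
  let ?P = "restrict_space borel {0..T} \<Otimes>\<^sub>M N"
  let ?r = "\<lambda>m t. real_of_int \<lfloor>t * real (Suc m)\<rfloor> / real (Suc m)"
  fix z assume "z \<in> space ?P"
  then have z: "fst z \<in> {0..T}" "snd z \<in> space N" by (auto simp: space_pair_measure space_restrict_space)
  have r: "?r m (fst z) \<le> fst z" "fst z - 1 / real (Suc m) \<le> ?r m (fst z)" "0 \<le> ?r m (fst z)" for m
  proof -
    show "?r m (fst z) \<le> fst z"
      using of_int_floor_le[of "fst z * real (Suc m)"] by (simp add: field_simps del: of_nat_Suc)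
    have "fst z * real (Suc m) - 1 \<le> real_of_int \<lfloor>fst z * real (Suc m)\<rfloor>" by linarith
    then have "(fst z * real (Suc m) - 1) / real (Suc m) \<le> ?r m (fst z)"
      by (intro divide_right_mono) auto
    then show "fst z - 1 / real (Suc m) \<le> ?r m (fst z)"
      by (simp add: diff_divide_distrib del: of_nat_Suc)
    show "0 \<le> ?r m (fst z)" using z by simp
  qed
  have "(\<lambda>m. fst z - 1 / real (Suc m)) \<longlonglongrightarrow> fst z - 0"
    by (intro tendsto_intros LIMSEQ_Suc[OF lim_inverse_n'])
  then have l: "(\<lambda>m. fst z - 1 / real (Suc m)) \<longlonglongrightarrow> fst z" by (simp only: diff_zero)
  have "(\<lambda>m. ?r m (fst z)) \<longlonglongrightarrow> fst z"
    by (rule real_tendsto_sandwich[OF always_eventually[OF allI[OF r(2)]] always_eventually[OF allI[OF r(1)]]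
          l tendsto_const])
  moreover have "?r m (fst z) \<in> {0..T}" for m
    using r(1,3)[of m] z(1) unfolding atLeastAtMost_iff by linarith
  ultimately have "(\<lambda>m. X (?r m (fst z)) (snd z)) \<longlonglongrightarrow> X (fst z) (snd z)"
    using continuous_on_tendsto_compose[OF cont[OF z(2)], of "\<lambda>m. ?r m (fst z)" "fst z" sequentially] z(1)
    by simp
  then show "(\<lambda>m. X (?r m (fst z)) (snd z)) \<longlonglongrightarrow> (case z of (t, \<omega>) \<Rightarrow> X t \<omega>)"
    by (simp add: case_prod_beta)
qed

context brownian_space
begin

lemma simple_value_measurable:
  assumes "simple_process M F T \<Phi>"
  shows "(\<lambda>(t, \<omega>). simple_value \<Phi> t \<omega>) \<in> borel_measurable (time_measure T \<Otimes>\<^sub>M M)"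
proof -
  have "(\<lambda>z. indicator {left_end \<Phi> i<..right_end \<Phi> i} (fst z) *\<^sub>R coefficient \<Phi> i (snd z))
      \<in> borel_measurable (time_measure T \<Otimes>\<^sub>M M)" if i: "i < length \<Phi>" for i
  proof (rule borel_measurable_scaleR)
    have "fst \<in> borel_measurable (time_measure T \<Otimes>\<^sub>M M)"
      using measurable_comp[OF measurable_fst, of "\<lambda>x. x" "time_measure T" borel M]
      by (simp add: comp_def measurable_restrict_space1)
    then show "(\<lambda>z. indicator {left_end \<Phi> i<..right_end \<Phi> i} (fst z) :: real) \<in> borel_measurable (time_measure T \<Otimes>\<^sub>M M)"
      by (rule measurable_compose) simp
    show "(\<lambda>z. coefficient \<Phi> i (snd z)) \<in> borel_measurable (time_measure T \<Otimes>\<^sub>M M)"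
      using F_measurable_M[OF simple_processD(4)[OF assms i]] by (rule measurable_compose[OF measurable_snd])
  qed
  then show ?thesis
    unfolding simple_value_sum case_prod_beta by (intro borel_measurable_sum) auto
qed

text \<open>Kolmogorov's inequality. The event is split by the first time \<open>t\<close> in
  \<open>J\<close> at which the level is exceeded. That part, \<open>A t\<close>, is known at time
  \<open>t\<close>, so the later increment of the integral is orthogonal to the integral at
  \<open>t\<close> restricted to \<open>A t\<close>.\<close>

lemma simple_integral_maximal_finite:
  assumes \<Phi>: "simple_process M F T \<Phi>" and J: "finite J" "J \<subseteq> {0..T}" and l: "0 < l"
  shows "l\<^sup>2 * prob {\<omega>\<in>space M. \<exists>t\<in>J. l < norm (simple_integral w \<Phi> t \<omega>)}
    \<le> expectation (\<lambda>\<omega>. (norm (simple_integral w \<Phi> T \<omega>))\<^sup>2)"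
proof -
  let ?S = "simple_integral w \<Phi>"
  define A where "A = (\<lambda>t. {\<omega>\<in>space M. l < norm (?S t \<omega>) \<and> (\<forall>s\<in>J. s < t \<longrightarrow> norm (?S s \<omega>) \<le> l)})"
  have AF: "A t \<in> sets (F t)" if t: "t \<in> J" for t
  proof -
    have S: "?S s \<in> borel_measurable (F t)" if "s \<in> J" "s \<le> t" for s
      using J that by (intro F_measurable_mono[OF simple_integral_measurable[OF \<Phi>]]) auto
    \<comment> \<open>For the earliest time of \<open>J\<close> the intersection runs over an empty
      index set and is the whole type; the last factor brings it back to the space.\<close>
    have "A t = {\<omega>\<in>space (F t). l < norm (?S t \<omega>)} \<inter> (\<Inter>s\<in>{s\<in>J. s < t}. {\<omega>\<in>space (F t). norm (?S s \<omega>) \<le> l}) \<inter> space (F t)"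
      by (auto simp: A_def space_F)
    moreover have "{\<omega>\<in>space (F t). l < norm (?S t \<omega>)} \<in> sets (F t)"
      using S[OF t] by measurable
    moreover have "(\<Inter>s\<in>{s\<in>J. s < t}. {\<omega>\<in>space (F t). norm (?S s \<omega>) \<le> l}) \<inter> space (F t) \<in> sets (F t)"
    proof (cases "{s\<in>J. s < t} = {}")
      case False
      have "(\<Inter>s\<in>{s\<in>J. s < t}. {\<omega>\<in>space (F t). norm (?S s \<omega>) \<le> l}) \<in> sets (F t)"
      proof (rule sets.finite_INT)
        fix s assume "s \<in> {s\<in>J. s < t}"
        then have "?S s \<in> borel_measurable (F t)" by (intro S) auto
        then show "{\<omega>\<in>space (F t). norm (?S s \<omega>) \<le> l} \<in> sets (F t)" by measurable
      qed (use J False in auto)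
      then show ?thesis by blast
    next
      case True
      then show ?thesis by (simp only: INT_empty image_empty Inter_empty) simp
    qed
    ultimately show ?thesis by (simp add: Int_assoc sets.Int)
  qed
  have AM: "A t \<in> sets M" if "t \<in> J" for t using AF[OF that] sets_F by blast
  have disj: "disjoint_family_on A J"
    unfolding disjoint_family_on_def A_def by (auto simp: not_less neq_iff)
  have cover: "{\<omega>\<in>space M. \<exists>t\<in>J. l < norm (?S t \<omega>)} \<subseteq> (\<Union>t\<in>J. A t)"
  proof
    fix \<omega> assume \<omega>: "\<omega> \<in> {\<omega>\<in>space M. \<exists>t\<in>J. l < norm (?S t \<omega>)}"
    define H where "H = {t\<in>J. l < norm (?S t \<omega>)}"
    have H: "finite H" "H \<noteq> {}" using J \<omega> by (auto simp: H_def)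
    from Min_in[OF H] have "Min H \<in> J" "l < norm (?S (Min H) \<omega>)" by (auto simp: H_def)
    moreover have "norm (?S s \<omega>) \<le> l" if "s \<in> J" "s < Min H" for s
      using Min_le[OF H(1), of s] that by (force simp: H_def)
    ultimately have "\<omega> \<in> A (Min H)" using \<omega> by (auto simp: A_def)
    then show "\<omega> \<in> (\<Union>t\<in>J. A t)" using \<open>Min H \<in> J\<close> by blast
  qed
  have Ssq: "square_integrable M (?S t)" if "0 \<le> t" for t
    by (rule simple_integral_square(1)[OF \<Phi> that])
  have T: "0 \<le> T" if "t \<in> J" for t using J that by auto
  have iA: "integrable M (\<lambda>\<omega>. indicator (A t) \<omega> * (norm (?S T \<omega>))\<^sup>2)" if t: "t \<in> J" for t
    using integrable_mult_indicator[OF AM[OF t] square_integrable_norm2[OF Ssq[OF T[OF t]]]] by simp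
  have each: "l\<^sup>2 * prob (A t) \<le> expectation (\<lambda>\<omega>. indicator (A t) \<omega> * (norm (?S T \<omega>))\<^sup>2)" if t: "t \<in> J" for t
  proof -
    have t0: "0 \<le> t" "t \<le> T" using J t by auto
    let ?Y = "\<lambda>\<omega>. indicator (A t) \<omega> *\<^sub>R ?S t \<omega>"
    have Y: "?Y \<in> borel_measurable (F t)"
      using AF[OF t] simple_integral_measurable[OF \<Phi> t0(1)] by (intro borel_measurable_scaleR) auto
    have Ysq: "square_integrable M ?Y"
      by (rule square_integrable_bound[OF Ssq[OF t0(1)] F_measurable_M[OF Y], of 1])
        (auto simp: indicator_def)
    have zero: "expectation (\<lambda>\<omega>. (?S T \<omega> - ?S t \<omega>) \<bullet> ?Y \<omega>) = 0"
      by (rule simple_integral_martingale[OF \<Phi> t0 Y Ysq])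
    have i1: "integrable M (\<lambda>\<omega>. (?S T \<omega> - ?S t \<omega>) \<bullet> ?Y \<omega>)"
      by (intro square_integrable_inner square_integrable_diff Ssq Ysq T[OF t] t0)
    \<comment> \<open>The added term has mean zero and completes a square: on \<open>A t\<close>,
      the squared norm at \<open>T\<close> minus the squared norm at \<open>t\<close> minus this
      term is the squared norm of the increment.\<close>
    have "l\<^sup>2 * prob (A t) = expectation (\<lambda>\<omega>. l\<^sup>2 * indicator (A t) \<omega> + 2 * ((?S T \<omega> - ?S t \<omega>) \<bullet> ?Y \<omega>))"
    proof -
      have "integrable M (\<lambda>\<omega>. l\<^sup>2 * indicator (A t) \<omega>)"
        using AM[OF t] by (intro integrable_mult_right integrable_real_indicator) (auto simp: less_top[symmetric])
      moreover have "expectation (\<lambda>\<omega>. l\<^sup>2 * indicator (A t) \<omega>) = l\<^sup>2 * prob (A t)"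
        using AM[OF t] sets.sets_into_space[OF AM[OF t]] by (simp add: Int_absorb2)
      ultimately show ?thesis
        by (subst Bochner_Integration.integral_add[OF _ integrable_mult_right[OF i1]])
          (simp_all only: integral_mult_right_zero zero mult_zero_right add_0_right)
    qed
    also have "\<dots> \<le> expectation (\<lambda>\<omega>. indicator (A t) \<omega> * (norm (?S T \<omega>))\<^sup>2)"
    proof (rule integral_mono[OF _ iA[OF t]])
      show "integrable M (\<lambda>\<omega>. l\<^sup>2 * indicator (A t) \<omega> + 2 * ((?S T \<omega> - ?S t \<omega>) \<bullet> ?Y \<omega>))"
        using AM[OF t]
        by (intro Bochner_Integration.integrable_add integrable_mult_right i1 integrable_real_indicator)
          (auto simp: less_top[symmetric])
      fix \<omega>
      show "l\<^sup>2 * indicator (A t) \<omega> + 2 * ((?S T \<omega> - ?S t \<omega>) \<bullet> ?Y \<omega>) \<le> indicator (A t) \<omega> * (norm (?S T \<omega>))\<^sup>2"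
      proof (cases "\<omega> \<in> A t")
        case True
        then have "l < norm (?S t \<omega>)" by (simp add: A_def)
        then have "l\<^sup>2 \<le> (norm (?S t \<omega>))\<^sup>2" using l by (intro power_mono) auto
        moreover have "0 \<le> (norm (?S T \<omega> - ?S t \<omega>))\<^sup>2" by simp
        ultimately show ?thesis using True
          by (simp add: power2_norm_eq_inner inner_diff_left inner_diff_right inner_commute)
      qed simp
    qed
    finally show ?thesis .
  qed
  have "l\<^sup>2 * prob {\<omega>\<in>space M. \<exists>t\<in>J. l < norm (?S t \<omega>)} \<le> l\<^sup>2 * (\<Sum>t\<in>J. prob (A t))"
  proof (intro mult_left_mono)
    have "prob {\<omega>\<in>space M. \<exists>t\<in>J. l < norm (?S t \<omega>)} \<le> prob (\<Union>t\<in>J. A t)"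
      by (rule finite_measure_mono[OF cover]) (use J AM in auto)
    also have "\<dots> \<le> (\<Sum>t\<in>J. prob (A t))"
      by (rule finite_measure_subadditive_finite) (use J AM in auto)
    finally show "prob {\<omega>\<in>space M. \<exists>t\<in>J. l < norm (?S t \<omega>)} \<le> (\<Sum>t\<in>J. prob (A t))" .
  qed simp
  also have "\<dots> \<le> (\<Sum>t\<in>J. expectation (\<lambda>\<omega>. indicator (A t) \<omega> * (norm (?S T \<omega>))\<^sup>2))"
    unfolding sum_distrib_left by (intro sum_mono each)
  also have "\<dots> = expectation (\<lambda>\<omega>. \<Sum>t\<in>J. indicator (A t) \<omega> * (norm (?S T \<omega>))\<^sup>2)"
    by (rule Bochner_Integration.integral_sum[symmetric]) (rule iA)
  also have "\<dots> \<le> expectation (\<lambda>\<omega>. (norm (?S T \<omega>))\<^sup>2)"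
  proof (cases "J = {}")
    case False
    then obtain t where "t \<in> J" by auto
    show ?thesis
    proof (rule integral_mono)
      show "integrable M (\<lambda>\<omega>. \<Sum>t\<in>J. indicator (A t) \<omega> * (norm (?S T \<omega>))\<^sup>2)"
        by (intro Bochner_Integration.integrable_sum iA)
      show "integrable M (\<lambda>\<omega>. (norm (?S T \<omega>))\<^sup>2)"
        by (rule square_integrable_norm2[OF Ssq[OF T[OF \<open>t \<in> J\<close>]]])
      fix \<omega>
      have "(\<Sum>t\<in>J. indicator (A t) \<omega> * (norm (?S T \<omega>))\<^sup>2) = indicator (\<Union>t\<in>J. A t) \<omega> * (norm (?S T \<omega>))\<^sup>2"
        by (simp add: indicator_UN_disjoint[OF J(1) disj] sum_distrib_right)
      also have "\<dots> \<le> 1 * (norm (?S T \<omega>))\<^sup>2" by (intro mult_right_mono) (auto simp: indicator_def)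
      finally show "(\<Sum>t\<in>J. indicator (A t) \<omega> * (norm (?S T \<omega>))\<^sup>2) \<le> (norm (?S T \<omega>))\<^sup>2" by simp
    qed
  qed simp
  finally show ?thesis .
qed

text \<open>The finite case exhausts a countable set of times. For continuous paths the rational
  times then control the supremum over the whole interval.\<close>

lemma simple_integral_maximal:
  assumes \<Phi>: "simple_process M F T \<Phi>" and C: "countable C" "C \<subseteq> {0..T}" and l: "0 < l"
  shows "{\<omega>\<in>space M. \<exists>t\<in>C. l < norm (simple_integral w \<Phi> t \<omega>)} \<in> sets M"
    and "l\<^sup>2 * prob {\<omega>\<in>space M. \<exists>t\<in>C. l < norm (simple_integral w \<Phi> t \<omega>)}
    \<le> expectation (\<lambda>\<omega>. (norm (simple_integral w \<Phi> T \<omega>))\<^sup>2)"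
proof -
  let ?S = "simple_integral w \<Phi>"
  let ?E = "\<lambda>J. {\<omega>\<in>space M. \<exists>t\<in>J. l < norm (?S t \<omega>)}"
  have E: "?E J \<in> sets M" if "countable J" "J \<subseteq> C" for J
  proof -
    have "{\<omega>\<in>space M. l < norm (?S t \<omega>)} \<in> sets M" if "t \<in> J" for t
    proof -
      have "0 \<le> t" using that \<open>J \<subseteq> C\<close> C by auto
      from F_measurable_M[OF simple_integral_measurable[OF \<Phi> this]] show ?thesis by measurable
    qed
    then have "(\<Union>t\<in>J. {\<omega>\<in>space M. l < norm (?S t \<omega>)}) \<in> sets M"
      using that(1) by (intro sets.countable_UN'') auto
    also have "(\<Union>t\<in>J. {\<omega>\<in>space M. l < norm (?S t \<omega>)}) = ?E J" by auto
    finally show ?thesis .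
  qed
  show "?E C \<in> sets M" by (rule E[OF C(1)]) simp
  show "l\<^sup>2 * prob (?E C) \<le> expectation (\<lambda>\<omega>. (norm (?S T \<omega>))\<^sup>2)"
  proof (cases "C = {}")
    case True
    then show ?thesis by simp
  next
    case False
    define J where "J = (\<lambda>n::nat. from_nat_into C ` {..n})"
    have J: "finite (J n)" "J n \<subseteq> C" for n
      using from_nat_into[OF False] by (auto simp: J_def)
    have un: "C = (\<Union>n. J n)"
      using range_from_nat_into[OF False C(1)] unfolding J_def by blast
    have "incseq (\<lambda>n. ?E (J n))"
      by (rule incseq_SucI) (auto simp: J_def)
    then have "(\<lambda>n. prob (?E (J n))) \<longlonglongrightarrow> prob (\<Union>n. ?E (J n))"
      using J E[OF countable_finite[OF J(1)]] by (intro finite_Lim_measure_incseq) auto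
    also have "(\<Union>n. ?E (J n)) = ?E C"
      unfolding un by auto
    finally have "(\<lambda>n. l\<^sup>2 * prob (?E (J n))) \<longlonglongrightarrow> l\<^sup>2 * prob (?E C)"
      by (intro tendsto_intros)
    then show ?thesis
      by (rule LIMSEQ_le_const2) (use simple_integral_maximal_finite[OF \<Phi> J(1) _ l] J(2) C(2) in blast)
  qed
qed

end

section \<open>The Ito integral\<close>

lemma square_integral_tendsto_zero_inner:
  fixes X :: "nat \<Rightarrow> 'a \<Rightarrow> 'v::euclidean_space"
  assumes X: "\<And>m. square_integrable M (X m)" and Y: "square_integrable M Y"
    and lim: "(\<lambda>m. LINT \<omega>|M. (norm (X m \<omega>))\<^sup>2) \<longlonglongrightarrow> 0"
  shows "(\<lambda>m. LINT \<omega>|M. X m \<omega> \<bullet> Y \<omega>) \<longlonglongrightarrow> 0"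
proof (rule tendsto_rabs_zero_cancel, rule tendsto_sandwich[of "\<lambda>_. 0"])
  have "(\<lambda>m. sqrt ((LINT \<omega>|M. (norm (X m \<omega>))\<^sup>2) * (LINT \<omega>|M. (norm (Y \<omega>))\<^sup>2)))
      \<longlonglongrightarrow> sqrt (0 * (LINT \<omega>|M. (norm (Y \<omega>))\<^sup>2))"
    by (intro tendsto_intros lim)
  then show "(\<lambda>m. sqrt ((LINT \<omega>|M. (norm (X m \<omega>))\<^sup>2) * (LINT \<omega>|M. (norm (Y \<omega>))\<^sup>2))) \<longlonglongrightarrow> 0"
    by simp
  show "\<forall>\<^sub>F m in sequentially. \<bar>LINT \<omega>|M. X m \<omega> \<bullet> Y \<omega>\<bar>
      \<le> sqrt ((LINT \<omega>|M. (norm (X m \<omega>))\<^sup>2) * (LINT \<omega>|M. (norm (Y \<omega>))\<^sup>2))"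
    using square_integral_inner_le[OF X Y] by (intro always_eventually allI real_le_rsqrt) simp
qed auto

context brownian_space
begin

lemma simple_integral_le_value:
  assumes \<Phi>: "simple_process M F T \<Phi>" and t: "t \<in> {0..T}"
  shows "(\<integral>\<^sup>+\<omega>. ennreal ((norm (simple_integral w \<Phi> t \<omega>))\<^sup>2) \<partial>M) \<le>
    (\<integral>\<^sup>+z. ennreal ((norm (simple_value \<Phi> (fst z) (snd z)))\<^sup>2) \<partial>(time_measure T \<Otimes>\<^sub>M M))"
proof -
  have m: "(\<lambda>(t, \<omega>). ennreal ((norm (simple_value \<Phi> t \<omega>))\<^sup>2)) \<in> borel_measurable (time_measure T \<Otimes>\<^sub>M M)"
    using simple_value_measurable[OF \<Phi>] by (simp add: case_prod_beta)
  have "(\<integral>\<^sup>+\<omega>. ennreal ((norm (simple_integral w \<Phi> t \<omega>))\<^sup>2) \<partial>M) =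
      (\<integral>\<^sup>+\<omega>. (\<integral>\<^sup>+\<tau>\<in>{0..t}. ennreal ((norm (simple_value \<Phi> \<tau> \<omega>))\<^sup>2) \<partial>lborel) \<partial>M)"
    using t by (intro simple_integral_isometry[OF \<Phi>]) auto
  also have "\<dots> \<le> (\<integral>\<^sup>+\<omega>. (\<integral>\<^sup>+\<tau>\<in>{0..T}. ennreal ((norm (simple_value \<Phi> \<tau> \<omega>))\<^sup>2) \<partial>lborel) \<partial>M)"
    using t by (intro nn_integral_mono) (auto simp: indicator_def)
  also have "\<dots> = (\<integral>\<^sup>+z. ennreal ((norm (simple_value \<Phi> (fst z) (snd z)))\<^sup>2) \<partial>(time_measure T \<Otimes>\<^sub>M M))"
    using nn_integral_time_pair[OF m] by (simp add: case_prod_unfold)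
  finally show ?thesis .
qed

definition value_dist :: "real \<Rightarrow> (real \<times> real \<times> ('w \<Rightarrow> 'v::euclidean_space)) list \<Rightarrow> (real \<Rightarrow> 'w \<Rightarrow> 'v) \<Rightarrow> ennreal" where
  "value_dist T \<Phi> \<phi> = (\<integral>\<^sup>+\<omega>. (\<integral>\<^sup>+t\<in>{0..T}. ennreal ((norm (simple_value \<Phi> t \<omega> - \<phi> t \<omega>))\<^sup>2) \<partial>lborel) \<partial>M)"

lemma value_dist_pair:
  assumes \<Phi>: "simple_process M F T \<Phi>" and \<phi>: "\<phi> \<in> L2_adapted M F T"
  shows "value_dist T \<Phi> \<phi> =
    (\<integral>\<^sup>+z. ennreal ((norm (simple_value \<Phi> (fst z) (snd z) - \<phi> (fst z) (snd z)))\<^sup>2) \<partial>(time_measure T \<Otimes>\<^sub>M M))"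
proof -
  have "(\<lambda>(t, \<omega>). \<phi> t \<omega>) \<in> borel_measurable (time_measure T \<Otimes>\<^sub>M M)"
    using \<phi> by (simp add: L2_adapted_iff square_integrable_def)
  then have "(\<lambda>(t, \<omega>). ennreal ((norm (simple_value \<Phi> t \<omega> - \<phi> t \<omega>))\<^sup>2)) \<in> borel_measurable (time_measure T \<Otimes>\<^sub>M M)"
    using simple_value_measurable[OF \<Phi>] by (simp add: case_prod_beta)
  from nn_integral_time_pair[OF this] show ?thesis by (simp add: value_dist_def case_prod_unfold)
qed

lemma simple_integral_diff_le:
  assumes \<Phi>: "simple_process M F T \<Phi>" and \<Psi>: "simple_process M F T \<Psi>" and \<phi>: "\<phi> \<in> L2_adapted M F T"
    and t: "t \<in> {0..T}"
  shows "(\<integral>\<^sup>+\<omega>. ennreal ((norm (simple_integral w \<Phi> t \<omega> - simple_integral w \<Psi> t \<omega>))\<^sup>2) \<partial>M) \<le>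
    2 * value_dist T \<Phi> \<phi> + 2 * value_dist T \<Psi> \<phi>"
proof -
  have [measurable]: "(\<lambda>z. \<phi> (fst z) (snd z)) \<in> borel_measurable (time_measure T \<Otimes>\<^sub>M M)"
    using \<phi> by (simp add: L2_adapted_iff square_integrable_def case_prod_unfold)
  have "(\<integral>\<^sup>+\<omega>. ennreal ((norm (simple_integral w (simple_minus \<Phi> \<Psi>) t \<omega>))\<^sup>2) \<partial>M) \<le>
    (\<integral>\<^sup>+z. ennreal ((norm (simple_value (simple_minus \<Phi> \<Psi>) (fst z) (snd z)))\<^sup>2) \<partial>(time_measure T \<Otimes>\<^sub>M M))"
    by (rule simple_integral_le_value[OF simple_process_minus[OF \<Phi> \<Psi>] t])
  also have "\<dots> \<le> 2 * value_dist T \<Phi> \<phi> + 2 * value_dist T \<Psi> \<phi>"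
    unfolding value_dist_pair[OF \<Phi> \<phi>] value_dist_pair[OF \<Psi> \<phi>] simple_value_minus
    using simple_value_measurable[OF \<Phi>] simple_value_measurable[OF \<Psi>]
    by (intro nn_integral_norm_diff_le) (auto simp: case_prod_beta)
  finally show ?thesis by (simp add: simple_integral_minus)
qed

text \<open>\<open>approx\<close> is a hypothesis because approximability is wanted for
  deterministic integrands, where it follows from uniform continuity. Continuity is claimed at every
  sample point, which is more than \<open>ito_integral\<close> asks: the closed loop is later solved
  path by path, and joint measurability is deduced from continuity.\<close>

lemma ito_integral_exists:
  fixes \<phi> :: "real \<Rightarrow> 'w \<Rightarrow> 'v::euclidean_space"
  assumes T: "0 < T" and \<phi>: "\<phi> \<in> L2_adapted M F T"
    and approx: "\<And>e. 0 < e \<Longrightarrow> \<exists>\<Phi>. simple_process M F T \<Phi> \<and> value_dist T \<Phi> \<phi> \<le> ennreal e"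
  shows "\<exists>I. ito_integral M F T w \<phi> I \<and> (\<forall>\<omega>\<in>space M. continuous_on {0..T} (\<lambda>t. I t \<omega>))"
proof -
  \<comment> \<open>At this rate the maximal inequality for consecutive differences is summable at the level \<open>2\<^sup>-\<^sup>k\<close>.\<close>
  have "\<exists>\<Phi>. \<forall>k::nat. simple_process M F T (\<Phi> k) \<and> value_dist T (\<Phi> k) \<phi> \<le> ennreal ((1/16)^k)"
    by (intro choice allI approx) simp
  then obtain \<Phi> where \<Phi>: "\<And>k. simple_process M F T (\<Phi> k)"
    and dist: "\<And>k. value_dist T (\<Phi> k) \<phi> \<le> ennreal ((1/16)^k)" by blast
  define S where "S = (\<lambda>k. simple_integral w (\<Phi> k))"
  have SF: "S k t \<in> borel_measurable (F t)" if "0 \<le> t" for k t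
    unfolding S_def by (rule simple_integral_measurable[OF \<Phi> that])
  have SM: "S k t \<in> borel_measurable M" if "0 \<le> t" for k t
    by (rule F_measurable_M[OF SF[OF that]])
  have close: "(\<integral>\<^sup>+\<omega>. ennreal ((norm (S k t \<omega> - S j t \<omega>))\<^sup>2) \<partial>M) \<le> ennreal (4 * (1/16)^k)"
    if "t \<in> {0..T}" "k \<le> j" for k j t
  proof -
    have "(\<integral>\<^sup>+\<omega>. ennreal ((norm (S k t \<omega> - S j t \<omega>))\<^sup>2) \<partial>M) \<le> 2 * value_dist T (\<Phi> k) \<phi> + 2 * value_dist T (\<Phi> j) \<phi>"
      unfolding S_def by (rule simple_integral_diff_le[OF \<Phi> \<Phi> \<phi> that(1)])
    also have "\<dots> \<le> 2 * ennreal ((1/16)^k) + 2 * ennreal ((1/16)^k)"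
    proof (intro add_mono mult_left_mono dist)
      have "ennreal ((1/16)^j) \<le> ennreal ((1/16)^k)"
        using that(2) by (intro ennreal_leI power_decreasing) auto
      with dist[of j] show "value_dist T (\<Phi> j) \<phi> \<le> ennreal ((1/16)^k)" by (rule order_trans)
    qed auto
    also have "\<dots> = ennreal (4 * (1/16)^k)"
      by (simp add: ennreal_mult flip: distrib_right)
    finally show ?thesis .
  qed
  define C where "C = {0..T} \<inter> \<rat>"
  have C: "countable C" "C \<subseteq> {0..T}" by (auto simp: C_def countable_rat)
  define E where "E = (\<lambda>k. {\<omega>\<in>space M. \<exists>t\<in>C. (1/2)^k < norm (simple_integral w (simple_minus (\<Phi> k) (\<Phi> (Suc k))) t \<omega>)})"
  have E: "E k \<in> sets M" for k
    unfolding E_def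
    by (rule simple_integral_maximal(1)[OF simple_process_minus[OF \<Phi> \<Phi>] C]) simp
  have PE: "prob (E k) \<le> 4 * (1/4)^k" for k
  proof -
    let ?D = "simple_minus (\<Phi> k) (\<Phi> (Suc k))"
    have D: "simple_process M F T ?D" by (rule simple_process_minus[OF \<Phi> \<Phi>])
    have "((1/2)^k)\<^sup>2 * prob (E k) \<le> expectation (\<lambda>\<omega>. (norm (simple_integral w ?D T \<omega>))\<^sup>2)"
      unfolding E_def by (rule simple_integral_maximal(2)[OF D C]) simp
    also have "\<dots> \<le> 4 * (1/16)^k"
    proof -
      have "square_integrable M (simple_integral w ?D T)"
        using T by (intro simple_integral_square(1)[OF D]) simp
      from nn_integral_square_integrable[OF this]
      have "ennreal (expectation (\<lambda>\<omega>. (norm (simple_integral w ?D T \<omega>))\<^sup>2)) \<le> ennreal (4 * (1/16)^k)"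
        using close[of T k "Suc k"] T by (simp add: S_def simple_integral_minus)
      then show ?thesis by (simp add: ennreal_le_iff)
    qed
    also have "((1/2::real)^k)\<^sup>2 = (1/4)^k"
      by (simp add: power2_eq_square flip: power_mult_distrib)
    finally have "(1/4)^k * prob (E k) \<le> 4 * (1/16)^k" .
    moreover have "(1/16::real)^k = (1/4)^k * (1/4)^k"
      by (simp flip: power_mult_distrib)
    ultimately show ?thesis by (simp add: mult.left_commute)
  qed
  have "summable (\<lambda>k. measure M (E k))"
    by (rule summable_comparison_test'[of "\<lambda>k. 4 * (1/4)^k" 0])
      (use PE in \<open>auto intro!: summable_mult summable_geometric\<close>)
  then have "AE \<omega> in M. eventually (\<lambda>k. \<omega> \<in> space M - E k) sequentially"
    using E by (intro borel_cantelli_AE1) (auto simp: less_top[symmetric])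
  moreover have "AE \<omega> in M. continuous_on {0..} (\<lambda>t. w t \<omega>)"
    using bm unfolding brownian_motion_def by blast
  ultimately have "AE \<omega> in M. eventually (\<lambda>k. \<omega> \<in> space M - E k) sequentially \<and> continuous_on {0..} (\<lambda>t. w t \<omega>)"
    by eventually_elim simp
  then obtain N where N: "N \<in> null_sets M"
    and sub: "{\<omega>\<in>space M. \<not> (eventually (\<lambda>k. \<omega> \<in> space M - E k) sequentially \<and> continuous_on {0..} (\<lambda>t. w t \<omega>))} \<subseteq> N"
    unfolding eventually_ae_filter by blast
  \<comment> \<open>The limit is written as a telescoping series because \<open>suminf\<close> of
    measurable functions is measurable whether or not it converges. The value 0 on the null set
    \<open>N\<close> makes every path continuous and keeps \<open>I\<close> adapted.\<close>
  define I where "I = (\<lambda>t \<omega>. if \<omega> \<in> N then 0 else S 0 t \<omega> + (\<Sum>k. S (Suc k) t \<omega> - S k t \<omega>))"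
  have unif: "uniform_limit {0..T} (\<lambda>k t. S k t \<omega>) (\<lambda>t. I t \<omega>) sequentially"
    and contS: "\<And>k. continuous_on {0..T} (\<lambda>t. S k t \<omega>)" if \<omega>: "\<omega> \<in> space M" "\<omega> \<notin> N" for \<omega>
  proof -
    have ev: "eventually (\<lambda>k. \<omega> \<in> space M - E k) sequentially" and cw: "continuous_on {0..} (\<lambda>t. w t \<omega>)"
      using sub \<omega> by auto
    show cS: "continuous_on {0..T} (\<lambda>t. S k t \<omega>)" for k
      unfolding S_def
      by (rule continuous_on_subset[OF simple_integral_continuous[where w=w and \<omega>=\<omega>, OF \<Phi> cw]]) auto
    have "eventually (\<lambda>k. \<forall>t\<in>{0..T}. norm (S (Suc k) t \<omega> - S k t \<omega>) \<le> (1/2)^k) sequentially"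
      using ev
    proof eventually_elim
      case (elim k)
      show ?case
      proof
        fix t assume t: "t \<in> {0..T}"
        have "S (Suc k) t \<omega> - S k t \<omega> \<in> cball 0 ((1/2)^k)"
        proof (rule interval_rational_dense[OF T _ closed_cball _ t])
          show "continuous_on {0..T} (\<lambda>t. S (Suc k) t \<omega> - S k t \<omega>)"
            by (intro continuous_intros cS)
          fix q assume "q \<in> {0..T} \<inter> \<rat>"
          then have "q \<in> C" by (simp add: C_def)
          with elim \<omega> show "S (Suc k) q \<omega> - S k q \<omega> \<in> cball 0 ((1/2)^k)"
            by (auto simp: E_def S_def simple_integral_minus not_less norm_minus_commute)
        qed
        then show "norm (S (Suc k) t \<omega> - S k t \<omega>) \<le> (1/2)^k" by simp
      qed
    qed
    then have "uniform_limit {0..T} (\<lambda>n t. \<Sum>k<n. S (Suc k) t \<omega> - S k t \<omega>)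
        (\<lambda>t. \<Sum>k. S (Suc k) t \<omega> - S k t \<omega>) sequentially"
      by (rule Weierstrass_m_test_ev) (simp add: summable_geometric)
    then have "uniform_limit {0..T} (\<lambda>n t. S 0 t \<omega> + (\<Sum>k<n. S (Suc k) t \<omega> - S k t \<omega>))
        (\<lambda>t. S 0 t \<omega> + (\<Sum>k. S (Suc k) t \<omega> - S k t \<omega>)) sequentially"
      by (intro uniform_limit_intros)
    then show "uniform_limit {0..T} (\<lambda>k t. S k t \<omega>) (\<lambda>t. I t \<omega>) sequentially"
      using \<omega> sum_lessThan_telescope[of "\<lambda>k. S k _ \<omega>"] by (simp add: I_def)
  qed
  have cI: "continuous_on {0..T} (\<lambda>t. I t \<omega>)" if "\<omega> \<in> space M" for \<omega>
  proof (cases "\<omega> \<in> N")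
    case False
    show ?thesis
      by (rule uniform_limit_theorem[OF _ unif[OF that False]]) (auto intro!: always_eventually contS[OF that False])
  qed (simp add: I_def)
  have IF: "I t \<in> borel_measurable (F t)" if t: "t \<in> {0..T}" for t
  proof -
    have "N \<in> sets (F t)" using N null_sets_F by blast
    then have "Measurable.pred (F t) (\<lambda>\<omega>. \<omega> \<in> N)" by (simp add: pred_sets2)
    moreover have "(\<lambda>\<omega>. S 0 t \<omega> + (\<Sum>k. S (Suc k) t \<omega> - S k t \<omega>)) \<in> borel_measurable (F t)"
      using SF t by (intro borel_measurable_add borel_measurable_suminf borel_measurable_diff) auto
    ultimately have "(\<lambda>\<omega>. I t \<omega>) \<in> borel_measurable (F t)"
      unfolding I_def by (intro measurable_If) auto
    then show ?thesis by simp
  qed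
  have IM: "I t \<in> borel_measurable M" if t: "t \<in> {0..T}" for t
    by (rule F_measurable_M[OF IF[OF t]])
  have adapted: "adapted_process M F T I"
    unfolding adapted_process_def using IF caratheodory_measurable[OF IM cI] by blast
  have lim: "(\<lambda>k. \<integral>\<^sup>+\<omega>. ennreal ((norm (S k t \<omega> - I t \<omega>))\<^sup>2) \<partial>M) \<longlonglongrightarrow> 0" if t: "t \<in> {0..T}" for t
  proof (rule tendsto_sandwich[of "\<lambda>_. 0"])
    have t0: "0 \<le> t" using t by simp
    have "(\<lambda>k. ennreal (4 * (1/16)^k)) \<longlonglongrightarrow> ennreal (4 * 0)"
      by (intro tendsto_intros tendsto_ennrealI LIMSEQ_power_zero) simp
    then show "(\<lambda>k. ennreal (4 * (1/16)^k)) \<longlonglongrightarrow> 0" by simp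
    show "\<forall>\<^sub>F k in sequentially. (\<integral>\<^sup>+\<omega>. ennreal ((norm (S k t \<omega> - I t \<omega>))\<^sup>2) \<partial>M) \<le> ennreal (4 * (1/16)^k)"
    proof (intro always_eventually allI)
      fix k
      \<comment> \<open>Fatou's lemma in \<open>j\<close>: the Cauchy estimate \<open>close\<close>
        survives the limit, so the convergence to \<open>I t\<close> holds in mean square and not
        only pathwise.\<close>
      have "(\<integral>\<^sup>+\<omega>. ennreal ((norm (S k t \<omega> - I t \<omega>))\<^sup>2) \<partial>M) =
          (\<integral>\<^sup>+\<omega>. liminf (\<lambda>j. ennreal ((norm (S k t \<omega> - S j t \<omega>))\<^sup>2)) \<partial>M)"
      proof (rule nn_integral_cong_AE)
        have "AE \<omega> in M. \<omega> \<notin> N" using N by (rule AE_not_in)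
        moreover have "AE \<omega> in M. \<omega> \<in> space M" by simp
        ultimately show "AE \<omega> in M. ennreal ((norm (S k t \<omega> - I t \<omega>))\<^sup>2) = liminf (\<lambda>j. ennreal ((norm (S k t \<omega> - S j t \<omega>))\<^sup>2))"
        proof eventually_elim
          case (elim \<omega>)
          have "(\<lambda>j. S j t \<omega>) \<longlonglongrightarrow> I t \<omega>"
            by (rule tendsto_uniform_limitI[OF unif t]) (use elim in auto)
          then have "(\<lambda>j. ennreal ((norm (S k t \<omega> - S j t \<omega>))\<^sup>2)) \<longlonglongrightarrow> ennreal ((norm (S k t \<omega> - I t \<omega>))\<^sup>2)"
            by (intro tendsto_ennrealI tendsto_intros)
          then show ?case by (intro lim_imp_Liminf[symmetric]) auto
        qed
      qed
      also have "\<dots> \<le> liminf (\<lambda>j. \<integral>\<^sup>+\<omega>. ennreal ((norm (S k t \<omega> - S j t \<omega>))\<^sup>2) \<partial>M)"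
        using SM[OF t0] by (intro nn_integral_liminf) measurable
      also have "\<dots> \<le> limsup (\<lambda>j. \<integral>\<^sup>+\<omega>. ennreal ((norm (S k t \<omega> - S j t \<omega>))\<^sup>2) \<partial>M)"
        by (intro Liminf_le_Limsup) simp
      also have "\<dots> \<le> ennreal (4 * (1/16)^k)"
        by (intro Limsup_bounded eventually_sequentiallyI[of k] close[OF t]) 
      finally show "(\<integral>\<^sup>+\<omega>. ennreal ((norm (S k t \<omega> - I t \<omega>))\<^sup>2) \<partial>M) \<le> ennreal (4 * (1/16)^k)" .
    qed
  qed auto
  have distlim: "(\<lambda>k. value_dist T (\<Phi> k) \<phi>) \<longlonglongrightarrow> 0"
  proof (rule tendsto_sandwich[of "\<lambda>_. 0"])
    have "(\<lambda>k. ennreal ((1/16)^k)) \<longlonglongrightarrow> ennreal 0"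
      by (intro tendsto_ennrealI LIMSEQ_power_zero) simp
    then show "(\<lambda>k. ennreal ((1/16)^k)) \<longlonglongrightarrow> 0" by simp
  qed (use dist in auto)
  have "ito_integral M F T w \<phi> I"
    unfolding ito_integral_def
  proof (intro conjI \<phi> adapted exI[of _ \<Phi>] allI \<Phi> ballI)
    show "AE \<omega> in M. continuous_on {0..T} (\<lambda>t. I t \<omega>)" using cI by (intro AE_I2)
    show "(\<lambda>m. \<integral>\<^sup>+\<omega>. (\<integral>\<^sup>+t\<in>{0..T}. ennreal ((norm (simple_value (\<Phi> m) t \<omega> - \<phi> t \<omega>))\<^sup>2) \<partial>lborel) \<partial>M) \<longlonglongrightarrow> 0"
      using distlim by (simp add: value_dist_def)
    fix t assume "t \<in> {0..T}"
    from lim[OF this] show "(\<lambda>m. \<integral>\<^sup>+\<omega>. ennreal ((norm (simple_integral w (\<Phi> m) t \<omega> - I t \<omega>))\<^sup>2) \<partial>M) \<longlonglongrightarrow> 0"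
      by (simp add: S_def)
  qed
  with cI show ?thesis by blast
qed

lemma ito_integralD:
  assumes "ito_integral M F T w \<phi> I"
  obtains \<Phi> where "\<And>m. simple_process M F T (\<Phi> m)" "(\<lambda>m. value_dist T (\<Phi> m) \<phi>) \<longlonglongrightarrow> 0"
    "\<And>t. t \<in> {0..T} \<Longrightarrow> (\<lambda>m. \<integral>\<^sup>+\<omega>. ennreal ((norm (simple_integral w (\<Phi> m) t \<omega> - I t \<omega>))\<^sup>2) \<partial>M) \<longlonglongrightarrow> 0"
  using assms unfolding ito_integral_def value_dist_def by blast

lemma ito_integral_measurable:
  assumes "ito_integral M F T w \<phi> I" "t \<in> {0..T}"
  shows "I t \<in> borel_measurable (F t)" "I t \<in> borel_measurable M"
proof -
  show "I t \<in> borel_measurable (F t)"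
    using assms unfolding ito_integral_def adapted_process_def by blast
  then show "I t \<in> borel_measurable M" by (rule F_measurable_M)
qed

text \<open>Two approximating sequences have integrals that are close by the isometry, since both
  integrands are close to \<open>\<phi>\<close>. This gives equality almost surely at each time, and
  continuity makes the exceptional set independent of the time.\<close>

lemma ito_integral_unique:
  fixes \<phi> :: "real \<Rightarrow> 'w \<Rightarrow> 'v::euclidean_space"
  assumes T: "0 < T" and I: "ito_integral M F T w \<phi> I" and J: "ito_integral M F T w \<phi> J"
  shows "AE \<omega> in M. \<forall>t\<in>{0..T}. I t \<omega> = J t \<omega>"
proof -
  have \<phi>: "\<phi> \<in> L2_adapted M F T" using I by (simp add: ito_integral_def)
  obtain \<Phi> where \<Phi>: "\<And>m. simple_process M F T (\<Phi> m)" "(\<lambda>m. value_dist T (\<Phi> m) \<phi>) \<longlonglongrightarrow> 0"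
    "\<And>t. t \<in> {0..T} \<Longrightarrow> (\<lambda>m. \<integral>\<^sup>+\<omega>. ennreal ((norm (simple_integral w (\<Phi> m) t \<omega> - I t \<omega>))\<^sup>2) \<partial>M) \<longlonglongrightarrow> 0"
    by (rule ito_integralD[OF I]) blast
  obtain \<Psi> where \<Psi>: "\<And>m. simple_process M F T (\<Psi> m)" "(\<lambda>m. value_dist T (\<Psi> m) \<phi>) \<longlonglongrightarrow> 0"
    "\<And>t. t \<in> {0..T} \<Longrightarrow> (\<lambda>m. \<integral>\<^sup>+\<omega>. ennreal ((norm (simple_integral w (\<Psi> m) t \<omega> - J t \<omega>))\<^sup>2) \<partial>M) \<longlonglongrightarrow> 0"
    by (rule ito_integralD[OF J]) blast
  have eq: "AE \<omega> in M. I t \<omega> = J t \<omega>" if t: "t \<in> {0..T}" for t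
  proof -
    note [measurable] = ito_integral_measurable(2)[OF I t] ito_integral_measurable(2)[OF J t]
    have m[measurable]: "simple_integral w (\<Phi> m) t \<in> borel_measurable M" "simple_integral w (\<Psi> m) t \<in> borel_measurable M" for m
      using t \<Phi>(1) \<Psi>(1) by (auto intro!: F_measurable_M simple_integral_measurable)
    let ?d = "\<lambda>X Y. \<integral>\<^sup>+\<omega>. ennreal ((norm (X \<omega> - Y \<omega> :: 'v))\<^sup>2) \<partial>M"
    have le: "?d (I t) (J t) \<le> 2 * ?d (simple_integral w (\<Phi> m) t) (I t) +
        2 * (2 * ?d (simple_integral w (\<Psi> m) t) (J t) + 2 * (2 * value_dist T (\<Phi> m) \<phi> + 2 * value_dist T (\<Psi> m) \<phi>))" for m
    proof -
      have "?d (I t) (J t) \<le> 2 * ?d (I t) (simple_integral w (\<Phi> m) t) + 2 * ?d (J t) (simple_integral w (\<Phi> m) t)"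
        by (rule nn_integral_norm_diff_le) measurable
      moreover have "?d (J t) (simple_integral w (\<Phi> m) t) \<le> 2 * ?d (J t) (simple_integral w (\<Psi> m) t)
          + 2 * ?d (simple_integral w (\<Phi> m) t) (simple_integral w (\<Psi> m) t)"
        by (rule nn_integral_norm_diff_le) measurable
      moreover have "?d (simple_integral w (\<Phi> m) t) (simple_integral w (\<Psi> m) t) \<le> 2 * value_dist T (\<Phi> m) \<phi> + 2 * value_dist T (\<Psi> m) \<phi>"
        by (rule simple_integral_diff_le[OF \<Phi>(1) \<Psi>(1) \<phi> t])
      ultimately have "?d (I t) (J t) \<le> 2 * ?d (I t) (simple_integral w (\<Phi> m) t) +
        2 * (2 * ?d (J t) (simple_integral w (\<Psi> m) t) + 2 * (2 * value_dist T (\<Phi> m) \<phi> + 2 * value_dist T (\<Psi> m) \<phi>))"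
        by (meson add_left_mono add_mono mult_left_mono order_trans order_refl zero_le)
      then show ?thesis by (simp add: norm_minus_commute)
    qed
    have "(\<lambda>m. 2 * ?d (simple_integral w (\<Phi> m) t) (I t) +
        2 * (2 * ?d (simple_integral w (\<Psi> m) t) (J t) + 2 * (2 * value_dist T (\<Phi> m) \<phi> + 2 * value_dist T (\<Psi> m) \<phi>)))
        \<longlonglongrightarrow> 2 * 0 + 2 * (2 * 0 + 2 * (2 * 0 + 2 * 0))"
      by (intro tendsto_add ennreal_tendsto_cmult \<Phi> \<Psi> t) auto
    then have "?d (I t) (J t) \<le> 2 * 0 + 2 * (2 * 0 + 2 * (2 * 0 + 2 * 0))"
      by (rule LIMSEQ_le_const) (use le in blast)
    then have "?d (I t) (J t) = 0" by simp
    then have "AE \<omega> in M. ennreal ((norm (I t \<omega> - J t \<omega>))\<^sup>2) = 0"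
      by (subst (asm) nn_integral_0_iff_AE) auto
    then show ?thesis by eventually_elim simp
  qed
  have "AE \<omega> in M. \<forall>t\<in>{0..T} \<inter> \<rat>. I t \<omega> = J t \<omega>"
    using eq by (subst AE_ball_countable) (auto simp: countable_rat)
  moreover have "AE \<omega> in M. continuous_on {0..T} (\<lambda>t. I t \<omega>)" "AE \<omega> in M. continuous_on {0..T} (\<lambda>t. J t \<omega>)"
    using I J by (auto simp: ito_integral_def)
  ultimately show ?thesis
  proof eventually_elim
    case (elim \<omega>)
    show ?case
    proof
      fix t assume t: "t \<in> {0..T}"
      have "I t \<omega> - J t \<omega> \<in> {0}"
        by (rule interval_rational_dense[OF T _ _ _ t]) (use elim in \<open>auto intro!: continuous_intros\<close>)
      then show "I t \<omega> = J t \<omega>" by simp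
    qed
  qed
qed

text \<open>The definition recast with real expectations, together with a second-moment bound that
  is uniform in \<open>t\<close>. The uniformity makes the integral square integrable over time as
  well.\<close>

lemma ito_integral_approx:
  assumes I: "ito_integral M F T w \<phi> I"
  obtains \<Phi> c where "\<And>m. simple_process M F T (\<Phi> m)"
    "\<And>m t. t \<in> {0..T} \<Longrightarrow> square_integrable M (\<lambda>\<omega>. simple_integral w (\<Phi> m) t \<omega> - I t \<omega>)"
    "\<And>t. t \<in> {0..T} \<Longrightarrow> (\<lambda>m. expectation (\<lambda>\<omega>. (norm (simple_integral w (\<Phi> m) t \<omega> - I t \<omega>))\<^sup>2)) \<longlonglongrightarrow> 0"
    "\<And>t. t \<in> {0..T} \<Longrightarrow> square_integrable M (I t) \<and> (\<integral>\<^sup>+\<omega>. ennreal ((norm (I t \<omega>))\<^sup>2) \<partial>M) \<le> ennreal c"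
proof -
  have \<phi>: "\<phi> \<in> L2_adapted M F T" using I by (simp add: ito_integral_def)
  obtain \<Phi>0 where \<Phi>0: "\<And>m. simple_process M F T (\<Phi>0 m)" "(\<lambda>m. value_dist T (\<Phi>0 m) \<phi>) \<longlonglongrightarrow> 0"
    "\<And>t. t \<in> {0..T} \<Longrightarrow> (\<lambda>m. \<integral>\<^sup>+\<omega>. ennreal ((norm (simple_integral w (\<Phi>0 m) t \<omega> - I t \<omega>))\<^sup>2) \<partial>M) \<longlonglongrightarrow> 0"
    by (rule ito_integralD[OF I]) blast
  let ?d = "\<lambda>m t. \<integral>\<^sup>+\<omega>. ennreal ((norm (simple_integral w (\<Phi>0 m) t \<omega> - I t \<omega>))\<^sup>2) \<partial>M"
  have mS: "simple_integral w (\<Phi>0 m) t \<in> borel_measurable M" if "t \<in> {0..T}" for m t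
    using that \<Phi>0(1) by (auto intro!: F_measurable_M simple_integral_measurable)
  have sqS: "square_integrable M (simple_integral w (\<Phi>0 m) t)" if "t \<in> {0..T}" for m t
    using that by (intro simple_integral_square(1)[OF \<Phi>0(1)]) auto
  have one: "\<forall>\<^sub>F m in sequentially. ?d m t < 1" if "t \<in> {0..T}" for t
    by (rule order_tendstoD(2)[OF \<Phi>0(3)[OF that]]) simp
  have sqI: "square_integrable M (I t)" if t: "t \<in> {0..T}" for t
  proof -
    \<comment> \<open>One approximant at finite distance already shows that \<open>I t\<close> is
      square integrable.\<close>
    from one[OF t] obtain m where "?d m t < 1" by (auto simp: eventually_sequentially)
    then have "?d m t < \<infinity>" using less_trans by fastforce
    then have "square_integrable M (\<lambda>\<omega>. simple_integral w (\<Phi>0 m) t \<omega> - I t \<omega>)"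
      using mS[OF t] ito_integral_measurable(2)[OF I t] by (subst square_integrable_iff_nn_integral) auto
    from square_integrable_diff[OF sqS[OF t, of m] this] show ?thesis by simp
  qed
  have dreal: "?d m t = ennreal (expectation (\<lambda>\<omega>. (norm (simple_integral w (\<Phi>0 m) t \<omega> - I t \<omega>))\<^sup>2))"
    if "t \<in> {0..T}" for m t
    by (rule nn_integral_square_integrable[OF square_integrable_diff[OF sqS sqI]]) (fact that)+
  let ?v = "\<integral>\<^sup>+z. ennreal ((norm (\<phi> (fst z) (snd z)))\<^sup>2) \<partial>(time_measure T \<Otimes>\<^sub>M M)"
  have \<phi>sq: "square_integrable (time_measure T \<Otimes>\<^sub>M M) (\<lambda>z. \<phi> (fst z) (snd z))"
    using \<phi> by (simp add: L2_adapted_iff case_prod_unfold)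
  then have "?v < \<infinity>"
    using square_integrable_iff_nn_integral[OF square_integrable_measurable[OF \<phi>sq]] by blast
  then obtain v where v: "v \<ge> 0" "?v = ennreal v" by (cases ?v) auto
  \<comment> \<open>The squared norm of a sum is at most twice the sum of the squares. Used once to
    pass from \<open>I t\<close> to a simple integral and once to pass from its integrand to
    \<open>\<phi>\<close>, with both distances at most 1, this gives the constant.\<close>
  have bound: "(\<integral>\<^sup>+\<omega>. ennreal ((norm (I t \<omega>))\<^sup>2) \<partial>M) \<le> ennreal (2 + 2 * (2 + 2 * v))" if t: "t \<in> {0..T}" for t
  proof -
    have "\<forall>\<^sub>F m in sequentially. value_dist T (\<Phi>0 m) \<phi> < 1"
      by (rule order_tendstoD(2)[OF \<Phi>0(2)]) simp
    with one[OF t] have "\<forall>\<^sub>F m in sequentially. ?d m t < 1 \<and> value_dist T (\<Phi>0 m) \<phi> < 1"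
      by eventually_elim simp
    then obtain m where m: "?d m t \<le> 1" "value_dist T (\<Phi>0 m) \<phi> \<le> 1"
      by (auto simp: eventually_sequentially dest: less_imp_le)
    have "(\<integral>\<^sup>+\<omega>. ennreal ((norm (I t \<omega>))\<^sup>2) \<partial>M) \<le> 2 * ?d m t + 2 * (\<integral>\<^sup>+\<omega>. ennreal ((norm (simple_integral w (\<Phi>0 m) t \<omega>))\<^sup>2) \<partial>M)"
      using nn_integral_norm_diff_le[OF ito_integral_measurable(2)[OF I t] mS[OF t, of m], of "\<lambda>_. 0"]
      by (simp add: norm_minus_commute)
    also have "\<dots> \<le> 2 * 1 + 2 * (\<integral>\<^sup>+z. ennreal ((norm (simple_value (\<Phi>0 m) (fst z) (snd z)))\<^sup>2) \<partial>(time_measure T \<Otimes>\<^sub>M M))"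
      by (intro add_mono mult_left_mono m simple_integral_le_value[OF \<Phi>0(1) t]) auto
    also have "\<dots> \<le> 2 * 1 + 2 * (2 * value_dist T (\<Phi>0 m) \<phi> + 2 * ?v)"
    proof (intro add_mono mult_left_mono)
      have "(\<lambda>z. simple_value (\<Phi>0 m) (fst z) (snd z)) \<in> borel_measurable (time_measure T \<Otimes>\<^sub>M M)"
        using simple_value_measurable[OF \<Phi>0(1)] by (simp add: case_prod_unfold)
      from nn_integral_norm_diff_le[OF this square_integrable_measurable[OF \<phi>sq], of "\<lambda>_. 0"]
      show "(\<integral>\<^sup>+z. ennreal ((norm (simple_value (\<Phi>0 m) (fst z) (snd z)))\<^sup>2) \<partial>(time_measure T \<Otimes>\<^sub>M M))
        \<le> 2 * value_dist T (\<Phi>0 m) \<phi> + 2 * ?v"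
        by (simp add: value_dist_pair[OF \<Phi>0(1) \<phi>])
    qed auto
    also have "\<dots> \<le> 2 * 1 + 2 * (2 * 1 + 2 * ?v)"
      by (intro add_mono mult_left_mono m) auto
    also have "\<dots> = ennreal (2 + 2 * (2 + 2 * v))"
      using v by (simp add: ennreal_plus ennreal_mult)
    finally show ?thesis .
  qed
  show thesis
  proof (rule that[of \<Phi>0 "2 + 2 * (2 + 2 * v)"])
    fix t assume t: "t \<in> {0..T}"
    show "square_integrable M (\<lambda>\<omega>. simple_integral w (\<Phi>0 m) t \<omega> - I t \<omega>)" for m
      by (intro square_integrable_diff sqS sqI t)
    show "(\<lambda>m. expectation (\<lambda>\<omega>. (norm (simple_integral w (\<Phi>0 m) t \<omega> - I t \<omega>))\<^sup>2)) \<longlonglongrightarrow> 0"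
      using \<Phi>0(3)[OF t] unfolding dreal[OF t]
      by (subst (asm) ennreal_0[symmetric], subst (asm) tendsto_ennreal_iff) auto
    show "square_integrable M (I t) \<and> (\<integral>\<^sup>+\<omega>. ennreal ((norm (I t \<omega>))\<^sup>2) \<partial>M) \<le> ennreal (2 + 2 * (2 + 2 * v))"
      using sqI[OF t] bound[OF t] by blast
  qed (rule \<Phi>0)
qed

lemma ito_integral_square_integrable:
  assumes I: "ito_integral M F T w \<phi> I"
  shows "t \<in> {0..T} \<Longrightarrow> square_integrable M (I t)" and "I \<in> L2_adapted M F T"
proof -
  obtain c where c: "\<And>t. t \<in> {0..T} \<Longrightarrow> square_integrable M (I t) \<and> (\<integral>\<^sup>+\<omega>. ennreal ((norm (I t \<omega>))\<^sup>2) \<partial>M) \<le> ennreal c"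
    by (rule ito_integral_approx[OF I]) blast
  show "t \<in> {0..T} \<Longrightarrow> square_integrable M (I t)" using c by blast
  have ad: "adapted_process M F T I" using I by (simp add: ito_integral_def)
  then have m: "(\<lambda>z. I (fst z) (snd z)) \<in> borel_measurable (time_measure T \<Otimes>\<^sub>M M)"
    unfolding adapted_process_def measurable_time_pair case_prod_unfold by blast
  have "(\<integral>\<^sup>+z. ennreal ((norm (I (fst z) (snd z)))\<^sup>2) \<partial>(time_measure T \<Otimes>\<^sub>M M)) =
      (\<integral>\<^sup>+t. (\<integral>\<^sup>+\<omega>. ennreal ((norm (I t \<omega>))\<^sup>2) \<partial>M) \<partial>time_measure T)"
    using m by (subst nn_integral_fst[symmetric]) auto
  also have "\<dots> \<le> (\<integral>\<^sup>+t. ennreal c \<partial>time_measure T)"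
    by (intro nn_integral_mono) (use c in \<open>auto simp: space_restrict_space\<close>)
  also have "\<dots> < \<infinity>"
    using finite_measure.emeasure_finite[OF finite_measure_time, of T "space (time_measure T)"]
    by (simp add: ennreal_mult_less_top less_top)
  finally have "square_integrable (time_measure T \<Otimes>\<^sub>M M) (\<lambda>z. I (fst z) (snd z))"
    by (simp add: square_integrable_iff_nn_integral[OF m])
  then show "I \<in> L2_adapted M F T"
    using ad by (simp add: L2_adapted_iff case_prod_unfold)
qed

text \<open>The martingale property in weak form: instead of a conditional expectation, it is tested
  against square integrable variables known at time \<open>s\<close>. In this form it passes from
  simple integrals to their mean-square limits by Cauchy-Schwarz.\<close>

lemma ito_integral_martingale:
  assumes I: "ito_integral M F T w \<phi> I" and st: "0 \<le> s" "s \<le> t" "t \<le> T"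
    and Y: "Y \<in> borel_measurable (F s)" "square_integrable M Y"
  shows "expectation (\<lambda>\<omega>. I t \<omega> \<bullet> Y \<omega>) = expectation (\<lambda>\<omega>. I s \<omega> \<bullet> Y \<omega>)"
proof -
  obtain \<Phi> where \<Phi>: "\<And>m. simple_process M F T (\<Phi> m)"
    and sq: "\<And>m t. t \<in> {0..T} \<Longrightarrow> square_integrable M (\<lambda>\<omega>. simple_integral w (\<Phi> m) t \<omega> - I t \<omega>)"
    and lim: "\<And>t. t \<in> {0..T} \<Longrightarrow> (\<lambda>m. expectation (\<lambda>\<omega>. (norm (simple_integral w (\<Phi> m) t \<omega> - I t \<omega>))\<^sup>2)) \<longlonglongrightarrow> 0"
    by (rule ito_integral_approx[OF I]) blast
  have s: "s \<in> {0..T}" and t: "t \<in> {0..T}" using st by auto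
  note sqI = ito_integral_square_integrable(1)[OF I]
  have sqS: "square_integrable M (simple_integral w (\<Phi> m) r)" if "r \<in> {0..T}" for m r
    using that by (intro simple_integral_square(1)[OF \<Phi>]) auto
  have eq: "expectation (\<lambda>\<omega>. (simple_integral w (\<Phi> m) s \<omega> - I s \<omega>) \<bullet> Y \<omega>) -
      expectation (\<lambda>\<omega>. (simple_integral w (\<Phi> m) t \<omega> - I t \<omega>) \<bullet> Y \<omega>) =
      expectation (\<lambda>\<omega>. I t \<omega> \<bullet> Y \<omega>) - expectation (\<lambda>\<omega>. I s \<omega> \<bullet> Y \<omega>)" for m
  proof -
    note i = square_integrable_inner[OF sqS[OF s, of m] Y(2)] square_integrable_inner[OF sqS[OF t, of m] Y(2)]
      square_integrable_inner[OF sqI[OF s] Y(2)] square_integrable_inner[OF sqI[OF t] Y(2)]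
    have "expectation (\<lambda>\<omega>. (simple_integral w (\<Phi> m) t \<omega> - simple_integral w (\<Phi> m) s \<omega>) \<bullet> Y \<omega>) = 0"
      by (rule simple_integral_martingale[OF \<Phi> st(1,2) Y])
    then show ?thesis using i by (simp add: inner_diff_left)
  qed
  have "(\<lambda>m. expectation (\<lambda>\<omega>. (simple_integral w (\<Phi> m) s \<omega> - I s \<omega>) \<bullet> Y \<omega>) -
      expectation (\<lambda>\<omega>. (simple_integral w (\<Phi> m) t \<omega> - I t \<omega>) \<bullet> Y \<omega>)) \<longlonglongrightarrow> 0 - 0"
    by (intro tendsto_diff square_integral_tendsto_zero_inner sq lim s t Y(2))
  then have "(\<lambda>m::nat. expectation (\<lambda>\<omega>. I t \<omega> \<bullet> Y \<omega>) - expectation (\<lambda>\<omega>. I s \<omega> \<bullet> Y \<omega>)) \<longlonglongrightarrow> 0"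
    unfolding eq by simp
  then show ?thesis by (simp add: LIMSEQ_const_iff)
qed

end

section \<open>Square integrable adapted processes\<close>

lemma borel_measurable_time_fst:
  assumes "continuous_on {0..T} c"
  shows "(\<lambda>z. c (fst z)) \<in> borel_measurable (time_measure T \<Otimes>\<^sub>M M)"
proof -
  have "c \<in> borel_measurable (restrict_space borel {0..T})"
    by (rule borel_measurable_continuous_on_restrict[OF assms])
  then have "c \<in> borel_measurable (time_measure T)"
    by (simp only: measurable_cong_sets[OF sets_restrict_space_cong[OF sets_lborel] refl])
  then show ?thesis by (rule measurable_compose[OF measurable_fst])
qed

context filtered_prob_space
begin

abbreviation pair_time :: "real \<Rightarrow> (real \<times> 'w) measure" where
  "pair_time T \<equiv> time_measure T \<Otimes>\<^sub>M M"

lemma finite_measure_pair_time: "finite_measure (pair_time T)"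
proof (rule finite_measureI)
  have "emeasure (pair_time T) (space (pair_time T)) = emeasure (time_measure T) (space (time_measure T)) * emeasure M (space M)"
    unfolding space_pair_measure by (rule emeasure_pair_measure_Times[OF sets.top sets.top])
  also have "\<dots> < \<infinity>"
    using finite_measure.emeasure_finite[OF finite_measure_time] by (simp add: ennreal_mult_less_top less_top emeasure_space_1)
  finally show "emeasure (pair_time T) (space (pair_time T)) \<noteq> \<infinity>" by simp
qed

lemma L2_adaptedD:
  assumes "X \<in> L2_adapted M F T"
  shows "square_integrable (pair_time T) (\<lambda>z. X (fst z) (snd z))"
    "t \<in> {0..T} \<Longrightarrow> X t \<in> borel_measurable (F t)"
  using assms by (auto simp: L2_adapted_iff case_prod_unfold adapted_process_def)

lemma L2_adaptedI:
  assumes "square_integrable (pair_time T) (\<lambda>z. X (fst z) (snd z))"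
    "\<And>t. t \<in> {0..T} \<Longrightarrow> X t \<in> borel_measurable (F t)"
  shows "X \<in> L2_adapted M F T"
  using assms by (auto simp: L2_adapted_iff case_prod_unfold adapted_process_def measurable_time_pair
      square_integrable_def)

lemma L2_adapted_add:
  assumes "X \<in> L2_adapted M F T" "Y \<in> L2_adapted M F T"
  shows "(\<lambda>t \<omega>. X t \<omega> + Y t \<omega>) \<in> L2_adapted M F T"
  by (rule L2_adaptedI[OF square_integrable_add[OF L2_adaptedD(1)[OF assms(1)] L2_adaptedD(1)[OF assms(2)]]
        borel_measurable_add[OF L2_adaptedD(2)[OF assms(1)] L2_adaptedD(2)[OF assms(2)]]])

lemma L2_adapted_diff:
  assumes "X \<in> L2_adapted M F T" "Y \<in> L2_adapted M F T"
  shows "(\<lambda>t \<omega>. X t \<omega> - Y t \<omega>) \<in> L2_adapted M F T"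
  by (rule L2_adaptedI[OF square_integrable_diff[OF L2_adaptedD(1)[OF assms(1)] L2_adaptedD(1)[OF assms(2)]]
        borel_measurable_diff[OF L2_adaptedD(2)[OF assms(1)] L2_adaptedD(2)[OF assms(2)]]])

lemma L2_adapted_sum:
  assumes "\<And>i. i \<in> I \<Longrightarrow> X i \<in> L2_adapted M F T"
  shows "(\<lambda>t \<omega>. \<Sum>i\<in>I. X i t \<omega>) \<in> L2_adapted M F T"
  by (rule L2_adaptedI[OF square_integrable_sum[OF L2_adaptedD(1)[OF assms]]
        borel_measurable_sum[OF L2_adaptedD(2)[OF assms]]])

lemma L2_adapted_bilinear:
  fixes prod :: "'a::euclidean_space \<Rightarrow> 'b::euclidean_space \<Rightarrow> 'c::euclidean_space"
  assumes bil: "bounded_bilinear prod" and c: "continuous_on {0..T} c" and X: "X \<in> L2_adapted M F T"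
  shows "(\<lambda>t \<omega>. prod (c t) (X t \<omega>)) \<in> L2_adapted M F T"
proof (rule L2_adaptedI)
  obtain k where k: "k > 0" "\<And>a b. norm (prod a b) \<le> k * (norm a * norm b)"
    using bounded_bilinear_pos_bound[OF bil] by blast
  obtain l where l: "l > 0" "\<And>t. t \<in> {0..T} \<Longrightarrow> norm (c t) \<le> l"
    using continuous_on_interval_bound[OF c] by blast
  show "square_integrable (pair_time T) (\<lambda>z. prod (c (fst z)) (X (fst z) (snd z)))"
  proof (rule square_integrable_bound[OF L2_adaptedD(1)[OF X]])
    show "(\<lambda>z. prod (c (fst z)) (X (fst z) (snd z))) \<in> borel_measurable (pair_time T)"
      by (rule borel_measurable_bounded_bilinear[OF bil borel_measurable_time_fst[OF c]
          square_integrable_measurable[OF L2_adaptedD(1)[OF X]]])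
    show "AE z in pair_time T. norm (prod (c (fst z)) (X (fst z) (snd z))) \<le> (k * l) * norm (X (fst z) (snd z))"
    proof (rule AE_I2)
      fix z assume "z \<in> space (pair_time T)"
      then have z: "fst z \<in> {0..T}" by (auto simp: space_pair_measure space_restrict_space)
      have "norm (prod (c (fst z)) (X (fst z) (snd z))) \<le> k * (norm (c (fst z)) * norm (X (fst z) (snd z)))"
        by (rule k)
      also have "\<dots> \<le> k * (l * norm (X (fst z) (snd z)))"
        using k l(2)[OF z] by (intro mult_left_mono mult_right_mono) auto
      finally show "norm (prod (c (fst z)) (X (fst z) (snd z))) \<le> (k * l) * norm (X (fst z) (snd z))" by simp
    qed
  qed
  fix t assume t: "t \<in> {0..T}"
  show "(\<lambda>\<omega>. prod (c t) (X t \<omega>)) \<in> borel_measurable (F t)"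
    by (rule borel_measurable_bounded_bilinear[OF bil borel_measurable_const L2_adaptedD(2)[OF X t]])
qed

lemmas L2_adapted_matrix = L2_adapted_bilinear[OF bounded_bilinear_matrix_vector_mult]
lemmas L2_adapted_scaleR = L2_adapted_bilinear[OF bounded_bilinear_scaleR]

lemma square_integrable_random_variable:
  assumes X: "square_integrable M X"
  shows "square_integrable (pair_time T) (\<lambda>z. X (snd z))"
proof -
  have mX: "X \<in> borel_measurable M" using X by (rule square_integrable_measurable)
  have m: "(\<lambda>z. X (snd z)) \<in> borel_measurable (pair_time T)"
    by (rule measurable_compose[OF measurable_snd mX])
  have "(\<integral>\<^sup>+z. ennreal ((norm (X (snd z)))\<^sup>2) \<partial>pair_time T) =
      (\<integral>\<^sup>+t. (\<integral>\<^sup>+\<omega>. ennreal ((norm (X \<omega>))\<^sup>2) \<partial>M) \<partial>time_measure T)"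
    using m nn_integral_fst[of "\<lambda>z. ennreal ((norm (X (snd z)))\<^sup>2)" "time_measure T"] by simp
  also have "\<dots> = (\<integral>\<^sup>+\<omega>. ennreal ((norm (X \<omega>))\<^sup>2) \<partial>M) * emeasure (time_measure T) (space (time_measure T))"
    by (rule nn_integral_const)
  also have "\<dots> < \<infinity>"
    using finite_measure.emeasure_finite[OF finite_measure_time, of T "space (time_measure T)"]
      square_integrable_iff_nn_integral[OF mX] X
    by (simp add: ennreal_mult_less_top less_top)
  finally show ?thesis
    using square_integrable_iff_nn_integral[OF m] by blast
qed

lemma L2_adapted_deterministic:
  assumes c: "continuous_on {0..T} (c :: real \<Rightarrow> 'v::euclidean_space)"
  shows "(\<lambda>t \<omega>. c t) \<in> L2_adapted M F T"
proof (rule L2_adaptedI)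
  obtain l where l: "l > 0" "\<And>t. t \<in> {0..T} \<Longrightarrow> norm (c t) \<le> l"
    using continuous_on_interval_bound[OF c] by blast
  show "square_integrable (pair_time T) (\<lambda>z. c (fst z))"
    by (rule finite_measure.square_integrable_bounded[OF finite_measure_pair_time borel_measurable_time_fst[OF c], where c=l])
      (use l in \<open>auto simp: space_pair_measure space_restrict_space\<close>)
qed simp

lemma L2_adapted_integrable_inner:
  assumes X: "X \<in> L2_adapted M F T" and Y: "Y \<in> L2_adapted M F T"
  shows "integrable (pair_time T) (\<lambda>z. X (fst z) (snd z) \<bullet> Y (fst z) (snd z))"
  by (rule square_integrable_inner[OF L2_adaptedD(1)[OF X] L2_adaptedD(1)[OF Y]])

lemma AE_path_integrable:
  fixes g :: "real \<Rightarrow> 'w \<Rightarrow> 'v::euclidean_space"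
  assumes "integrable (pair_time T) (\<lambda>z. g (fst z) (snd z))"
  shows "AE \<omega> in M. set_integrable lborel {0..T} (\<lambda>t. g t \<omega>)"
    and "integrable M (\<lambda>\<omega>. LBINT t:{0..T}. g t \<omega>)"
    and "expectation (\<lambda>\<omega>. LBINT t:{0..T}. g t \<omega>) = (LINT z|pair_time T. g (fst z) (snd z))"
proof -
  interpret pair_sigma_finite "time_measure T" M by (rule pair_sigma_finite_time)
  have i: "integrable (pair_time T) (case_prod g)" using assms by (simp add: case_prod_unfold)
  have e: "(LBINT t:{0..T}. g t \<omega>) = (LINT t|time_measure T. g t \<omega>)" for \<omega>
    by (simp add: set_lebesgue_integral_def integral_restrict_space)
  show "AE \<omega> in M. set_integrable lborel {0..T} (\<lambda>t. g t \<omega>)"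
    using AE_integrable_snd[OF i] by (simp add: set_integrable_def integrable_restrict_space)
  show "integrable M (\<lambda>\<omega>. LBINT t:{0..T}. g t \<omega>)"
    unfolding e by (rule integrable_snd[OF i])
  show "expectation (\<lambda>\<omega>. LBINT t:{0..T}. g t \<omega>) = (LINT z|pair_time T. g (fst z) (snd z))"
    unfolding e using integral_snd[OF i] by (simp add: case_prod_unfold)
qed

lemma L2_adapted_integrable:
  assumes "X \<in> L2_adapted M F T"
  shows "integrable (pair_time T) (\<lambda>z. X (fst z) (snd z))"
  by (rule finite_measure.square_integrable_imp_integrable[OF finite_measure_pair_time L2_adaptedD(1)[OF assms]])

lemma L2_adapted_square_integrable_AE:
  assumes X: "X \<in> L2_adapted M F T"
  shows "AE t in time_measure T. square_integrable M (X t)"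
proof -
  interpret pair_sigma_finite "time_measure T" M by (rule pair_sigma_finite_time)
  have "AE t in time_measure T. integrable M (\<lambda>\<omega>. (norm (X t \<omega>))\<^sup>2)"
    using AE_integrable_fst'[OF square_integrable_norm2[OF L2_adaptedD(1)[OF X]]] by simp
  moreover have "AE t in time_measure T. t \<in> {0..T}"
    by (rule AE_I2) (simp add: space_restrict_space)
  ultimately show ?thesis
    by eventually_elim (auto simp: square_integrable_def intro: F_measurable_M[OF L2_adaptedD(2)[OF X]])
qed

text \<open>Cauchy-Schwarz in time against the constant 1. It is meant for data that enter the
  Gronwall bound through their total integral.\<close>

lemma square_integrable_time_integral:
  fixes X :: "real \<Rightarrow> 'w \<Rightarrow> 'v::euclidean_space"
  assumes X: "square_integrable (pair_time T) (\<lambda>z. X (fst z) (snd z))"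
  shows "square_integrable M (\<lambda>\<omega>. LBINT t:{0..T}. X t \<omega>)"
proof -
  let ?c = "measure (time_measure T) (space (time_measure T))"
  have i: "integrable (pair_time T) (\<lambda>z. X (fst z) (snd z))"
    by (rule finite_measure.square_integrable_imp_integrable[OF finite_measure_pair_time X])
  have m: "(\<lambda>\<omega>. LBINT t:{0..T}. X t \<omega>) \<in> borel_measurable M"
    using AE_path_integrable(2)[OF i] by auto
  interpret pair_sigma_finite "time_measure T" M by (rule pair_sigma_finite_time)
  interpret tm: finite_measure "time_measure T" by (rule finite_measure_time)
  have i2: "integrable (pair_time T) (case_prod (\<lambda>t \<omega>. (norm (X t \<omega>))\<^sup>2))"
    using square_integrable_norm2[OF X] by (simp add: case_prod_unfold)
  have sq: "AE \<omega> in M. integrable (time_measure T) (\<lambda>t. (norm (X t \<omega>))\<^sup>2)"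
    using AE_integrable_snd[OF i2] .
  have "AE \<omega> in M. integrable (time_measure T) (\<lambda>t. X t \<omega>)"
    using AE_integrable_snd[of X] i by (simp add: case_prod_unfold)
  with sq have le: "AE \<omega> in M. (norm (LBINT t:{0..T}. X t \<omega>))\<^sup>2 \<le> ?c * (LINT t|time_measure T. (norm (X t \<omega>))\<^sup>2)"
  proof eventually_elim
    case (elim \<omega>)
    have s1: "square_integrable (time_measure T) (\<lambda>t. norm (X t \<omega>))"
      using elim by (simp add: square_integrable_def)
    have s2: "square_integrable (time_measure T) (\<lambda>t. 1::real)"
      by (simp add: square_integrable_def)
    have "norm (LBINT t:{0..T}. X t \<omega>) = norm (LINT t|time_measure T. X t \<omega>)"
      by (simp add: set_lebesgue_integral_def integral_restrict_space)
    also have "\<dots> \<le> (LINT t|time_measure T. norm (X t \<omega>))"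
      by (rule integral_norm_bound)
    finally have "(norm (LBINT t:{0..T}. X t \<omega>))\<^sup>2 \<le> (LINT t|time_measure T. norm (X t \<omega>))\<^sup>2"
      by (intro power_mono) auto
    also have "\<dots> \<le> (LINT t|time_measure T. (norm (X t \<omega>))\<^sup>2) * ?c"
      using square_integral_inner_le[OF s1 s2] by simp
    finally show ?case by (simp add: mult.commute)
  qed
  show ?thesis
    unfolding square_integrable_def
  proof (intro conjI m)
    show "integrable M (\<lambda>\<omega>. (norm (LBINT t:{0..T}. X t \<omega>))\<^sup>2)"
    proof (rule Bochner_Integration.integrable_bound)
      show "integrable M (\<lambda>\<omega>. ?c * (LINT t|time_measure T. (norm (X t \<omega>))\<^sup>2))"
        using integrable_snd[OF i2] by (intro integrable_mult_right) simp
      show "(\<lambda>\<omega>. (norm (LBINT t:{0..T}. X t \<omega>))\<^sup>2) \<in> borel_measurable M" using m by measurable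
      show "AE \<omega> in M. norm ((norm (LBINT t:{0..T}. X t \<omega>))\<^sup>2) \<le> norm (?c * (LINT t|time_measure T. (norm (X t \<omega>))\<^sup>2))"
        using le by eventually_elim auto
    qed
  qed
qed

text \<open>The joint measurability in \<open>adapted_process\<close> refers to the whole space and
  does not by itself make a time integral up to \<open>t\<close> measurable with respect to
  \<open>F t\<close>. Continuity of the paths gives joint measurability with respect to
  \<open>F t\<close>, and then Fubini's theorem applies.\<close>

lemma time_integral_measurable:
  fixes X :: "real \<Rightarrow> 'w \<Rightarrow> 'v::euclidean_space"
  assumes X: "\<And>\<tau>. \<tau> \<in> {0..t} \<Longrightarrow> X \<tau> \<in> borel_measurable (F \<tau>)"
    and cont: "\<And>\<omega>. \<omega> \<in> space M \<Longrightarrow> continuous_on {0..t} (\<lambda>\<tau>. X \<tau> \<omega>)"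
  shows "(\<lambda>\<omega>. LBINT \<tau>:{0..t}. X \<tau> \<omega>) \<in> borel_measurable (F t)"
proof -
  have "(\<lambda>(\<tau>, \<omega>). X \<tau> \<omega>) \<in> borel_measurable (restrict_space borel {0..t} \<Otimes>\<^sub>M F t)"
    by (rule caratheodory_measurable) (use F_measurable_mono[OF X] cont in \<open>auto simp: space_F\<close>)
  then have "(\<lambda>(\<tau>, \<omega>). X \<tau> \<omega>) \<in> borel_measurable (time_measure t \<Otimes>\<^sub>M F t)"
    by (simp only: measurable_time_pair)
  then have "(\<lambda>(\<omega>, \<tau>). X \<tau> \<omega>) \<in> borel_measurable (F t \<Otimes>\<^sub>M time_measure t)"
    by (subst measurable_pair_swap_iff) (simp add: case_prod_unfold)
  then have "(\<lambda>\<omega>. LINT \<tau>|time_measure t. X \<tau> \<omega>) \<in> borel_measurable (F t)"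
    by (rule sigma_finite_measure.borel_measurable_lebesgue_integral[OF sigma_finite_time])
  then show ?thesis
    by (simp add: set_lebesgue_integral_def integral_restrict_space)
qed

end

context brownian_space
begin

text \<open>
  The martingale property allows \<open>I t\<close> to be replaced by its terminal value under the time integral;
  this is what makes the product rule for stochastic differentials unnecessary here.
\<close>

lemma ito_integral_orthogonal:
  fixes \<phi> :: "real \<Rightarrow> 'w \<Rightarrow> 'v::euclidean_space"
  assumes I: "ito_integral M F T w \<phi> I" and T: "0 \<le> T" and g: "g \<in> L2_adapted M F T"
    and zero: "AE \<omega> in M. (LBINT t:{0..T}. g t \<omega>) = 0"
  shows "(LINT z|pair_time T. I (fst z) (snd z) \<bullet> g (fst z) (snd z)) = 0"
proof -
  interpret pair_sigma_finite "time_measure T" M by (rule pair_sigma_finite_time)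
  note IL = ito_integral_square_integrable(2)[OF I]
  have TT: "T \<in> {0..T}" using T by simp
  have ITsq: "square_integrable (pair_time T) (\<lambda>z. I T (snd z))"
    by (intro square_integrable_random_variable ito_integral_square_integrable(1)[OF I TT])
  have i1: "integrable (pair_time T) (\<lambda>z. I (fst z) (snd z) \<bullet> g (fst z) (snd z))"
    by (rule L2_adapted_integrable_inner[OF IL g])
  have i2: "integrable (pair_time T) (\<lambda>z. I T (snd z) \<bullet> g (fst z) (snd z))"
    by (rule square_integrable_inner[OF ITsq L2_adaptedD(1)[OF g]])
  have "(LINT z|pair_time T. I (fst z) (snd z) \<bullet> g (fst z) (snd z)) = (LINT t|time_measure T. expectation (\<lambda>\<omega>. I t \<omega> \<bullet> g t \<omega>))"
    using integral_fst'[OF i1] by simp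
  also have "\<dots> = (LINT t|time_measure T. expectation (\<lambda>\<omega>. I T \<omega> \<bullet> g t \<omega>))"
  proof (rule Bochner_Integration.integral_cong_AE)
    show "(\<lambda>t. expectation (\<lambda>\<omega>. I t \<omega> \<bullet> g t \<omega>)) \<in> borel_measurable (time_measure T)"
      using borel_measurable_integrable[OF integrable_fst'[OF i1]] by simp
    show "(\<lambda>t. expectation (\<lambda>\<omega>. I T \<omega> \<bullet> g t \<omega>)) \<in> borel_measurable (time_measure T)"
      using borel_measurable_integrable[OF integrable_fst'[OF i2]] by simp
    have "AE t in time_measure T. t \<in> {0..T}"
      by (rule AE_I2) (simp add: space_restrict_space)
    with L2_adapted_square_integrable_AE[OF g]
    show "AE t in time_measure T. expectation (\<lambda>\<omega>. I t \<omega> \<bullet> g t \<omega>) = expectation (\<lambda>\<omega>. I T \<omega> \<bullet> g t \<omega>)"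
    proof eventually_elim
      case (elim t)
      show ?case
        by (rule ito_integral_martingale[OF I, symmetric]) (use elim in \<open>auto intro: L2_adaptedD(2)[OF g]\<close>)
    qed
  qed
  also have "\<dots> = (LINT z|pair_time T. I T (snd z) \<bullet> g (fst z) (snd z))"
    using integral_fst'[OF i2] by simp
  also have "\<dots> = expectation (\<lambda>\<omega>. LBINT t:{0..T}. I T \<omega> \<bullet> g t \<omega>)"
    using AE_path_integrable(3)[of T "\<lambda>t \<omega>. I T \<omega> \<bullet> g t \<omega>"] i2 by simp
  also have "\<dots> = expectation (\<lambda>\<omega>. 0)"
  proof (rule Bochner_Integration.integral_cong_AE)
    show "(\<lambda>\<omega>. LBINT t:{0..T}. I T \<omega> \<bullet> g t \<omega>) \<in> borel_measurable M"
      using AE_path_integrable(2)[of T "\<lambda>t \<omega>. I T \<omega> \<bullet> g t \<omega>"] i2 by auto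
    show "AE \<omega> in M. (LBINT t:{0..T}. I T \<omega> \<bullet> g t \<omega>) = 0"
      using zero AE_path_integrable(1)[OF L2_adapted_integrable[OF g]]
    proof eventually_elim
      case (elim \<omega>)
      have "(LBINT t:{0..T}. I T \<omega> \<bullet> g t \<omega>) = I T \<omega> \<bullet> (LBINT t:{0..T}. g t \<omega>)"
        unfolding set_lebesgue_integral_def
        using integral_bounded_linear[OF bounded_linear_inner_right elim(2)[unfolded set_integrable_def], of "I T \<omega>"]
        by simp
      then show ?case using elim by simp
    qed
  qed simp
  finally show ?thesis by simp
qed

lemma deterministic_approximation:
  fixes \<sigma> :: "real \<Rightarrow> 'v::euclidean_space"
  assumes T: "0 < T" and \<sigma>: "continuous_on {0..T} \<sigma>" and e: "0 < e"
  shows "\<exists>\<Phi>. simple_process M F T \<Phi> \<and> value_dist T \<Phi> (\<lambda>t \<omega>. \<sigma> t) \<le> ennreal e"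
proof -
  \<comment> \<open>Chosen so that \<open>d\<^sup>2 * T = e\<close>.\<close>
  define d where "d = sqrt (e / T)"
  have d: "0 < d" using e T by (simp add: d_def)
  have "uniformly_continuous_on {0..T} \<sigma>"
    by (rule compact_uniformly_continuous[OF \<sigma>]) simp
  then obtain r where r: "r > 0" "\<And>s t. s \<in> {0..T} \<Longrightarrow> t \<in> {0..T} \<Longrightarrow> dist s t < r \<Longrightarrow> dist (\<sigma> s) (\<sigma> t) < d"
    unfolding uniformly_continuous_on_def using d by metis
  obtain n where n: "T / r < real n" using reals_Archimedean2 by blast
  then have n0: "0 < n" using T r by (metis divide_pos_pos gr0I less_asym of_nat_0)
  define q where "q = T / real n"
  have q: "0 < q" "q < r" "real n * q = T"
    using n n0 T r by (auto simp: q_def field_simps)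
  define \<Phi> where "\<Phi> = map (\<lambda>k. (real k * q, real (Suc k) * q, \<lambda>\<omega>::'w. \<sigma> (real k * q))) [0..<n]"
  have \<Phi>: "simple_process M F T \<Phi>"
  proof -
    have "real (Suc k) * q \<le> T" if "k < n" for k
    proof -
      have "real (Suc k) * q \<le> real n * q" using that q by (intro mult_right_mono) auto
      then show ?thesis using q by simp
    qed
    then show ?thesis
      using q by (auto simp: simple_process_def \<Phi>_def bounded_iff algebra_simps)
  qed
  have val: "norm (simple_value \<Phi> t \<omega> - \<sigma> t) \<le> d" if t: "t \<in> {0<..T}" for t \<omega>
  proof -
    \<comment> \<open>The index of the interval from kq to (k + 1)q that contains \<open>t\<close>;
      the ceiling is lowered by one because the intervals are closed on the right. Time 0 lies in
      none of them, hence the restriction to positive \<open>t\<close> and the null set set aside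
      below.\<close>
    define k where "k = nat (\<lceil>t / q\<rceil> - 1)"
    have tq: "0 < t / q" using t q by simp
    have k: "real k = of_int \<lceil>t / q\<rceil> - 1" using tq by (simp add: k_def)
    have k1: "real k < t / q" "t / q \<le> real k + 1" unfolding k by linarith+
    then have k2: "real k * q < t" "t \<le> real (Suc k) * q" using q by (auto simp: field_simps)
    have "real k * q < real n * q" using k2 t q by auto
    then have kn: "k < n" using q(1) by (simp only: mult_less_cancel_right_pos of_nat_less_iff)
    have uniq: "j = k" if "real j * q < t" "t \<le> real (Suc j) * q" for j
    proof -
      have "real j * q < real (Suc k) * q" "real k * q < real (Suc j) * q" using that k2 by linarith+
      then have "real j < real (Suc k)" "real k < real (Suc j)" using q by (simp_all del: of_nat_Suc)
      then show "j = k" by linarith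
    qed
    have "simple_value \<Phi> t \<omega> = (\<Sum>j<n. indicator {real j * q<..real (Suc j) * q} t *\<^sub>R \<sigma> (real j * q))"
      unfolding simple_value_sum by (simp add: \<Phi>_def del: of_nat_Suc)
    also have "\<dots> = (\<Sum>j<n. if j = k then \<sigma> (real k * q) else 0)"
    proof (intro sum.cong refl)
      fix j
      show "indicator {real j * q<..real (Suc j) * q} t *\<^sub>R \<sigma> (real j * q) = (if j = k then \<sigma> (real k * q) else 0)"
      proof (cases "j = k")
        case True
        then show ?thesis using k2 by (simp del: of_nat_Suc)
      next
        case False
        then have "t \<notin> {real j * q<..real (Suc j) * q}"
          using uniq[of j] by (simp only: greaterThanAtMost_iff) blast
        then show ?thesis using False by (simp del: of_nat_Suc greaterThanAtMost_iff)
      qed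
    qed
    also have "\<dots> = \<sigma> (real k * q)" using kn by simp
    finally have "simple_value \<Phi> t \<omega> = \<sigma> (real k * q)" .
    moreover have "dist (real k * q) t < r" using k2 q by (auto simp: dist_real_def algebra_simps)
    moreover have "real k * q \<in> {0..T}" using k2 t q by auto
    ultimately show ?thesis using r(2)[of "real k * q" t] t by (auto simp: dist_norm)
  qed
  have "value_dist T \<Phi> (\<lambda>t \<omega>. \<sigma> t) \<le> (\<integral>\<^sup>+\<omega>. (\<integral>\<^sup>+t\<in>{0..T}. ennreal (d\<^sup>2) \<partial>lborel) \<partial>M)"
    unfolding value_dist_def
  proof (rule nn_integral_mono, rule nn_integral_mono_AE)
    fix \<omega>
    show "AE t in lborel. ennreal ((norm (simple_value \<Phi> t \<omega> - \<sigma> t))\<^sup>2) * indicator {0..T} t \<le> ennreal (d\<^sup>2) * indicator {0..T} t"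
      using AE_lborel_singleton[of "0::real"]
    proof eventually_elim
      case (elim t)
      show ?case
      proof (cases "t \<in> {0..T}")
        case True
        with elim have "norm (simple_value \<Phi> t \<omega> - \<sigma> t) \<le> d" by (intro val) auto
        then show ?thesis using True by (auto intro!: ennreal_leI power_mono)
      qed simp
    qed
  qed
  also have "\<dots> = ennreal (d\<^sup>2) * ennreal T"
    using T by (simp add: nn_integral_cmult_indicator emeasure_space_1)
  also have "\<dots> = ennreal e"
    using T e by (simp add: d_def flip: ennreal_mult)
  finally show ?thesis using \<Phi> by blast
qed

lemma wiener_integral_exists:
  fixes \<sigma> :: "real \<Rightarrow> 'v::euclidean_space"
  assumes T: "0 < T" and \<sigma>: "continuous_on {0..T} \<sigma>"
  shows "\<exists>I. ito_integral M F T w (\<lambda>t \<omega>. \<sigma> t) I \<and> (\<forall>\<omega>\<in>space M. continuous_on {0..T} (\<lambda>t. I t \<omega>))"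
  by (rule ito_integral_exists[OF T L2_adapted_deterministic[OF \<sigma>] deterministic_approximation[OF T \<sigma>]])

end

section \<open>Completion of squares\<close>

lemma matrix_inner_transpose: "(X *v a) \<bullet> b = a \<bullet> (transpose X *v (b :: real^'m))"
  for X :: "real^'n^'m"
  by (metis dot_lmul_matrix transpose_matrix_vector inner_commute)

lemmas matrix_vector_simps = matrix_vector_mult_add_rdistrib matrix_vector_mult_diff_rdistrib
  matrix_vector_right_distrib matrix_vector_mult_diff_distrib
  scaleR_matrix_vector_assoc[symmetric] matrix_vector_mult_scaleR matrix_vector_mul_assoc[symmetric]

text \<open>All data at one fixed time. \<open>Pd\<close>, \<open>Kd\<close>, \<open>sd\<close> are
  the derivatives of \<open>P\<close>, \<open>K\<close>, \<open>s\<close> there, so that what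
  follows is pure algebra.\<close>

locale riccati_data =
  fixes A G \<Gamma> Q P K Pd Kd :: "real^'n^'n" and B :: "real^'r^'n" and R Ri :: "real^'r^'r"
    and f \<eta> s sd :: "real^'n" and \<rho> :: real
  assumes Q: "transpose Q = Q" and P: "transpose P = P" and K: "transpose K = K"
    and Ri: "transpose Ri = Ri" and RRi: "R ** Ri = mat 1" and R: "transpose R = R"
    and Pd: "Pd = \<rho> *\<^sub>R P - transpose A ** P - P ** A - Q + P ** (B ** Ri ** transpose B) ** P"
    and Kd: "Kd = \<rho> *\<^sub>R K - transpose (A + G) ** K - K ** (A + G) - transpose G ** P - P ** G
      + (P + K) ** (B ** Ri ** transpose B) ** (P + K) - P ** (B ** Ri ** transpose B) ** P
      + Xi_matrix \<Gamma> Q"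
    and sd: "sd = \<rho> *\<^sub>R s - transpose (A + G - B ** Ri ** transpose B ** (P + K)) *v s
      - (P + K) *v f + (Q *v \<eta> - (transpose \<Gamma> ** Q) *v \<eta>)"
begin

lemma RRi_vec: "R *v (Ri *v x) = x"
  by (metis RRi matrix_vector_mul_assoc matrix_vector_mul_lid)

text \<open>
  Two control profiles are compared. For one agent, \<open>a\<close> and \<open>w\<close> are the differences of the states and
  of the controls, \<open>b\<close> and \<open>\<mu>\<close> their sums; \<open>c\<close>, \<open>d\<close>, \<open>wm\<close> are the averages of \<open>a\<close>, \<open>b\<close>, \<open>w\<close> over
  the agents. In these variables the difference of the two running costs is the bilinear \<open>cost_rate\<close>.
\<close>

definition feedback_square :: "real^'n \<Rightarrow> real^'r \<Rightarrow> real" where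
  "feedback_square q w = (w + Ri *v (transpose B *v q)) \<bullet> (R *v (w + Ri *v (transpose B *v q)))"

definition cost_rate :: "real^'n \<Rightarrow> real^'n \<Rightarrow> real^'n \<Rightarrow> real^'n \<Rightarrow> real^'r \<Rightarrow> real^'r \<Rightarrow> real" where
  "cost_rate a c b d w \<mu> = (a - \<Gamma> *v c) \<bullet> (Q *v (b - \<Gamma> *v d - 2 *\<^sub>R \<eta>)) + w \<bullet> (R *v \<mu>)"

text \<open>With c as the average of the a, and up to the discount factor, this is the derivative of
  the inner product of \<open>b\<close> with \<gamma> plus twice the discounted inner product of
  \<open>a\<close> with \<open>s\<close>, the noise left out. The first line differentiates
  \<open>b\<close>, the next two differentiate \<gamma>, the last one the term in \<open>s\<close>.
  The forcing is doubled because \<open>b\<close> is a sum of two states.\<close>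

definition adjoint_rate :: "real^'n \<Rightarrow> real^'n \<Rightarrow> real^'n \<Rightarrow> real^'n \<Rightarrow> real^'r \<Rightarrow> real^'r \<Rightarrow> real^'r \<Rightarrow> real" where
  "adjoint_rate a c b d w wm \<mu> =
    (A *v b + B *v \<mu> + G *v d + 2 *\<^sub>R f) \<bullet> (P *v a + K *v c)
    + b \<bullet> (- \<rho> *\<^sub>R (P *v a + K *v c) + Pd *v a + P *v (A *v a + B *v w + G *v c)
        + Kd *v c + K *v ((A + G) *v c + B *v wm))
    + 2 * (- \<rho> * (a \<bullet> s) + (A *v a + B *v w + G *v c) \<bullet> s + a \<bullet> sd)"

text \<open>The action of \<open>B ** Ri ** transpose B\<close>, the matrix in all quadratic terms
  of the Riccati equations. As a single symbol it stays intact while products are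
  rearranged.\<close>

definition gain :: "real^'n \<Rightarrow> real^'n" where
  "gain x = B *v (Ri *v (transpose B *v x))"

lemma gain_add: "gain (x + y) = gain x + gain y" and gain_scaleR: "gain (r *\<^sub>R x) = r *\<^sub>R gain x"
  by (simp_all add: gain_def matrix_vector_simps)

lemma Pd_vec: "Pd *v x = \<rho> *\<^sub>R (P *v x) - transpose A *v (P *v x) - P *v (A *v x) - Q *v x + P *v gain (P *v x)"
  unfolding Pd by (simp add: gain_def matrix_vector_simps)

lemma Kd_vec: "Kd *v x = \<rho> *\<^sub>R (K *v x) - transpose A *v (K *v x) - transpose G *v (K *v x)
    - K *v (A *v x) - K *v (G *v x) - transpose G *v (P *v x) - P *v (G *v x)
    + P *v gain (K *v x) + K *v gain (P *v x) + K *v gain (K *v x)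
    + transpose \<Gamma> *v (Q *v x) + Q *v (\<Gamma> *v x) - transpose \<Gamma> *v (Q *v (\<Gamma> *v x))"
  unfolding Kd Xi_matrix_def by (simp add: gain_def matrix_vector_simps transpose_add)

text \<open>All matrices are moved onto the test vector, so that \<open>s\<close>, \<open>f\<close>
  and \<open>\<eta>\<close> stand alone in the inner products and their coefficients can be
  compared.\<close>

lemma sd_inner: "x \<bullet> sd = s \<bullet> (\<rho> *\<^sub>R x - A *v x - G *v x + gain (P *v x) + gain (K *v x))
    - f \<bullet> (P *v x + K *v x) + \<eta> \<bullet> (Q *v x - Q *v (\<Gamma> *v x))"
proof -
  have "x \<bullet> (transpose X *v y) = y \<bullet> (X *v x)" for X :: "real^'n^'n" and y
    by (metis matrix_inner_transpose inner_commute)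
  moreover have "x \<bullet> (P *v y) = y \<bullet> (P *v x)" "x \<bullet> (K *v y) = y \<bullet> (K *v x)" "x \<bullet> (Q *v y) = y \<bullet> (Q *v x)" for x y
    by (metis matrix_inner_transpose inner_commute P K Q)+
  moreover have "(Q *v y) \<bullet> z = y \<bullet> (Q *v z)" for y z
    by (metis matrix_inner_transpose Q)
  ultimately show ?thesis
    unfolding sd by (simp add: gain_def inner_simps matrix_vector_simps algebra_simps inner_commute[of x s])
qed

text \<open>Here only symmetry and the form of \<open>\<mu>\<close> enter; \<open>Pd\<close>,
  \<open>Kd\<close> and \<open>sd\<close> are still arbitrary symbols. The right-hand side is sorted
  by the factors \<open>b\<close>, \<open>d\<close> and the inhomogeneous data, so that the
  equations of \<open>P\<close>, \<open>K\<close> and \<open>s\<close> can then be applied to one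
  bracket each. The form of \<open>\<mu>\<close>, the sum of the two controls, says that the first
  control is the feedback: the sum is \<open>w\<close> plus twice the first control, and
  \<open>b - a\<close> is twice the first state.\<close>

lemma square_completion_bilinear:
  fixes a b c d :: "real^'n" and w wm :: "real^'r"
  defines "q \<equiv> P *v a + K *v c" and "k \<equiv> Q *v (a - \<Gamma> *v c)"
  defines "\<mu> \<equiv> w - Ri *v (transpose B *v (P *v (b - a) + K *v (d - c) + 2 *\<^sub>R s))"
  shows "cost_rate a c b d w \<mu> + adjoint_rate a c b d w wm \<mu> = feedback_square q w
    + b \<bullet> (k + transpose A *v q - \<rho> *\<^sub>R q + Pd *v a + P *v (A *v a + G *v c) + Kd *v c
        + K *v ((A + G) *v c + B *v wm) - P *v gain q)
    + d \<bullet> (transpose G *v q - transpose \<Gamma> *v k - K *v (B *v w) - K *v gain q)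
    + 2 * (s \<bullet> (A *v a + G *v c - \<rho> *\<^sub>R a - gain q) + f \<bullet> q - \<eta> \<bullet> k + a \<bullet> sd)"
proof -
  define p where "p = P *v b + K *v d + 2 *\<^sub>R s"
  have \<mu>: "\<mu> = w - Ri *v (transpose B *v (p - q))"
    by (simp add: \<mu>_def p_def q_def matrix_vector_simps algebra_simps)
  have RI: "x \<bullet> (R *v (Ri *v y)) = x \<bullet> y" for x y by (simp add: RRi_vec)
  have RI': "(Ri *v y) \<bullet> (R *v x) = y \<bullet> x" for x y
    by (metis matrix_inner_transpose Ri R RRi_vec inner_commute)
  have BT: "x \<bullet> (y v* B) = y \<bullet> (B *v x)" for x y
    by (metis dot_lmul_matrix inner_commute)
  have gs: "gain x \<bullet> y = x \<bullet> gain y" for x y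
    unfolding gain_def by (metis matrix_inner_transpose Ri transpose_transpose)
  have T1: "(a - \<Gamma> *v c) \<bullet> (Q *v (b - \<Gamma> *v d - 2 *\<^sub>R \<eta>)) = b \<bullet> k - d \<bullet> (transpose \<Gamma> *v k) - 2 * (\<eta> \<bullet> k)"
  proof -
    have "(a - \<Gamma> *v c) \<bullet> (Q *v (b - \<Gamma> *v d - 2 *\<^sub>R \<eta>)) = (b - \<Gamma> *v d - 2 *\<^sub>R \<eta>) \<bullet> k"
      unfolding k_def by (metis matrix_inner_transpose Q inner_commute)
    then show ?thesis by (simp add: inner_diff_left matrix_inner_transpose)
  qed
  have T2: "w \<bullet> (R *v \<mu>) = w \<bullet> (R *v w) - p \<bullet> (B *v w) + q \<bullet> (B *v w)"
    unfolding \<mu> by (simp add: matrix_vector_mult_diff_distrib RRi_vec inner_diff_right BT)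
  have T3: "(A *v b + B *v \<mu> + G *v d + 2 *\<^sub>R f) \<bullet> q = b \<bullet> (transpose A *v q) + d \<bullet> (transpose G *v q)
      + 2 * (f \<bullet> q) + q \<bullet> (B *v w) - p \<bullet> gain q + q \<bullet> gain q"
  proof -
    have "B *v \<mu> = B *v w - gain p + gain q"
      unfolding \<mu> gain_def by (simp add: matrix_vector_simps)
    then show ?thesis
      by (simp add: inner_add_left inner_diff_left gs matrix_inner_transpose[of A] matrix_inner_transpose[of G] inner_commute[of "B *v w"])
  qed
  have T4: "feedback_square q w = w \<bullet> (R *v w) + 2 * (q \<bullet> (B *v w)) + q \<bullet> gain q"
  proof -
    have "(Ri *v (transpose B *v q)) \<bullet> (transpose B *v q) = q \<bullet> gain q"
      unfolding gain_def by (simp add: BT)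
    then show ?thesis
      unfolding feedback_square_def
      by (simp add: matrix_vector_right_distrib inner_add_left inner_add_right RI RI' RRi_vec BT
          inner_commute[of "q v* B"])
  qed
  have T5: "p \<bullet> x = b \<bullet> (P *v x) + d \<bullet> (K *v x) + 2 * (s \<bullet> x)" for x
    unfolding p_def by (simp add: inner_add_left matrix_inner_transpose P K)
  show ?thesis
    unfolding cost_rate_def adjoint_rate_def T1 T2 q_def[symmetric] T3 T4 T5
    by (simp add: inner_add_right inner_diff_right matrix_vector_right_distrib inner_commute[of _ s] algebra_simps)
qed

text \<open>
  The Riccati equations make the right-hand side a square up to terms that are linear in the
  deviations of one agent from the averages \<open>c\<close>, \<open>d\<close>, \<open>wm\<close>; those vanish after summation over the agents.
\<close>

lemma square_completion_agent:
  fixes a b c d :: "real^'n" and w wm :: "real^'r"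
  defines "\<mu> \<equiv> w - Ri *v (transpose B *v (P *v (b - a) + K *v (d - c) + 2 *\<^sub>R s))"
  shows "cost_rate a c b d w \<mu> + adjoint_rate a c b d w wm \<mu> = feedback_square (P *v a + K *v c) w
    + (b - d) \<bullet> (transpose A *v (K *v c) - \<rho> *\<^sub>R (K *v c) + P *v (G *v c) + Kd *v c
        + K *v ((A + G) *v c + B *v wm) - P *v gain (K *v c) - Q *v (\<Gamma> *v c))
    + d \<bullet> (transpose G *v (P *v (a - c)) - transpose \<Gamma> *v (Q *v (a - c)) - K *v gain (P *v (a - c)))
    - d \<bullet> (K *v (B *v (w - wm)))
    + 2 * (s \<bullet> (gain (K *v (a - c)) - G *v (a - c)) - f \<bullet> (K *v (a - c)) - \<eta> \<bullet> (Q *v (\<Gamma> *v (a - c))))"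
proof -
  let ?q = "P *v a + K *v c" and ?k = "Q *v (a - \<Gamma> *v c)"
  let ?Y = "transpose A *v (K *v c) - \<rho> *\<^sub>R (K *v c) + P *v (G *v c) + Kd *v c
        + K *v ((A + G) *v c + B *v wm) - P *v gain (K *v c) - Q *v (\<Gamma> *v c)"
  let ?Z = "transpose G *v (P *v (a - c)) - transpose \<Gamma> *v (Q *v (a - c)) - K *v gain (P *v (a - c))"
  have gd: "gain (x - y) = gain x - gain y" for x y
    by (simp add: gain_def matrix_vector_simps)
  \<comment> \<open>One equation for each of the three brackets: that of \<open>P\<close> clears
    \<open>a\<close> from the coefficient of \<open>b\<close>, that of \<open>K\<close> turns the
    coefficient of \<open>d\<close> into \<open>- ?Y\<close> up to deviations from the averages,
    that of \<open>s\<close> leaves only deviations among the inhomogeneous terms. The two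
    occurrences of \<open>?Y\<close> then share the factor \<open>b - d\<close>.\<close>
  have 1: "?k + transpose A *v ?q - \<rho> *\<^sub>R ?q + Pd *v a + P *v (A *v a + G *v c) + Kd *v c
        + K *v ((A + G) *v c + B *v wm) - P *v gain ?q = ?Y"
    unfolding Pd_vec by (simp add: gain_add matrix_vector_simps algebra_simps)
  have 2: "transpose G *v ?q - transpose \<Gamma> *v ?k - K *v (B *v w) - K *v gain ?q = ?Z - K *v (B *v (w - wm)) - ?Y"
    unfolding Kd_vec by (simp add: gain_add gd matrix_vector_simps algebra_simps)
  have 3: "s \<bullet> (A *v a + G *v c - \<rho> *\<^sub>R a - gain ?q) + f \<bullet> ?q - \<eta> \<bullet> ?k + a \<bullet> sd =
      s \<bullet> (gain (K *v (a - c)) - G *v (a - c)) - f \<bullet> (K *v (a - c)) - \<eta> \<bullet> (Q *v (\<Gamma> *v (a - c)))"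
    unfolding sd_inner by (simp add: gain_add gd matrix_vector_simps inner_simps algebra_simps)
  show ?thesis
    unfolding \<mu>_def square_completion_bilinear 1 2 3
    by (simp add: inner_diff_left inner_diff_right algebra_simps)
qed

lemma square_completion_sum:
  fixes a b :: "'i \<Rightarrow> real^'n" and w :: "'i \<Rightarrow> real^'r"
  assumes c: "(\<Sum>i\<in>I. a i) = real (card I) *\<^sub>R c" and d: "(\<Sum>i\<in>I. b i) = real (card I) *\<^sub>R d"
    and wm: "(\<Sum>i\<in>I. w i) = real (card I) *\<^sub>R wm"
    and \<mu>: "\<And>i. i \<in> I \<Longrightarrow> \<mu> i = w i - Ri *v (transpose B *v (P *v (b i - a i) + K *v (d - c) + 2 *\<^sub>R s))"
  shows "(\<Sum>i\<in>I. cost_rate (a i) c (b i) d (w i) (\<mu> i) + adjoint_rate (a i) c (b i) d (w i) wm (\<mu> i))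
    = (\<Sum>i\<in>I. feedback_square (P *v a i + K *v c) (w i))"
proof -
  have z: "(\<Sum>i\<in>I. a i - c) = 0" "(\<Sum>i\<in>I. b i - d) = 0" "(\<Sum>i\<in>I. w i - wm) = 0"
    using c d wm by (simp_all add: sum_subtractf sum_constant_scaleR del: sum_constant)
  have lin: "(\<Sum>i\<in>I. L (a i - c)) = 0" if "linear L" for L :: "real^'n \<Rightarrow> real"
    using linear_sum[OF that, of "\<lambda>i. a i - c" I] linear_0[OF that] z by simp
  have lin2: "(\<Sum>i\<in>I. L (w i - wm)) = 0" if "linear L" for L :: "real^'r \<Rightarrow> real"
    using linear_sum[OF that, of "\<lambda>i. w i - wm" I] linear_0[OF that] z by simp
  let ?Y = "transpose A *v (K *v c) - \<rho> *\<^sub>R (K *v c) + P *v (G *v c) + Kd *v c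
        + K *v ((A + G) *v c + B *v wm) - P *v gain (K *v c) - Q *v (\<Gamma> *v c)"
  let ?L1 = "\<lambda>x. d \<bullet> (transpose G *v (P *v x) - transpose \<Gamma> *v (Q *v x) - K *v gain (P *v x))"
  let ?L2 = "\<lambda>x. d \<bullet> (K *v (B *v x))"
  let ?L3 = "\<lambda>x. 2 * (s \<bullet> (gain (K *v x) - G *v x) - f \<bullet> (K *v x) - \<eta> \<bullet> (Q *v (\<Gamma> *v x)))"
  have L: "linear ?L1" "linear ?L3"
    by (auto intro!: linearI simp: gain_def matrix_vector_simps inner_simps algebra_simps
        simp del: transpose_matrix_vector)
  have L2: "linear ?L2"
    by (auto intro!: linearI simp: matrix_vector_simps inner_simps)
  have "(\<Sum>i\<in>I. cost_rate (a i) c (b i) d (w i) (\<mu> i) + adjoint_rate (a i) c (b i) d (w i) wm (\<mu> i))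
    = (\<Sum>i\<in>I. feedback_square (P *v a i + K *v c) (w i) + (b i - d) \<bullet> ?Y + ?L1 (a i - c) - ?L2 (w i - wm) + ?L3 (a i - c))"
    by (intro sum.cong refl) (simp only: \<mu> square_completion_agent)
  also have "\<dots> = (\<Sum>i\<in>I. feedback_square (P *v a i + K *v c) (w i)) + (\<Sum>i\<in>I. (b i - d) \<bullet> ?Y)
      + (\<Sum>i\<in>I. ?L1 (a i - c)) - (\<Sum>i\<in>I. ?L2 (w i - wm)) + (\<Sum>i\<in>I. ?L3 (a i - c))"
    by (simp only: sum.distrib sum_subtractf)
  also have "(\<Sum>i\<in>I. (b i - d) \<bullet> ?Y) = 0"
    by (simp only: inner_sum_left[symmetric] z inner_zero_left)
  finally show ?thesis
    by (simp only: lin[OF L(1)] lin[OF L(2)] lin2[OF L2] add_0_right diff_zero)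
qed

lemma feedback_square_nonneg:
  assumes "positive_definite R"
  shows "0 \<le> feedback_square q w"
  using assms unfolding feedback_square_def positive_definite_def
  by (metis inner_zero_left less_imp_le order_refl)

end

lemma agents_sum:
  assumes "N \<ge> 1"
  shows "(\<Sum>i\<in>{1..N}. x i) = real (card {1..N}) *\<^sub>R ((1 / real N) *\<^sub>R (\<Sum>i\<in>{1..N}. x i :: 'a::real_vector))"
  using assms by simp

lemma abs_cont_cong:
  assumes "abs_cont T g g'" "\<And>t. g t = k t" "\<And>t. g' t = k' t"
  shows "abs_cont T k k'"
proof -
  have "g = k" "g' = k'" using assms(2,3) by auto
  then show ?thesis using assms(1) by simp
qed

locale riccati_path =
  fixes N :: nat and T \<rho> :: real and A G \<Gamma> Q :: "real^'n^'n" and B :: "real^'r^'n" and R :: "real^'r^'r"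
    and f \<eta> s :: "real \<Rightarrow> real^'n" and P K :: "real \<Rightarrow> real^'n^'n"
  assumes T_pos: "0 < T" and N_pos: "1 \<le> N"
    and Q_sym: "transpose Q = Q" and R_sym: "transpose R = R" and R_pos: "positive_definite R"
    and f_cont: "continuous_on {0..T} f" and eta_cont: "continuous_on {0..T} \<eta>"
    and P_sol: "solves_P T \<rho> A B Q R P" and K_sol: "solves_K T \<rho> A B G \<Gamma> Q R P K"
    and s_sol: "solves_s T \<rho> A B G \<Gamma> Q R f \<eta> P K s"
begin

abbreviation "Ri \<equiv> matrix_inv R"

definition "Pd t = \<rho> *\<^sub>R P t - transpose A ** P t - P t ** A - Q + P t ** (B ** Ri ** transpose B) ** P t"

definition "Kd t = \<rho> *\<^sub>R K t - transpose (A + G) ** K t - K t ** (A + G) - transpose G ** P t - P t ** G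
      + (P t + K t) ** (B ** Ri ** transpose B) ** (P t + K t) - P t ** (B ** Ri ** transpose B) ** P t
      + Xi_matrix \<Gamma> Q"

definition "sd t = \<rho> *\<^sub>R s t - transpose (A + G - B ** Ri ** transpose B ** (P t + K t)) *v s t
      - (P t + K t) *v f t + (Q *v \<eta> t - (transpose \<Gamma> ** Q) *v \<eta> t)"

lemma P_der: "t \<in> {0..T} \<Longrightarrow> (P has_vector_derivative Pd t) (at t within {0..T})"
  unfolding Pd_def by (rule solves_P_derivative[OF P_sol])

lemma K_der: "t \<in> {0..T} \<Longrightarrow> (K has_vector_derivative Kd t) (at t within {0..T})"
  unfolding Kd_def by (rule solves_K_derivative[OF K_sol])

lemma s_der: "t \<in> {0..T} \<Longrightarrow> (s has_vector_derivative sd t) (at t within {0..T})"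
  unfolding sd_def using solves_s_derivative[OF s_sol] by (simp only: eta_bar_def)

lemma P_cont: "continuous_on {0..T} P" and K_cont: "continuous_on {0..T} K" and s_cont: "continuous_on {0..T} s"
  by (rule has_vector_derivative_imp_continuous_on, erule P_der K_der s_der)+

lemma Pd_cont: "continuous_on {0..T} Pd" and Kd_cont: "continuous_on {0..T} Kd" and sd_cont: "continuous_on {0..T} sd"
  unfolding Pd_def[abs_def] Kd_def[abs_def] sd_def[abs_def]
  by (intro continuous_intros P_cont K_cont s_cont f_cont eta_cont
      bounded_linear.continuous_on[OF bounded_linear_transpose])+

lemma terminal: "P T = 0" "K T = 0" "s T = 0"
  using P_sol K_sol s_sol by (auto simp: solves_P_def solves_K_def solves_s_def)

lemma Ri_props: "R ** Ri = mat 1" "transpose Ri = Ri"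
  using positive_definite_invertible[OF R_pos] transpose_matrix_inv[OF R_sym] by auto

lemma riccati_data_at:
  assumes t: "t \<in> {0..T}"
  shows "riccati_data A G \<Gamma> Q (P t) (K t) (Pd t) (Kd t) B R Ri (f t) (\<eta> t) (s t) (sd t) \<rho>"
proof
  have Psym: "transpose (P t) = P t" if "t \<in> {0..T}" for t
    by (rule solves_P_symmetric[OF P_sol Q_sym Ri_props(2) that])
  show "transpose (P t) = P t" by (rule Psym[OF t])
  show "transpose (K t) = K t"
    by (rule solves_K_symmetric[OF K_sol Q_sym Psym P_cont Ri_props(2) t])
qed (fact Q_sym R_sym Ri_props Pd_def Kd_def sd_def)+

abbreviation mean :: "(nat \<Rightarrow> 'a::real_vector) \<Rightarrow> 'a" where
  "mean a \<equiv> (1 / real N) *\<^sub>R (\<Sum>i\<in>{1..N}. a i)"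

text \<open>The derivative of \<gamma> as a function of the current differences of states and
  controls. It uses nothing beyond their values at time \<open>t\<close>, which makes the resulting
  process adapted.\<close>

definition costate_rate :: "(nat \<Rightarrow> real^'n) \<Rightarrow> (nat \<Rightarrow> real^'r) \<Rightarrow> nat \<Rightarrow> real \<Rightarrow> real^'n" where
  "costate_rate h w i t = exp (- \<rho> * t) *\<^sub>R (- \<rho> *\<^sub>R (P t *v h i + K t *v mean h) + Pd t *v h i
    + P t *v (A *v h i + B *v w i + G *v mean h) + Kd t *v mean h
    + K t *v ((A + G) *v mean h + B *v mean w))"

text \<open>The discounted difference of the total running costs, with each difference of squares
  factored into a difference against a sum. The sum of the two tracking errors contains
  \<open>\<eta>\<close> twice.\<close>

definition cost_gap :: "(nat \<Rightarrow> real^'n) \<Rightarrow> (nat \<Rightarrow> real^'n) \<Rightarrow> (nat \<Rightarrow> real^'r) \<Rightarrow> (nat \<Rightarrow> real^'r) \<Rightarrow> real \<Rightarrow> real" where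
  "cost_gap h z w \<mu> t = exp (- \<rho> * t) * (\<Sum>i\<in>{1..N}.
    (h i - \<Gamma> *v mean h) \<bullet> (Q *v (z i - \<Gamma> *v mean z - 2 *\<^sub>R \<eta> t)) + w i \<bullet> (R *v \<mu> i))"

lemma mean_diff: "mean (\<lambda>i. a i - b i) = mean a - mean (b :: nat \<Rightarrow> 'a::real_vector)"
  by (simp add: sum_subtractf scaleR_diff_right)

lemma mean_add: "mean (\<lambda>i. a i + b i) = mean a + mean (b :: nat \<Rightarrow> 'a::real_vector)"
  by (simp add: sum.distrib scaleR_add_right)

lemma mean_matrix: "mean (\<lambda>i. X *v a i) = X *v mean (a :: nat \<Rightarrow> real^'k)"
  by (simp add: matrix_vector_mult_scaleR bounded_bilinear.sum_right[OF bounded_bilinear_matrix_vector_mult])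

lemma mean_const: "mean (\<lambda>i. c :: 'a::real_vector) = c"
  using N_pos by (simp add: sum_constant_scaleR del: sum_constant)

section \<open>Comparison of two control profiles along a single sample path\<close>

context
  fixes x y I :: "nat \<Rightarrow> real \<Rightarrow> real^'n" and u v :: "nat \<Rightarrow> real \<Rightarrow> real^'r"
  assumes X: "\<And>i. i \<in> {1..N} \<Longrightarrow> abs_cont T (\<lambda>t. x i t - I i t)
      (\<lambda>t. A *v x i t + B *v u i t + G *v mean (\<lambda>j. x j t) + f t)"
    and Y: "\<And>i. i \<in> {1..N} \<Longrightarrow> abs_cont T (\<lambda>t. y i t - I i t)
      (\<lambda>t. A *v y i t + B *v v i t + G *v mean (\<lambda>j. y j t) + f t)"
    and start: "\<And>i. i \<in> {1..N} \<Longrightarrow> y i 0 = x i 0"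
begin

private abbreviation (input) "h i t \<equiv> y i t - x i t"
private abbreviation (input) "z i t \<equiv> x i t + y i t"
private abbreviation (input) "w i t \<equiv> v i t - u i t"
private abbreviation (input) "\<mu> i t \<equiv> u i t + v i t"

lemma difference_abs_cont:
  assumes i: "i \<in> {1..N}"
  shows "abs_cont T (h i) (\<lambda>t. A *v h i t + B *v w i t + G *v mean (\<lambda>j. h j t))"
proof -
  have "abs_cont T (\<lambda>t. (y i t - I i t) + - (x i t - I i t))
      (\<lambda>t. (A *v y i t + B *v v i t + G *v mean (\<lambda>j. y j t) + f t)
        + - (A *v x i t + B *v u i t + G *v mean (\<lambda>j. x j t) + f t))"
    by (intro abs_cont_add Y[OF i] abs_cont_bounded_linear[OF _ X[OF i]] bounded_linear_minus bounded_linear_ident)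
  then show ?thesis
    unfolding mean_diff by (rule abs_cont_cong) (simp_all add: matrix_vector_mult_diff_distrib algebra_simps)
qed

lemma difference_mean_abs_cont:
  "abs_cont T (\<lambda>t. mean (\<lambda>i. h i t)) (\<lambda>t. (A + G) *v mean (\<lambda>i. h i t) + B *v mean (\<lambda>i. w i t))"
proof -
  have "abs_cont T (\<lambda>t. mean (\<lambda>i. h i t)) (\<lambda>t. mean (\<lambda>i. A *v h i t + B *v w i t + G *v mean (\<lambda>j. h j t)))"
    by (intro abs_cont_bounded_linear[OF bounded_linear_scaleR_right] abs_cont_sum difference_abs_cont)
  also have "(\<lambda>t. mean (\<lambda>i. A *v h i t + B *v w i t + G *v mean (\<lambda>j. h j t))) =
      (\<lambda>t. (A + G) *v mean (\<lambda>i. h i t) + B *v mean (\<lambda>i. w i t))"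
    unfolding mean_add mean_matrix mean_const by (simp only: matrix_vector_mult_add_rdistrib add_ac)
  finally show ?thesis .
qed

lemma discount_abs_cont: "abs_cont T (\<lambda>t. exp (- \<rho> * t)) (\<lambda>t. - \<rho> * exp (- \<rho> * t))"
proof (rule abs_contI)
  fix t
  have "((\<lambda>t. exp (- \<rho> * t)) has_real_derivative - \<rho> * exp (- \<rho> * t)) (at t within {0..T})"
    by (auto intro!: derivative_eq_intros)
  then show "((\<lambda>t. exp (- \<rho> * t)) has_vector_derivative - \<rho> * exp (- \<rho> * t)) (at t within {0..T})"
    by (simp only: has_real_derivative_iff_has_vector_derivative)
qed (intro continuous_intros)

lemma costate_abs_cont:
  assumes i: "i \<in> {1..N}"
  shows "abs_cont T (\<lambda>t. exp (- \<rho> * t) *\<^sub>R (P t *v h i t + K t *v mean (\<lambda>j. h j t)))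
    (\<lambda>t. costate_rate (\<lambda>j. h j t) (\<lambda>j. w j t) i t)"
proof -
  have P: "abs_cont T P Pd" and K: "abs_cont T K Kd"
    using P_der K_der Pd_cont Kd_cont by (auto intro: abs_contI)
  note d = abs_cont_bilinear[OF bounded_bilinear_scaleR discount_abs_cont
      abs_cont_add[OF abs_cont_bilinear[OF bounded_bilinear_matrix_vector_mult P difference_abs_cont[OF i]]
        abs_cont_bilinear[OF bounded_bilinear_matrix_vector_mult K difference_mean_abs_cont]]]
  show ?thesis
    by (rule abs_cont_cong[OF d]) (simp_all add: costate_rate_def algebra_simps)
qed

text \<open>\<gamma> vanishes at 0 because both states start alike, and at \<open>T\<close> because
  \<open>P\<close> and \<open>K\<close> do.\<close>

lemma costate_integral:
  assumes i: "i \<in> {1..N}"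
  shows "(LBINT t:{0..T}. costate_rate (\<lambda>j. h j t) (\<lambda>j. w j t) i t) = 0"
proof -
  have "mean (\<lambda>j. h j 0) = 0" using start by simp
  then have 0: "P 0 *v h i 0 + K 0 *v mean (\<lambda>j. h j 0) = 0"
    by (simp only: start[OF i] diff_self matrix_vector_mult_0_right add_0)
  have T: "P T *v h i T + K T *v mean (\<lambda>j. h j T) = 0"
    by (simp only: terminal matrix_vector_mult_0 add_0)
  show ?thesis
    using abs_cont_eq[OF costate_abs_cont[OF i], of T] T_pos unfolding 0 T by simp
qed

lemma path_gap_nonneg:
  assumes fb: "\<And>t i. t \<in> {0..T} \<Longrightarrow> i \<in> {1..N} \<Longrightarrow>
      u i t = - ((Ri ** transpose B) *v (P t *v x i t + K t *v mean (\<lambda>j. x j t) + s t))"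
    and int: "set_integrable lborel {0..T} (\<lambda>t.
      cost_gap (\<lambda>i. h i t) (\<lambda>i. z i t) (\<lambda>i. w i t) (\<lambda>i. \<mu> i t) t
      + 2 * (\<Sum>i\<in>{1..N}. I i t \<bullet> costate_rate (\<lambda>j. h j t) (\<lambda>j. w j t) i t))"
  shows "0 \<le> (LBINT t:{0..T}. cost_gap (\<lambda>i. h i t) (\<lambda>i. z i t) (\<lambda>i. w i t) (\<lambda>i. \<mu> i t) t
      + 2 * (\<Sum>i\<in>{1..N}. I i t \<bullet> costate_rate (\<lambda>j. h j t) (\<lambda>j. w j t) i t))"
proof -
  let ?D = "\<lambda>t. cost_gap (\<lambda>i. h i t) (\<lambda>i. z i t) (\<lambda>i. w i t) (\<lambda>i. \<mu> i t) t
      + 2 * (\<Sum>i\<in>{1..N}. I i t \<bullet> costate_rate (\<lambda>j. h j t) (\<lambda>j. w j t) i t)"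
  let ?\<gamma> = "\<lambda>i t. exp (- \<rho> * t) *\<^sub>R (P t *v h i t + K t *v mean (\<lambda>j. h j t))"
  let ?h' = "\<lambda>i t. A *v h i t + B *v w i t + G *v mean (\<lambda>j. h j t)"
  let ?z' = "\<lambda>i t. A *v z i t + B *v \<mu> i t + G *v mean (\<lambda>j. z j t) + 2 *\<^sub>R f t"
  let ?c = "\<lambda>i t. costate_rate (\<lambda>j. h j t) (\<lambda>j. w j t) i t"
  let ?\<theta>' = "\<lambda>i t. - \<rho> * exp (- \<rho> * t) * (h i t \<bullet> s t) + exp (- \<rho> * t) * (?h' i t \<bullet> s t + h i t \<bullet> sd t)"
  \<comment> \<open>A function with the same value, zero, at both ends. The noise must be removed
    twice to leave an absolutely continuous factor; the term in \<open>s\<close> is doubled, like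
    \<open>f\<close> and \<open>\<eta>\<close>, because sums of two states are involved.\<close>
  let ?X = "\<lambda>t. \<Sum>i\<in>{1..N}. (z i t - 2 *\<^sub>R I i t) \<bullet> ?\<gamma> i t + 2 * (exp (- \<rho> * t) * (h i t \<bullet> s t))"
  let ?X' = "\<lambda>t. \<Sum>i\<in>{1..N}. (?z' i t \<bullet> ?\<gamma> i t + (z i t - 2 *\<^sub>R I i t) \<bullet> ?c i t) + 2 * ?\<theta>' i t"
  have s: "abs_cont T s sd" using s_der sd_cont by (rule abs_contI)
  have z: "abs_cont T (\<lambda>t. z i t - 2 *\<^sub>R I i t) (?z' i)" if i: "i \<in> {1..N}" for i
    using abs_cont_add[OF X[OF i] Y[OF i]]
    unfolding mean_add
    by (rule abs_cont_cong) (simp_all add: matrix_vector_right_distrib algebra_simps scaleR_2)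
  have "abs_cont T ?X ?X'"
    by (intro abs_cont_sum abs_cont_add abs_cont_bilinear[OF bounded_bilinear_inner z costate_abs_cont]
        abs_cont_bounded_linear[OF bounded_linear_mult_right]
        abs_cont_bilinear[OF bounded_bilinear_mult discount_abs_cont
          abs_cont_bilinear[OF bounded_bilinear_inner difference_abs_cont s]])
  note Xac = this
  have "mean (\<lambda>j. h j 0) = 0" using start by simp
  then have X0: "?X 0 = 0"
    by (intro sum.neutral ballI) (simp only: start diff_self matrix_vector_mult_0_right add_0 scaleR_zero_right
        inner_zero_right inner_zero_left mult_zero_right)
  have XT: "?X T = 0"
    by (intro sum.neutral ballI) (simp only: terminal matrix_vector_mult_0 add_0 scaleR_zero_right
        inner_zero_right inner_zero_left mult_zero_right)
  have X'int: "(LBINT t:{0..T}. ?X' t) = 0"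
    using abs_cont_eq[OF Xac, of T] T_pos unfolding X0 XT by simp
  \<comment> \<open>Adding the derivative of \<open>?X\<close>, whose integral is zero, turns the
    integrand into a discounted sum of squares at each single time.\<close>
  have key: "?D t + ?X' t = exp (- \<rho> * t) * (\<Sum>i\<in>{1..N}.
      riccati_data.feedback_square B R Ri (P t *v h i t + K t *v mean (\<lambda>j. h j t)) (w i t))"
    if t: "t \<in> {0..T}" for t
  proof -
    interpret riccati_data A G \<Gamma> Q "P t" "K t" "Pd t" "Kd t" B R Ri "f t" "\<eta> t" "s t" "sd t" \<rho>
      by (rule riccati_data_at[OF t])
    \<comment> \<open>The sum of the controls is \<open>w\<close> plus twice \<open>u\<close>, and
      \<open>z - h\<close> is twice \<open>x\<close>; so the feedback law for \<open>u\<close> takes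
      the form that the algebraic identity expects.\<close>
    have \<mu>: "\<mu> i t = w i t - Ri *v (transpose B *v (P t *v (z i t - h i t)
        + K t *v (mean (\<lambda>j. z j t) - mean (\<lambda>j. h j t)) + 2 *\<^sub>R s t))" if i: "i \<in> {1..N}" for i
    proof -
      have 1: "z i t - h i t = 2 *\<^sub>R x i t" by (simp add: scaleR_2)
      have 2: "mean (\<lambda>j. z j t) - mean (\<lambda>j. h j t) = 2 *\<^sub>R mean (\<lambda>j. x j t)"
      proof -
        have "(p + q) - (q - p) = 2 *\<^sub>R p" for p q :: "real^'n" by (simp add: scaleR_2)
        then show ?thesis unfolding mean_add mean_diff .
      qed
      have "\<mu> i t = w i t + 2 *\<^sub>R u i t" by (simp add: scaleR_2)
      also have "\<dots> = w i t - Ri *v (transpose B *v (P t *v (2 *\<^sub>R x i t)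
        + K t *v (2 *\<^sub>R mean (\<lambda>j. x j t)) + 2 *\<^sub>R s t))"
      proof -
        have "a + 2 *\<^sub>R - ((Ri ** transpose B) *v (P t *v p + K t *v m + s t))
            = a - Ri *v (transpose B *v (P t *v (2 *\<^sub>R p) + K t *v (2 *\<^sub>R m) + 2 *\<^sub>R s t))" for a p m
          by (simp add: matrix_vector_simps algebra_simps del: transpose_matrix_vector)
        then show ?thesis unfolding fb[OF t i] .
      qed
      finally show ?thesis unfolding 1 2 .
    qed
    let ?cr = "\<lambda>i. cost_rate (h i t) (mean (\<lambda>j. h j t)) (z i t) (mean (\<lambda>j. z j t)) (w i t) (\<mu> i t)"
    let ?ar = "\<lambda>i. adjoint_rate (h i t) (mean (\<lambda>j. h j t)) (z i t) (mean (\<lambda>j. z j t)) (w i t) (mean (\<lambda>j. w j t)) (\<mu> i t)"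
    let ?X'i = "\<lambda>i. (?z' i t \<bullet> ?\<gamma> i t + (z i t - 2 *\<^sub>R I i t) \<bullet> ?c i t) + 2 * ?\<theta>' i t"
    \<comment> \<open>\<open>adjoint_rate\<close> pairs the derivative of \<gamma> with
      \<open>z\<close>, while \<open>?X'\<close> pairs it with \<open>z\<close> minus twice the
      noise. The discrepancy is exactly the noise term of \<open>?D\<close>.\<close>
    have ar: "exp (- \<rho> * t) * ?ar i = 2 * (I i t \<bullet> ?c i t) + ?X'i i" for i
      unfolding adjoint_rate_def costate_rate_def
      by (simp add: inner_diff_left algebra_simps)
    have "(\<Sum>i\<in>{1..N}. feedback_square (P t *v h i t + K t *v mean (\<lambda>j. h j t)) (w i t)) = (\<Sum>i\<in>{1..N}. ?cr i + ?ar i)"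
      by (rule square_completion_sum[OF agents_sum[OF N_pos] agents_sum[OF N_pos] agents_sum[OF N_pos] \<mu>, symmetric])
    then have "exp (- \<rho> * t) * (\<Sum>i\<in>{1..N}. feedback_square (P t *v h i t + K t *v mean (\<lambda>j. h j t)) (w i t))
        = exp (- \<rho> * t) * (\<Sum>i\<in>{1..N}. ?cr i) + (\<Sum>i\<in>{1..N}. exp (- \<rho> * t) * ?ar i)"
      by (simp only: sum.distrib distrib_left sum_distrib_left)
    also have "(\<Sum>i\<in>{1..N}. exp (- \<rho> * t) * ?ar i) = 2 * (\<Sum>i\<in>{1..N}. I i t \<bullet> ?c i t) + (\<Sum>i\<in>{1..N}. ?X'i i)"
      by (simp only: ar sum.distrib[of "\<lambda>i. 2 * (I i t \<bullet> ?c i t)" ?X'i] sum_distrib_left)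
    finally show ?thesis
      unfolding cost_gap_def cost_rate_def by (simp only: add.assoc)
  qed
  have "0 \<le> (LBINT t:{0..T}. ?D t + ?X' t)"
    unfolding set_lebesgue_integral_def
  proof (rule Bochner_Integration.integral_nonneg)
    fix t
    show "0 \<le> indicator {0..T} t *\<^sub>R (?D t + ?X' t)"
    proof (cases "t \<in> {0..T}")
      case True
      interpret riccati_data A G \<Gamma> Q "P t" "K t" "Pd t" "Kd t" B R Ri "f t" "\<eta> t" "s t" "sd t" \<rho>
        by (rule riccati_data_at[OF True])
      show ?thesis
        unfolding key[OF True] using True
        by (auto intro!: mult_nonneg_nonneg sum_nonneg feedback_square_nonneg R_pos)
    qed simp
  qed
  also have "\<dots> = (LBINT t:{0..T}. ?D t)"
    using set_integral_add(2)[OF int abs_cont_set_integrable[OF Xac]] X'int by simp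
  finally show ?thesis .
qed

end

end

section \<open>The closed loop and its optimality\<close>

lemma set_lebesgue_integral_singleton: "(LBINT \<tau>:{a..a::real}. g \<tau>) = (0 :: 'a::euclidean_space)"
  unfolding set_lebesgue_integral_def
  by (rule integral_eq_zero_AE) (use AE_lborel_singleton[of a] in \<open>auto elim!: eventually_mono\<close>)

text \<open>Nothing is required of \<open>g\<close>: if it is not integrable, its integral is 0.
  This is essential in \<open>state_L2\<close>, where the integrand contains a control whose
  integrability is not yet known.\<close>

lemma norm_set_integral_le:
  fixes g :: "real \<Rightarrow> 'a::euclidean_space" and k :: "real \<Rightarrow> real"
  assumes "set_integrable lborel S k" "\<And>t. t \<in> S \<Longrightarrow> norm (g t) \<le> k t"
  shows "norm (LBINT t:S. g t) \<le> (LBINT t:S. k t)"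
proof -
  have "norm (LBINT t:S. g t) \<le> (LBINT t. norm (indicator S t *\<^sub>R g t))"
    unfolding set_lebesgue_integral_def by (rule integral_norm_bound)
  also have "\<dots> \<le> (LBINT t:S. k t)"
    unfolding set_lebesgue_integral_def
  proof (rule integral_mono')
    show "integrable lborel (\<lambda>t. indicator S t *\<^sub>R k t)" using assms(1) by (simp add: set_integrable_def)
    fix t
    show "norm (indicator S t *\<^sub>R g t) \<le> indicator S t *\<^sub>R k t" using assms(2) by (cases "t \<in> S") auto
    show "0 \<le> indicator S t *\<^sub>R k t"
      using order_trans[OF norm_ge_zero assms(2)] by (cases "t \<in> S") auto
  qed
  finally show ?thesis .
qed

lemma matrix_norm_bound: "\<exists>k\<ge>0. \<forall>y. norm (X *v y) \<le> k * norm y"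
  for X :: "real^'n^'m"
  using onorm[OF matrix_vector_mul_bounded_linear[of X]] onorm_pos_le[OF matrix_vector_mul_bounded_linear[of X]]
  by blast

lemma integral_eq_LBINT:
  fixes g :: "real \<Rightarrow> 'a::euclidean_space"
  assumes "continuous_on {a..b} g"
  shows "integral {a..b} g = (LBINT t:{a..b}. g t)"
  by (rule set_borel_integral_eq_integral(2)[symmetric]) (rule set_integrable_continuous_interval[OF assms])

lemma gronwall_LBINT:
  fixes y a :: "real \<Rightarrow> real"
  assumes y: "continuous_on {0..T} y" and a: "continuous_on {0..T} a"
    and C: "C \<ge> 0" and a0: "\<And>t. t \<in> {0..T} \<Longrightarrow> a t \<ge> 0"
    and le: "\<And>t. t \<in> {0..T} \<Longrightarrow> y t \<le> a t + C * (LBINT \<tau>:{0..t}. y \<tau>)"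
    and t: "t \<in> {0..T}"
  shows "y t \<le> a t + C * exp (C * T) * (LBINT \<tau>:{0..T}. a \<tau>)"
proof -
  have "y t \<le> a t + C * integral {0..t} y" if "t \<in> {0..T}" for t
  proof -
    have "continuous_on {0..t} y" by (rule continuous_on_subset[OF y]) (use that in auto)
    then show ?thesis using le[OF that] by (simp add: integral_eq_LBINT)
  qed
  from gronwall_integral[OF y a C a0 this t] show ?thesis by (simp add: integral_eq_LBINT[OF a])
qed

context filtered_prob_space
begin

lemma AE_pair_time_le:
  fixes X :: "real \<Rightarrow> 'w \<Rightarrow> 'a::euclidean_space" and Z :: "real \<Rightarrow> 'w \<Rightarrow> real"
  assumes X: "(\<lambda>z. X (fst z) (snd z)) \<in> borel_measurable (pair_time T)"
    and Z: "(\<lambda>z. Z (fst z) (snd z)) \<in> borel_measurable (pair_time T)"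
    and le: "AE \<omega> in M. \<forall>t\<in>{0..T}. norm (X t \<omega>) \<le> Z t \<omega>"
  shows "AE z in pair_time T. norm (X (fst z) (snd z)) \<le> Z (fst z) (snd z)"
proof -
  interpret pair_sigma_finite "time_measure T" M by (rule pair_sigma_finite_time)
  show ?thesis
  proof (rule AE_pair_measure)
    show "{z \<in> space (pair_time T). norm (X (fst z) (snd z)) \<le> Z (fst z) (snd z)} \<in> sets (pair_time T)"
      using X Z by measurable
    show "AE t in time_measure T. AE \<omega> in M. norm (X (fst (t, \<omega>)) (snd (t, \<omega>))) \<le> Z (fst (t, \<omega>)) (snd (t, \<omega>))"
    proof (rule AE_I2)
      fix t assume "t \<in> space (time_measure T)"
      then have t: "t \<in> {0..T}" by (simp add: space_restrict_space)
      show "AE \<omega> in M. norm (X (fst (t, \<omega>)) (snd (t, \<omega>))) \<le> Z (fst (t, \<omega>)) (snd (t, \<omega>))"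
        using le by eventually_elim (use t in simp)
    qed
  qed
qed

lemma square_integrable_norm:
  assumes "square_integrable L X"
  shows "square_integrable L (\<lambda>z. norm (X z))"
  using assms by (auto simp: square_integrable_def)

end

locale social_control = riccati_path N T \<rho> A G \<Gamma> Q B R f \<eta> s P K + filtered_prob_space M F
  for N :: nat and T \<rho> :: real and A G \<Gamma> Q :: "real^'n^'n" and B :: "real^'r^'n" and R :: "real^'r^'r"
    and f \<eta> s :: "real \<Rightarrow> real^'n" and P K :: "real \<Rightarrow> real^'n^'n"
    and M :: "'w measure" and F :: "real \<Rightarrow> 'w measure" +
  fixes W :: "nat \<Rightarrow> real \<Rightarrow> 'w \<Rightarrow> real" and x0 :: "nat \<Rightarrow> 'w \<Rightarrow> real^'n" and \<sigma> :: "real \<Rightarrow> real^'n"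
  assumes brownian: "\<And>i. i \<in> {1..N} \<Longrightarrow> brownian_motion M F (W i)"
    and x0_measurable: "\<And>i t. i \<in> {1..N} \<Longrightarrow> x0 i \<in> borel_measurable (F t)"
    and x0_square: "\<And>i. i \<in> {1..N} \<Longrightarrow> square_integrable M (x0 i)"
    and sigma_cont: "continuous_on {0..T} \<sigma>"
begin

abbreviation "is_state u x \<equiv> state_process M F T N W x0 A B G f \<sigma> u x"

lemma brownian_space: "i \<in> {1..N} \<Longrightarrow> brownian_space M F (W i)"
  by unfold_locales (rule brownian)

lemma noise_exists:
  "\<exists>J. \<forall>i\<in>{1..N}. ito_integral M F T (W i) (\<lambda>t \<omega>. \<sigma> t) (J i) \<and>
    (\<forall>\<omega>\<in>space M. continuous_on {0..T} (\<lambda>t. J i t \<omega>))"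
  by (rule bchoice) (intro ballI brownian_space.wiener_integral_exists[OF brownian_space T_pos sigma_cont])

text \<open>One version per agent, fixed once and for all and continuous at every sample point. Each
  state process comes with its own version of the stochastic integral; by uniqueness it may be
  replaced by this one, so that the noise of two states cancels exactly.\<close>

definition noise :: "nat \<Rightarrow> real \<Rightarrow> 'w \<Rightarrow> real^'n" where
  "noise = (SOME J. \<forall>i\<in>{1..N}. ito_integral M F T (W i) (\<lambda>t \<omega>. \<sigma> t) (J i) \<and>
    (\<forall>\<omega>\<in>space M. continuous_on {0..T} (\<lambda>t. J i t \<omega>)))"

lemma noise:
  assumes i: "i \<in> {1..N}"
  shows "ito_integral M F T (W i) (\<lambda>t \<omega>. \<sigma> t) (noise i)"
    and "\<omega> \<in> space M \<Longrightarrow> continuous_on {0..T} (\<lambda>t. noise i t \<omega>)"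
  using someI_ex[OF noise_exists, folded noise_def] i by blast+

lemma noise_L2: "i \<in> {1..N} \<Longrightarrow> noise i \<in> L2_adapted M F T"
  by (rule brownian_space.ito_integral_square_integrable(2)[OF brownian_space noise(1)])

lemma state_measurable:
  assumes "is_state u x" "i \<in> {1..N}"
  shows "(\<lambda>z. x i (fst z) (snd z)) \<in> borel_measurable (pair_time T)"
    "t \<in> {0..T} \<Longrightarrow> x i t \<in> borel_measurable (F t)"
    "AE \<omega> in M. continuous_on {0..T} (\<lambda>t. x i t \<omega>)"
  using assms by (auto simp: state_process_def adapted_process_def measurable_time_pair case_prod_unfold)

lemma state_equation:
  assumes st: "is_state u x" and i: "i \<in> {1..N}"
  shows "AE \<omega> in M. \<forall>t\<in>{0..T}. x i t \<omega> = x0 i \<omega> +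
     (LBINT \<tau>:{0..t}. A *v x i \<tau> \<omega> + B *v u i \<tau> \<omega> + G *v mean (\<lambda>j. x j \<tau> \<omega>) + f \<tau>) + noise i t \<omega>"
proof -
  obtain I where I: "ito_integral M F T (W i) (\<lambda>t \<omega>. \<sigma> t) I"
    and eq: "AE \<omega> in M. \<forall>t\<in>{0..T}. x i t \<omega> = x0 i \<omega> +
      (LBINT \<tau>:{0..t}. A *v x i \<tau> \<omega> + B *v u i \<tau> \<omega> + G *v agents_mean N x \<tau> \<omega> + f \<tau>) + I t \<omega>"
    using st i unfolding state_process_def by blast
  have "AE \<omega> in M. \<forall>t\<in>{0..T}. I t \<omega> = noise i t \<omega>"
    by (rule brownian_space.ito_integral_unique[OF brownian_space[OF i] T_pos I noise(1)[OF i]])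
  with eq show ?thesis
    unfolding agents_mean_def by eventually_elim simp
qed

lemma AE_agents:
  assumes "\<And>i. i \<in> {1..N} \<Longrightarrow> AE \<omega> in M. Pr i \<omega>"
  shows "AE \<omega> in M. \<forall>i\<in>{1..N}. Pr i \<omega>"
  using assms by (subst AE_ball_countable) auto

lemma norm_mean_le: "norm (mean a) \<le> (\<Sum>i\<in>{1..N}. norm (a i :: 'a::real_normed_vector))"
proof -
  have "norm (mean a) = (1 / real N) * norm (\<Sum>i\<in>{1..N}. a i)" by simp
  also have "\<dots> \<le> 1 * norm (\<Sum>i\<in>{1..N}. a i)"
    using N_pos by (intro mult_right_mono) auto
  also have "\<dots> \<le> (\<Sum>i\<in>{1..N}. norm (a i))" by (simp add: norm_sum)
  finally show ?thesis .
qed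

text \<open>Admissibility of a feedback depends on its state being square integrable, so that
  property cannot be derived from admissibility. The bound on \<open>u\<close> avoids the circle: it
  covers an admissible profile with \<open>c = 0\<close> and \<open>v = u\<close>, and a feedback
  with \<open>v\<close> its deterministic part. The sum of the norms of all states satisfies a
  Gronwall inequality along almost every path, with square integrable data.\<close>

lemma state_L2:
  fixes v :: "nat \<Rightarrow> real \<Rightarrow> 'w \<Rightarrow> 'b::euclidean_space"
  assumes st: "is_state u x" and v: "\<And>i. i \<in> {1..N} \<Longrightarrow> v i \<in> L2_adapted M F T" and c: "0 \<le> c"
    and bound: "AE \<omega> in M. \<forall>t\<in>{0..T}. \<forall>i\<in>{1..N}.
      norm (u i t \<omega>) \<le> c * (\<Sum>j\<in>{1..N}. norm (x j t \<omega>)) + norm (v i t \<omega>)"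
    and i: "i \<in> {1..N}"
  shows "x i \<in> L2_adapted M F T"
proof -
  obtain kA where kA: "kA \<ge> 0" "\<And>y. norm (A *v y) \<le> kA * norm y" using matrix_norm_bound by blast
  obtain kB where kB: "kB \<ge> 0" "\<And>y. norm (B *v y) \<le> kB * norm y" using matrix_norm_bound by blast
  obtain kG where kG: "kG \<ge> 0" "\<And>y. norm (G *v y) \<le> kG * norm y" using matrix_norm_bound by blast
  define C0 where "C0 = kA + kB * c + kG"
  have C0: "C0 \<ge> 0" using kA kB kG c by (simp add: C0_def)
  define g where "g = (\<lambda>i t \<omega>. kB * norm (v i t \<omega>) + norm (f t))"
  define V where "V = (\<lambda>i \<omega>. LBINT t:{0..T}. g i t \<omega>)"
  define a where "a = (\<lambda>t \<omega>. \<Sum>i\<in>{1..N}. norm (x0 i \<omega>) + norm (noise i t \<omega>) + V i \<omega>)"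
  \<comment> \<open>The estimate for one agent involves the sum of the norms over all agents; adding
    these estimates up produces the factor \<open>N\<close>.\<close>
  define C where "C = real N * C0"
  have C: "C \<ge> 0" using C0 by (simp add: C_def)
  have fL2: "(\<lambda>t \<omega>. f t) \<in> L2_adapted M F T" by (rule L2_adapted_deterministic[OF f_cont])
  have gsq: "square_integrable (pair_time T) (\<lambda>z. g i (fst z) (snd z))" if "i \<in> {1..N}" for i
    unfolding g_def
    using square_integrable_add[OF square_integrable_scaleR[OF square_integrable_norm[OF L2_adaptedD(1)[OF v[OF that]]], of kB]
        square_integrable_norm[OF L2_adaptedD(1)[OF fL2]]]
    by simp
  have Vsq: "square_integrable (pair_time T) (\<lambda>z. V i (snd z))" if "i \<in> {1..N}" for i
    unfolding V_def
    by (rule square_integrable_random_variable[OF square_integrable_time_integral[OF gsq[OF that]]])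
  have asq: "square_integrable (pair_time T) (\<lambda>z. a (fst z) (snd z))"
    unfolding a_def
    by (intro square_integrable_sum square_integrable_add Vsq square_integrable_norm[OF L2_adaptedD(1)[OF noise_L2]]
        square_integrable_norm[OF square_integrable_random_variable[OF x0_square]])
  \<comment> \<open>The Gronwall bound, written down in advance as a process so that its square
    integrability can be settled on the product space.\<close>
  define b where "b = (\<lambda>t \<omega>. a t \<omega> + (C * exp (C * T)) * (LBINT \<tau>:{0..T}. a \<tau> \<omega>))"
  have bsq: "square_integrable (pair_time T) (\<lambda>z. b (fst z) (snd z))"
    unfolding b_def
    using square_integrable_add[OF asq square_integrable_scaleR[where c="C * exp (C * T)", OF
        square_integrable_random_variable[OF square_integrable_time_integral[OF asq]]]]
    by simp
  have "AE \<omega> in M. \<forall>i\<in>{1..N}. set_integrable lborel {0..T} (\<lambda>t. g i t \<omega>)"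
    by (intro AE_agents AE_path_integrable(1) finite_measure.square_integrable_imp_integrable[OF finite_measure_pair_time gsq])
  moreover have "AE \<omega> in M. \<forall>i\<in>{1..N}. continuous_on {0..T} (\<lambda>t. x i t \<omega>)"
    by (intro AE_agents state_measurable(3)[OF st])
  moreover have "AE \<omega> in M. \<forall>i\<in>{1..N}. \<forall>t\<in>{0..T}. x i t \<omega> = x0 i \<omega> +
     (LBINT \<tau>:{0..t}. A *v x i \<tau> \<omega> + B *v u i \<tau> \<omega> + G *v mean (\<lambda>j. x j \<tau> \<omega>) + f \<tau>) + noise i t \<omega>"
    by (intro AE_agents state_equation[OF st])
  moreover have "AE \<omega> in M. \<omega> \<in> space M" by simp
  ultimately have "AE \<omega> in M. \<forall>t\<in>{0..T}. norm (x i t \<omega>) \<le> b t \<omega>"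
    using bound
  proof eventually_elim
    case (elim \<omega>)
    define Y where "Y = (\<lambda>t. \<Sum>j\<in>{1..N}. norm (x j t \<omega>))"
    have Ycont: "continuous_on {0..T} Y"
      unfolding Y_def using elim(2) by (intro continuous_intros) auto
    have Yint: "set_integrable lborel {0..t} Y" if "t \<in> {0..T}" for t
      by (rule set_integrable_continuous_interval[OF continuous_on_subset[OF Ycont]]) (use that in auto)
    have gint: "set_integrable lborel {0..t} (\<lambda>t. g j t \<omega>)" if "t \<in> {0..T}" "j \<in> {1..N}" for t j
      by (rule set_integrable_subset[where A="{0..T}"]) (use that elim(1) in auto)
    have g0: "0 \<le> g j t \<omega>" for j t using kB by (simp add: g_def)
    have V0: "0 \<le> V j \<omega>" for j
      unfolding V_def set_lebesgue_integral_def using g0 by (intro Bochner_Integration.integral_nonneg) auto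
    have xj: "norm (x j t \<omega>) \<le> norm (x0 j \<omega>) + norm (noise j t \<omega>) + V j \<omega> + C0 * (LBINT \<tau>:{0..t}. Y \<tau>)"
      if t: "t \<in> {0..T}" and j: "j \<in> {1..N}" for t j
    proof -
      let ?D = "\<lambda>\<tau>. A *v x j \<tau> \<omega> + B *v u j \<tau> \<omega> + G *v mean (\<lambda>k. x k \<tau> \<omega>) + f \<tau>"
      have "norm (?D \<tau>) \<le> C0 * Y \<tau> + g j \<tau> \<omega>" if \<tau>: "\<tau> \<in> {0..t}" for \<tau>
      proof -
        have \<tau>T: "\<tau> \<in> {0..T}" using \<tau> t by auto
        have "norm (x j \<tau> \<omega>) \<le> Y \<tau>"
          unfolding Y_def using j by (intro member_le_sum) auto
        then have "norm (A *v x j \<tau> \<omega>) \<le> kA * Y \<tau>"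
          using kA by (meson mult_left_mono order_trans)
        moreover have "norm (B *v u j \<tau> \<omega>) \<le> kB * (c * Y \<tau> + norm (v j \<tau> \<omega>))"
          using kB elim(5) \<tau>T j unfolding Y_def by (meson mult_left_mono order_trans)
        moreover have "norm (G *v mean (\<lambda>k. x k \<tau> \<omega>)) \<le> kG * Y \<tau>"
          using kG norm_mean_le[of "\<lambda>k. x k \<tau> \<omega>"] unfolding Y_def by (meson mult_left_mono order_trans)
        moreover have "norm (?D \<tau>) \<le> norm (A *v x j \<tau> \<omega>) + norm (B *v u j \<tau> \<omega>)
            + norm (G *v mean (\<lambda>k. x k \<tau> \<omega>)) + norm (f \<tau>)"
          by (intro norm_triangle_le add_right_mono norm_triangle_ineq order_refl)
        ultimately show ?thesis unfolding C0_def g_def by (simp add: algebra_simps)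
      qed
      then have "norm (LBINT \<tau>:{0..t}. ?D \<tau>) \<le> (LBINT \<tau>:{0..t}. C0 * Y \<tau> + g j \<tau> \<omega>)"
        by (intro norm_set_integral_le set_integral_add set_integrable_mult_right Yint gint t j)
      also have "\<dots> = C0 * (LBINT \<tau>:{0..t}. Y \<tau>) + (LBINT \<tau>:{0..t}. g j \<tau> \<omega>)"
        using Yint[OF t] gint[OF t j] by simp
      also have "(LBINT \<tau>:{0..t}. g j \<tau> \<omega>) \<le> V j \<omega>"
        unfolding V_def set_lebesgue_integral_def
        using elim(1) j g0 t gint[OF t j]
        by (intro integral_mono) (auto simp: set_integrable_def indicator_def)
      finally have "norm (LBINT \<tau>:{0..t}. ?D \<tau>) \<le> C0 * (LBINT \<tau>:{0..t}. Y \<tau>) + V j \<omega>" by simp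
      moreover have "x j t \<omega> = x0 j \<omega> + (LBINT \<tau>:{0..t}. ?D \<tau>) + noise j t \<omega>"
        using elim(3) t j by blast
      moreover have "norm (x0 j \<omega> + (LBINT \<tau>:{0..t}. ?D \<tau>) + noise j t \<omega>)
          \<le> norm (x0 j \<omega>) + norm (LBINT \<tau>:{0..t}. ?D \<tau>) + norm (noise j t \<omega>)"
        by (intro norm_triangle_le add_right_mono norm_triangle_ineq)
      ultimately show ?thesis by simp
    qed
    have Yle: "Y t \<le> a t \<omega> + C * (LBINT \<tau>:{0..t}. Y \<tau>)" if t: "t \<in> {0..T}" for t
    proof -
      have "Y t \<le> (\<Sum>j\<in>{1..N}. norm (x0 j \<omega>) + norm (noise j t \<omega>) + V j \<omega> + C0 * (LBINT \<tau>:{0..t}. Y \<tau>))"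
        unfolding Y_def by (intro sum_mono xj[unfolded Y_def] t)
      then show ?thesis by (simp add: a_def C_def sum.distrib)
    qed
    have acont: "continuous_on {0..T} (\<lambda>t. a t \<omega>)"
      unfolding a_def using noise(2) elim(4) by (intro continuous_intros) auto
    have a0: "0 \<le> a t \<omega>" for t
      unfolding a_def using V0 by (intro sum_nonneg add_nonneg_nonneg) auto
    show ?case
    proof
      fix t assume t: "t \<in> {0..T}"
      have "norm (x i t \<omega>) \<le> Y t"
        unfolding Y_def using i by (intro member_le_sum) auto
      also have "\<dots> \<le> b t \<omega>"
        unfolding b_def by (rule gronwall_LBINT[OF Ycont acont C a0 Yle t])
      finally show "norm (x i t \<omega>) \<le> b t \<omega>" .
    qed
  qed
  then have "AE z in pair_time T. norm (x i (fst z) (snd z)) \<le> b (fst z) (snd z)"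
    by (rule AE_pair_time_le[OF state_measurable(1)[OF st i] square_integrable_measurable[OF bsq]])
  then have "AE z in pair_time T. norm (x i (fst z) (snd z)) \<le> 1 * norm (b (fst z) (snd z))"
    by eventually_elim auto
  then have "square_integrable (pair_time T) (\<lambda>z. x i (fst z) (snd z))"
    by (rule square_integrable_bound[OF bsq state_measurable(1)[OF st i]])
  then show ?thesis
    by (rule L2_adaptedI) (rule state_measurable(2)[OF st i])
qed

end

section \<open>Square integrability of the closed loop, comparison of costs, optimality\<close>

lemma quadratic_difference:
  assumes "transpose S = (S :: real^'k^'k)"
  shows "wnorm2 S a - wnorm2 S b = (a - b) \<bullet> (S *v (a + b))"
proof -
  have "b \<bullet> (S *v a) = a \<bullet> (S *v b)"
    by (metis matrix_inner_transpose inner_commute assms)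
  then show ?thesis
    by (simp add: wnorm2_def matrix_vector_right_distrib inner_diff_left inner_add_right)
qed

context social_control
begin

lemma mean_L2:
  fixes X :: "nat \<Rightarrow> real \<Rightarrow> 'w \<Rightarrow> 'v::euclidean_space"
  assumes "\<And>i. i \<in> {1..N} \<Longrightarrow> X i \<in> L2_adapted M F T"
  shows "(\<lambda>t \<omega>. mean (\<lambda>i. X i t \<omega>)) \<in> L2_adapted M F T"
  by (rule L2_adapted_scaleR[OF continuous_on_const L2_adapted_sum[OF assms]])

lemma matrix_L2: "X \<in> L2_adapted M F T \<Longrightarrow> (\<lambda>t \<omega>. Z *v X t \<omega>) \<in> L2_adapted M F T"
  for Z :: "real^'k^'m"
  by (rule L2_adapted_matrix[OF continuous_on_const])

abbreviation "feedback_of x \<equiv> feedback N B R P K s x"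

lemma feedback_eq:
  "feedback_of x i t \<omega> = - ((Ri ** transpose B) *v (P t *v x i t \<omega> + K t *v mean (\<lambda>j. x j t \<omega>) + s t))"
  by (simp add: feedback_def agents_mean_def)

lemma feedback_L2:
  assumes x: "\<And>i. i \<in> {1..N} \<Longrightarrow> x i \<in> L2_adapted M F T" and i: "i \<in> {1..N}"
  shows "feedback_of x i \<in> L2_adapted M F T"
proof -
  have "(\<lambda>t \<omega>. P t *v x i t \<omega> + K t *v mean (\<lambda>j. x j t \<omega>) + s t) \<in> L2_adapted M F T"
    by (rule L2_adapted_add[OF L2_adapted_add[OF L2_adapted_matrix[OF P_cont x[OF i]]
          L2_adapted_matrix[OF K_cont mean_L2[OF x]]] L2_adapted_deterministic[OF s_cont]])
  from matrix_L2[OF this, of "- (Ri ** transpose B)"] show ?thesis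
    unfolding feedback_eq[abs_def]
    by (simp add: bounded_bilinear.minus_left[OF bounded_bilinear_matrix_vector_mult])
qed

text \<open>The feedback is affine in the states with bounded coefficients, so
  \<open>state_L2\<close> applies before admissibility is known; the part free of the states is
  bounded by a multiple of \<open>s\<close>.\<close>

lemma closed_loop_L2:
  assumes st: "is_state (feedback_of x) x" and i: "i \<in> {1..N}"
  shows "x i \<in> L2_adapted M F T"
proof -
  let ?D = "- (Ri ** transpose B)"
  obtain kD where kD: "kD \<ge> 0" "\<And>y. norm (?D *v y) \<le> kD * norm y" using matrix_norm_bound by blast
  obtain k where k: "k > 0" "\<And>(a::real^'n^'n) b. norm (a *v b) \<le> k * (norm a * norm b)"
    using bounded_bilinear_pos_bound[OF bounded_bilinear_matrix_vector_mult] by blast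
  obtain kP where kP: "kP > 0" "\<And>t. t \<in> {0..T} \<Longrightarrow> norm (P t) \<le> kP"
    using continuous_on_interval_bound[OF P_cont] by blast
  obtain kK where kK: "kK > 0" "\<And>t. t \<in> {0..T} \<Longrightarrow> norm (K t) \<le> kK"
    using continuous_on_interval_bound[OF K_cont] by blast
  define c where "c = kD * (k * (kP + kK))"
  have c: "0 \<le> c" using kD k kP kK by (simp add: c_def)
  have v: "(\<lambda>t \<omega>. kD *\<^sub>R s t) \<in> L2_adapted M F T"
    by (rule L2_adapted_deterministic) (intro continuous_intros s_cont)
  show ?thesis
  proof (rule state_L2[OF st v c _ i], intro AE_I2 ballI)
    fix \<omega> t j assume t: "t \<in> {0..T}" and j: "j \<in> {1..N}"
    let ?Y = "\<Sum>l\<in>{1..N}. norm (x l t \<omega>)"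
    have "norm (x j t \<omega>) \<le> ?Y" using j by (intro member_le_sum) auto
    then have 1: "norm (P t *v x j t \<omega>) \<le> k * (kP * ?Y)"
      using k kP(1) kP(2)[OF t] by (intro order_trans[OF k(2)] mult_left_mono mult_mono) auto
    have 2: "norm (K t *v mean (\<lambda>l. x l t \<omega>)) \<le> k * (kK * ?Y)"
      using k kK(1) kK(2)[OF t] norm_mean_le[of "\<lambda>l. x l t \<omega>"]
      by (intro order_trans[OF k(2)] mult_left_mono mult_mono) auto
    have "feedback_of x j t \<omega> = ?D *v (P t *v x j t \<omega> + K t *v mean (\<lambda>l. x l t \<omega>) + s t)"
      unfolding feedback_eq by (simp add: bounded_bilinear.minus_left[OF bounded_bilinear_matrix_vector_mult])
    then have "norm (feedback_of x j t \<omega>) \<le> kD * norm (P t *v x j t \<omega> + K t *v mean (\<lambda>l. x l t \<omega>) + s t)"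
      using kD(2) by simp
    also have "\<dots> \<le> kD * (k * (kP * ?Y) + k * (kK * ?Y) + norm (s t))"
      using 1 2 kD(1) by (intro mult_left_mono norm_triangle_le add_mono order_refl)
    finally show "norm (feedback_of x j t \<omega>) \<le> c * ?Y + norm (kD *\<^sub>R s t)"
      using kD(1) by (simp add: c_def algebra_simps)
  qed
qed

lemma admissible_state_L2:
  assumes "is_state v y" "admissible M F T N v" "i \<in> {1..N}"
  shows "y i \<in> L2_adapted M F T"
  by (rule state_L2[OF assms(1) _ order_refl _ assms(3), of v]) (use assms(2) in \<open>auto simp: admissible_def\<close>)

lemma state_path:
  assumes st: "is_state u x" and adm: "admissible M F T N u"
  shows "AE \<omega> in M. \<forall>i\<in>{1..N}. abs_cont T (\<lambda>t. x i t \<omega> - noise i t \<omega>)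
      (\<lambda>t. A *v x i t \<omega> + B *v u i t \<omega> + G *v mean (\<lambda>j. x j t \<omega>) + f t)
    \<and> x i 0 \<omega> = x0 i \<omega> + noise i 0 \<omega>"
proof (rule AE_agents)
  fix i assume i: "i \<in> {1..N}"
  note x = admissible_state_L2[OF st adm]
  have u: "u i \<in> L2_adapted M F T" using adm i by (simp add: admissible_def)
  have "(\<lambda>t \<omega>. A *v x i t \<omega> + B *v u i t \<omega> + G *v mean (\<lambda>j. x j t \<omega>) + f t) \<in> L2_adapted M F T"
    by (rule L2_adapted_add[OF L2_adapted_add[OF L2_adapted_add[OF matrix_L2[OF x[OF i]] matrix_L2[OF u]]
          matrix_L2[OF mean_L2[OF x]]] L2_adapted_deterministic[OF f_cont]])
  from AE_path_integrable(1)[OF L2_adapted_integrable[OF this]] state_equation[OF st i]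
  show "AE \<omega> in M. abs_cont T (\<lambda>t. x i t \<omega> - noise i t \<omega>)
      (\<lambda>t. A *v x i t \<omega> + B *v u i t \<omega> + G *v mean (\<lambda>j. x j t \<omega>) + f t)
    \<and> x i 0 \<omega> = x0 i \<omega> + noise i 0 \<omega>"
  proof eventually_elim
    case (elim \<omega>)
    let ?D = "\<lambda>t. A *v x i t \<omega> + B *v u i t \<omega> + G *v mean (\<lambda>j. x j t \<omega>) + f t"
    have eq: "x i t \<omega> = x0 i \<omega> + (LBINT \<tau>:{0..t}. ?D \<tau>) + noise i t \<omega>" if "t \<in> {0..T}" for t
      using elim(2) that by blast
    have 0: "x i 0 \<omega> = x0 i \<omega> + noise i 0 \<omega>"
      using eq[of 0] T_pos unfolding set_lebesgue_integral_singleton by simp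
    moreover have "x i t \<omega> - noise i t \<omega> = (x i 0 \<omega> - noise i 0 \<omega>) + (LBINT \<tau>:{0..t}. ?D \<tau>)" if "t \<in> {0..T}" for t
      using eq[OF that] 0 by simp
    ultimately show ?case
      unfolding abs_cont_def using elim(1) by blast
  qed
qed

text \<open>Noise, forcing and the common control all cancel in the difference, which solves a
  homogeneous linear equation from zero; Gronwall's inequality then has no data term.\<close>

lemma state_unique:
  assumes x: "is_state u x" and y: "is_state u y" and adm: "admissible M F T N u"
  shows "AE \<omega> in M. \<forall>i\<in>{1..N}. \<forall>t\<in>{0..T}. y i t \<omega> = x i t \<omega>"
  using state_path[OF x adm] state_path[OF y adm]
proof eventually_elim
  case (elim \<omega>)
  obtain kA where kA: "kA \<ge> 0" "\<And>y. norm (A *v y) \<le> kA * norm y" using matrix_norm_bound by blast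
  obtain kG where kG: "kG \<ge> 0" "\<And>y. norm (G *v y) \<le> kG * norm y" using matrix_norm_bound by blast
  define d where "d = (\<lambda>i t. y i t \<omega> - x i t \<omega>)"
  have ac: "abs_cont T (d i) (\<lambda>t. A *v d i t + G *v mean (\<lambda>j. d j t))" if i: "i \<in> {1..N}" for i
    using difference_abs_cont[of "\<lambda>i t. x i t \<omega>" "\<lambda>i t. noise i t \<omega>" "\<lambda>i t. u i t \<omega>" "\<lambda>i t. y i t \<omega>" "\<lambda>i t. u i t \<omega>" i]
      elim i by (simp add: d_def)
  have d0: "d i 0 = 0" if i: "i \<in> {1..N}" for i
    using elim i by (simp add: d_def)
  define Y where "Y = (\<lambda>t. \<Sum>j\<in>{1..N}. norm (d j t))"
  have Ycont: "continuous_on {0..T} Y"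
    unfolding Y_def by (intro continuous_intros abs_cont_continuous_on[OF ac])
  have Yint: "set_integrable lborel {0..t} Y" if "t \<in> {0..T}" for t
    by (rule set_integrable_continuous_interval[OF continuous_on_subset[OF Ycont]]) (use that in auto)
  have dj: "norm (d j t) \<le> (kA + kG) * (LBINT \<tau>:{0..t}. Y \<tau>)" if t: "t \<in> {0..T}" and j: "j \<in> {1..N}" for t j
  proof -
    have "norm (A *v d j \<tau> + G *v mean (\<lambda>l. d l \<tau>)) \<le> (kA + kG) * Y \<tau>" for \<tau>
    proof -
      have "norm (d j \<tau>) \<le> Y \<tau>" unfolding Y_def using j by (intro member_le_sum) auto
      then have "norm (A *v d j \<tau>) \<le> kA * Y \<tau>" using kA by (meson mult_left_mono order_trans)
      moreover have "norm (G *v mean (\<lambda>l. d l \<tau>)) \<le> kG * Y \<tau>"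
        using kG norm_mean_le[of "\<lambda>l. d l \<tau>"] unfolding Y_def by (meson mult_left_mono order_trans)
      ultimately show ?thesis
        by (intro norm_triangle_le) (simp add: distrib_right)
    qed
    then have "norm (LBINT \<tau>:{0..t}. A *v d j \<tau> + G *v mean (\<lambda>l. d l \<tau>)) \<le> (LBINT \<tau>:{0..t}. (kA + kG) * Y \<tau>)"
      by (intro norm_set_integral_le set_integrable_mult_right Yint t)
    then show ?thesis using abs_cont_eq[OF ac[OF j] t] d0[OF j] by simp
  qed
  have "Y t = 0" if t: "t \<in> {0..T}" for t
  proof (rule order_antisym)
    have "Y t \<le> 0 + (real N * (kA + kG)) * exp ((real N * (kA + kG)) * T) * (LBINT \<tau>:{0..T}. 0)"
    proof (rule gronwall_LBINT[OF Ycont _ _ _ _ t])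
      fix t assume t: "t \<in> {0..T}"
      have "Y t \<le> (\<Sum>j\<in>{1..N}. (kA + kG) * (LBINT \<tau>:{0..t}. Y \<tau>))"
        unfolding Y_def by (intro sum_mono dj[unfolded Y_def] t)
      then show "Y t \<le> 0 + real N * (kA + kG) * (LBINT \<tau>:{0..t}. Y \<tau>)" by simp
    qed (use kA kG in auto)
    then show "Y t \<le> 0" by simp
    show "0 \<le> Y t" unfolding Y_def by (intro sum_nonneg) auto
  qed
  then have "norm (d i t) = 0" if "t \<in> {0..T}" "i \<in> {1..N}" for t i
    using that by (auto simp: Y_def sum_nonneg_eq_0_iff)
  then show ?case by (auto simp: d_def)
qed

lemma quadratic_integrable:
  fixes X :: "real \<Rightarrow> 'w \<Rightarrow> real^'k" and S :: "real^'k^'k"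
  assumes "X \<in> L2_adapted M F T"
  shows "integrable (pair_time T) (\<lambda>z. exp (- \<rho> * fst z) * wnorm2 S (X (fst z) (snd z)))"
proof -
  have "(\<lambda>t \<omega>. exp (- \<rho> * t) *\<^sub>R X t \<omega>) \<in> L2_adapted M F T"
    by (rule L2_adapted_scaleR[OF _ assms]) (intro continuous_intros)
  from L2_adapted_integrable_inner[OF this matrix_L2[OF assms, of S]] show ?thesis
    by (simp add: wnorm2_def)
qed

lemma agent_cost_pair:
  assumes x: "\<And>i. i \<in> {1..N} \<Longrightarrow> x i \<in> L2_adapted M F T" and u: "\<And>i. i \<in> {1..N} \<Longrightarrow> u i \<in> L2_adapted M F T"
    and i: "i \<in> {1..N}"
  defines "L \<equiv> \<lambda>t \<omega>. exp (- \<rho> * t) *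
        (wnorm2 Q (x i t \<omega> - \<Gamma> *v agents_mean N x t \<omega> - \<eta> t) + wnorm2 R (u i t \<omega>))"
  shows "integrable (pair_time T) (\<lambda>z. L (fst z) (snd z))"
    and "agent_cost M T N \<rho> \<Gamma> Q R \<eta> u x i = (LINT z|pair_time T. L (fst z) (snd z))"
proof -
  have "(\<lambda>t \<omega>. x i t \<omega> - \<Gamma> *v agents_mean N x t \<omega> - \<eta> t) \<in> L2_adapted M F T"
    unfolding agents_mean_def
    by (rule L2_adapted_diff[OF L2_adapted_diff[OF x[OF i] matrix_L2[OF mean_L2[OF x]]]
          L2_adapted_deterministic[OF eta_cont]])
  from Bochner_Integration.integrable_add[OF quadratic_integrable[OF this, of Q] quadratic_integrable[OF u[OF i], of R]]
  show int: "integrable (pair_time T) (\<lambda>z. L (fst z) (snd z))"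
    unfolding L_def by (simp only: distrib_left)
  show "agent_cost M T N \<rho> \<Gamma> Q R \<eta> u x i = (LINT z|pair_time T. L (fst z) (snd z))"
    unfolding agent_cost_def L_def by (rule AE_path_integrable(3)[of T L, OF int, unfolded L_def])
qed

text \<open>The costs are iterated integrals. Square integrability of states and controls makes them
  integrals over the product of time and probability, where they may be subtracted under the
  integral sign.\<close>

lemma cost_gap_pair:
  assumes x: "\<And>i. i \<in> {1..N} \<Longrightarrow> x i \<in> L2_adapted M F T" and u: "\<And>i. i \<in> {1..N} \<Longrightarrow> u i \<in> L2_adapted M F T"
    and y: "\<And>i. i \<in> {1..N} \<Longrightarrow> y i \<in> L2_adapted M F T" and v: "\<And>i. i \<in> {1..N} \<Longrightarrow> v i \<in> L2_adapted M F T"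
  defines "D \<equiv> \<lambda>t \<omega>. cost_gap (\<lambda>i. y i t \<omega> - x i t \<omega>) (\<lambda>i. x i t \<omega> + y i t \<omega>)
      (\<lambda>i. v i t \<omega> - u i t \<omega>) (\<lambda>i. u i t \<omega> + v i t \<omega>) t"
  shows "integrable (pair_time T) (\<lambda>z. D (fst z) (snd z))"
    and "social_cost M T N \<rho> \<Gamma> Q R \<eta> v y - social_cost M T N \<rho> \<Gamma> Q R \<eta> u x = (LINT z|pair_time T. D (fst z) (snd z))"
proof -
  define L where "L = (\<lambda>u x i t \<omega>. exp (- \<rho> * t) *
        (wnorm2 Q (x i t \<omega> - \<Gamma> *v agents_mean N x t \<omega> - \<eta> t) + wnorm2 R ((u :: nat \<Rightarrow> real \<Rightarrow> 'w \<Rightarrow> real^'r) i t \<omega>)))"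
  have D: "D t \<omega> = (\<Sum>i\<in>{1..N}. L v y i t \<omega> - L u x i t \<omega>)" for t \<omega>
  proof -
    have "L v y i t \<omega> - L u x i t \<omega> = exp (- \<rho> * t) * ((y i t \<omega> - x i t \<omega> - \<Gamma> *v mean (\<lambda>i. y i t \<omega> - x i t \<omega>)) \<bullet>
        (Q *v (x i t \<omega> + y i t \<omega> - \<Gamma> *v mean (\<lambda>i. x i t \<omega> + y i t \<omega>) - 2 *\<^sub>R \<eta> t))
        + (v i t \<omega> - u i t \<omega>) \<bullet> (R *v (u i t \<omega> + v i t \<omega>)))" for i
    proof -
      have 1: "(y i t \<omega> - \<Gamma> *v mean (\<lambda>i. y i t \<omega>) - \<eta> t) - (x i t \<omega> - \<Gamma> *v mean (\<lambda>i. x i t \<omega>) - \<eta> t)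
          = y i t \<omega> - x i t \<omega> - \<Gamma> *v mean (\<lambda>i. y i t \<omega> - x i t \<omega>)"
        unfolding mean_diff by (simp add: matrix_vector_mult_diff_distrib)
      have 2: "(y i t \<omega> - \<Gamma> *v mean (\<lambda>i. y i t \<omega>) - \<eta> t) + (x i t \<omega> - \<Gamma> *v mean (\<lambda>i. x i t \<omega>) - \<eta> t)
          = x i t \<omega> + y i t \<omega> - \<Gamma> *v mean (\<lambda>i. x i t \<omega> + y i t \<omega>) - 2 *\<^sub>R \<eta> t"
        unfolding mean_add by (simp add: matrix_vector_right_distrib scaleR_2)
      have "L v y i t \<omega> - L u x i t \<omega> = exp (- \<rho> * t) *
          ((wnorm2 Q (y i t \<omega> - \<Gamma> *v mean (\<lambda>i. y i t \<omega>) - \<eta> t) - wnorm2 Q (x i t \<omega> - \<Gamma> *v mean (\<lambda>i. x i t \<omega>) - \<eta> t))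
           + (wnorm2 R (v i t \<omega>) - wnorm2 R (u i t \<omega>)))"
        unfolding L_def agents_mean_def by (simp only: right_diff_distrib[symmetric] add_diff_add)
      then show ?thesis
        unfolding quadratic_difference[OF Q_sym] quadratic_difference[OF R_sym] 1 2
        by (simp only: add.commute[of "v i t \<omega>"])
    qed
    then show ?thesis unfolding D_def cost_gap_def sum_distrib_left by (simp only:)
  qed
  have iy: "integrable (pair_time T) (\<lambda>z. L v y i (fst z) (snd z))" if "i \<in> {1..N}" for i
    unfolding L_def by (rule agent_cost_pair(1)[OF y v that])
  have ix: "integrable (pair_time T) (\<lambda>z. L u x i (fst z) (snd z))" if "i \<in> {1..N}" for i
    unfolding L_def by (rule agent_cost_pair(1)[OF x u that])
  show "integrable (pair_time T) (\<lambda>z. D (fst z) (snd z))"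
    unfolding D by (intro Bochner_Integration.integrable_sum Bochner_Integration.integrable_diff iy ix)
  have cy: "agent_cost M T N \<rho> \<Gamma> Q R \<eta> v y i = (LINT z|pair_time T. L v y i (fst z) (snd z))" if "i \<in> {1..N}" for i
    unfolding L_def by (rule agent_cost_pair(2)[OF y v that])
  have cx: "agent_cost M T N \<rho> \<Gamma> Q R \<eta> u x i = (LINT z|pair_time T. L u x i (fst z) (snd z))" if "i \<in> {1..N}" for i
    unfolding L_def by (rule agent_cost_pair(2)[OF x u that])
  have "(LINT z|pair_time T. D (fst z) (snd z)) = (\<Sum>i\<in>{1..N}. LINT z|pair_time T. L v y i (fst z) (snd z) - L u x i (fst z) (snd z))"
    unfolding D by (intro Bochner_Integration.integral_sum Bochner_Integration.integrable_diff iy ix)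
  also have "\<dots> = (\<Sum>i\<in>{1..N}. agent_cost M T N \<rho> \<Gamma> Q R \<eta> v y i - agent_cost M T N \<rho> \<Gamma> Q R \<eta> u x i)"
    by (intro sum.cong refl) (simp only: cy cx Bochner_Integration.integral_diff[OF iy ix])
  finally show "social_cost M T N \<rho> \<Gamma> Q R \<eta> v y - social_cost M T N \<rho> \<Gamma> Q R \<eta> u x = (LINT z|pair_time T. D (fst z) (snd z))"
    by (simp only: social_cost_def sum_subtractf)
qed

lemma costate_rate_L2:
  assumes h: "\<And>i. i \<in> {1..N} \<Longrightarrow> h i \<in> L2_adapted M F T" and w: "\<And>i. i \<in> {1..N} \<Longrightarrow> w i \<in> L2_adapted M F T"
    and i: "i \<in> {1..N}"
  shows "(\<lambda>t \<omega>. costate_rate (\<lambda>j. h j t \<omega>) (\<lambda>j. w j t \<omega>) i t) \<in> L2_adapted M F T"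
  unfolding costate_rate_def
  by (intro L2_adapted_scaleR L2_adapted_add L2_adapted_matrix continuous_intros
      P_cont K_cont Pd_cont Kd_cont mean_L2 h w i)

text \<open>The feedback law is demanded only almost surely, because the profile may have been
  computed from another version of the state than \<open>x\<close>.\<close>

lemma feedback_optimal:
  assumes x: "is_state u x" and u: "admissible M F T N u"
    and fb: "AE \<omega> in M. \<forall>i\<in>{1..N}. \<forall>t\<in>{0..T}. u i t \<omega> = feedback_of x i t \<omega>"
    and y: "is_state v y" and v: "admissible M F T N v"
  shows "social_cost M T N \<rho> \<Gamma> Q R \<eta> u x \<le> social_cost M T N \<rho> \<Gamma> Q R \<eta> v y"
proof -
  note xL = admissible_state_L2[OF x u] and yL = admissible_state_L2[OF y v]
  have uL: "i \<in> {1..N} \<Longrightarrow> u i \<in> L2_adapted M F T" and vL: "i \<in> {1..N} \<Longrightarrow> v i \<in> L2_adapted M F T" for i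
    using u v by (auto simp: admissible_def)
  define D where "D = (\<lambda>t \<omega>. cost_gap (\<lambda>i. y i t \<omega> - x i t \<omega>) (\<lambda>i. x i t \<omega> + y i t \<omega>)
      (\<lambda>i. v i t \<omega> - u i t \<omega>) (\<lambda>i. u i t \<omega> + v i t \<omega>) t)"
  define c where "c = (\<lambda>i t \<omega>. costate_rate (\<lambda>j. y j t \<omega> - x j t \<omega>) (\<lambda>j. v j t \<omega> - u j t \<omega>) i t)"
  have Dint: "integrable (pair_time T) (\<lambda>z. D (fst z) (snd z))"
    and gap: "social_cost M T N \<rho> \<Gamma> Q R \<eta> v y - social_cost M T N \<rho> \<Gamma> Q R \<eta> u x = (LINT z|pair_time T. D (fst z) (snd z))"
    unfolding D_def by (rule cost_gap_pair[OF xL uL yL vL]; assumption)+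
  have cL: "c i \<in> L2_adapted M F T" if i: "i \<in> {1..N}" for i
    unfolding c_def by (rule costate_rate_L2[OF L2_adapted_diff[OF yL xL] L2_adapted_diff[OF vL uL] i])
  have nint: "integrable (pair_time T) (\<lambda>z. noise i (fst z) (snd z) \<bullet> c i (fst z) (snd z))" if "i \<in> {1..N}" for i
    by (rule L2_adapted_integrable_inner[OF noise_L2[OF that] cL[OF that]])
  let ?J = "\<lambda>t \<omega>. \<Sum>i\<in>{1..N}. noise i t \<omega> \<bullet> c i t \<omega>"
  have Jint: "integrable (pair_time T) (\<lambda>z. ?J (fst z) (snd z))"
    by (intro Bochner_Integration.integrable_sum nint)
  have tot: "integrable (pair_time T) (\<lambda>z. D (fst z) (snd z) + 2 * ?J (fst z) (snd z))"
    by (intro Bochner_Integration.integrable_add integrable_mult_right Dint Jint)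
  have paths: "AE \<omega> in M. (\<forall>i\<in>{1..N}. (LBINT t:{0..T}. c i t \<omega>) = 0) \<and> 0 \<le> (LBINT t:{0..T}. D t \<omega> + 2 * ?J t \<omega>)"
    using state_path[OF x u] state_path[OF y v] fb AE_path_integrable(1)[OF tot]
  proof eventually_elim
    case (elim \<omega>)
    have X: "abs_cont T (\<lambda>t. x i t \<omega> - noise i t \<omega>) (\<lambda>t. A *v x i t \<omega> + B *v u i t \<omega> + G *v mean (\<lambda>j. x j t \<omega>) + f t)"
      and Y: "abs_cont T (\<lambda>t. y i t \<omega> - noise i t \<omega>) (\<lambda>t. A *v y i t \<omega> + B *v v i t \<omega> + G *v mean (\<lambda>j. y j t \<omega>) + f t)"
      and start: "y i 0 \<omega> = x i 0 \<omega>" if "i \<in> {1..N}" for i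
      using elim(1,2) that by simp_all
    have fb': "u i t \<omega> = - ((Ri ** transpose B) *v (P t *v x i t \<omega> + K t *v mean (\<lambda>j. x j t \<omega>) + s t))"
      if "t \<in> {0..T}" "i \<in> {1..N}" for t i
      using elim(3) that by (simp only: feedback_eq)
    show ?case
    proof (intro conjI ballI)
      fix i assume i: "i \<in> {1..N}"
      show "(LBINT t:{0..T}. c i t \<omega>) = 0"
        unfolding c_def
        by (rule costate_integral[where x="\<lambda>i t. x i t \<omega>" and y="\<lambda>i t. y i t \<omega>" and u="\<lambda>i t. u i t \<omega>"
              and v="\<lambda>i t. v i t \<omega>" and I="\<lambda>i t. noise i t \<omega>", OF X Y start i])
    next
      show "0 \<le> (LBINT t:{0..T}. D t \<omega> + 2 * ?J t \<omega>)"
        unfolding D_def c_def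
        by (rule path_gap_nonneg[where x="\<lambda>i t. x i t \<omega>" and y="\<lambda>i t. y i t \<omega>" and u="\<lambda>i t. u i t \<omega>"
              and v="\<lambda>i t. v i t \<omega>" and I="\<lambda>i t. noise i t \<omega>", OF X Y start fb' elim(4)[unfolded D_def c_def]])
    qed
  qed
  \<comment> \<open>\<open>c i\<close> is adapted and has zero time integral along almost every
    path, which is what orthogonality to the noise requires.\<close>
  have "(LINT z|pair_time T. noise i (fst z) (snd z) \<bullet> c i (fst z) (snd z)) = 0" if i: "i \<in> {1..N}" for i
    by (rule brownian_space.ito_integral_orthogonal[OF brownian_space[OF i] noise(1)[OF i] _ cL[OF i]])
      (use T_pos paths i in \<open>auto elim!: eventually_mono\<close>)
  then have "(LINT z|pair_time T. ?J (fst z) (snd z)) = 0"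
    by (subst Bochner_Integration.integral_sum) (auto intro: nint)
  \<comment> \<open>The noise term has mean zero only after integration over the sample space,
    whereas nonnegativity was shown path by path with the term included; so it is added before
    Fubini's theorem is applied.\<close>
  then have "(LINT z|pair_time T. D (fst z) (snd z)) = (LINT z|pair_time T. D (fst z) (snd z) + 2 * ?J (fst z) (snd z))"
    by (subst Bochner_Integration.integral_add[OF Dint integrable_mult_right[OF Jint]]) simp
  also have "\<dots> = expectation (\<lambda>\<omega>. LBINT t:{0..T}. D t \<omega> + 2 * ?J t \<omega>)"
    by (rule AE_path_integrable(3)[OF tot, symmetric])
  also have "\<dots> \<ge> 0"
    by (rule integral_nonneg_AE) (use paths in \<open>auto elim!: eventually_mono\<close>)
  finally show ?thesis using gap by simp
qed

text \<open>\<open>feedback_of x\<close> is a fixed profile computed from \<open>x\<close>, but its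
  cost has to be compared along every state \<open>x'\<close> that it generates. By uniqueness the
  profile is almost surely also the feedback computed from \<open>x'\<close>.\<close>

lemma closed_loop_optimal:
  assumes st: "is_state (feedback_of x) x"
  shows "optimal_control M F T N W x0 A B G f \<sigma> \<rho> \<Gamma> Q R \<eta> (feedback_of x)"
  unfolding optimal_control_def
proof (intro conjI allI impI)
  show adm: "admissible M F T N (feedback_of x)"
    unfolding admissible_def by (intro ballI feedback_L2 closed_loop_L2[OF st])
  show "\<exists>x'. is_state (feedback_of x) x'" using st by blast
  fix x' v y
  assume x': "is_state (feedback_of x) x'" and v: "admissible M F T N v" and y: "is_state v y"
  have "AE \<omega> in M. \<forall>i\<in>{1..N}. \<forall>t\<in>{0..T}. feedback_of x i t \<omega> = feedback_of x' i t \<omega>"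
    using state_unique[OF st x' adm]
  proof eventually_elim
    case (elim \<omega>)
    then show ?case by (auto simp: feedback_eq intro!: arg_cong2[where f=plus] sum.cong)
  qed
  from feedback_optimal[OF x' adm this y v]
  show "social_cost M T N \<rho> \<Gamma> Q R \<eta> (feedback_of x) x' \<le> social_cost M T N \<rho> \<Gamma> Q R \<eta> v y" .
qed

end

section \<open>The filtration generated by the agents\<close>

lemma sets_agent_sigma:
  "sets (agent_sigma M \<xi> w t) = sigma_sets (space M)
    ({\<xi> -` S \<inter> space M | S. S \<in> sets borel} \<union> {w \<tau> -` S \<inter> space M | \<tau> S. 0 \<le> \<tau> \<and> \<tau> \<le> t \<and> S \<in> sets borel})"
  unfolding agent_sigma_def by (rule sets_measure_of) auto

lemma space_agent_sigma: "space (agent_sigma M \<xi> w t) = space M"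
  unfolding agent_sigma_def by (rule space_measure_of) auto

lemma agents_filtration_generators:
  "(\<Union>i\<in>{1..N}. sets (agent_sigma M (x0 i) (W i) t)) \<union> null_sets M \<subseteq> Pow (space M)"
proof -
  have "sets (agent_sigma M (x0 i) (W i) t) \<subseteq> Pow (space M)" for i
    using sets.space_closed[of "agent_sigma M (x0 i) (W i) t"] by (simp only: space_agent_sigma)
  moreover have "null_sets M \<subseteq> Pow (space M)"
    by (auto dest: null_setsD2 sets.sets_into_space)
  ultimately show ?thesis by blast
qed

lemma space_agents_filtration: "space (agents_filtration M N x0 W t) = space M"
  unfolding agents_filtration_def by (rule space_measure_of[OF agents_filtration_generators])

lemma sets_agents_filtration:
  "sets (agents_filtration M N x0 W t) = sigma_sets (space M)
    ((\<Union>i\<in>{1..N}. sets (agent_sigma M (x0 i) (W i) t)) \<union> null_sets M)"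
  unfolding agents_filtration_def by (rule sets_measure_of[OF agents_filtration_generators])

lemma agent_sigma_subset:
  assumes "\<xi> \<in> borel_measurable M" "\<And>\<tau>. 0 \<le> \<tau> \<Longrightarrow> w \<tau> \<in> borel_measurable M"
  shows "sets (agent_sigma M \<xi> w t) \<subseteq> sets M"
  unfolding sets_agent_sigma
  by (rule sets.sigma_sets_subset) (use assms in \<open>auto intro: measurable_sets\<close>)

lemma agent_sigma_mono:
  assumes "s \<le> t"
  shows "sets (agent_sigma M \<xi> w s) \<subseteq> sets (agent_sigma M \<xi> w t)"
  unfolding sets_agent_sigma
proof (rule sigma_sets_mono', rule Un_mono[OF order_refl], rule subsetI)
  fix Z assume "Z \<in> {w \<tau> -` S \<inter> space M | \<tau> S. 0 \<le> \<tau> \<and> \<tau> \<le> s \<and> S \<in> sets borel}"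
  then obtain \<tau> S where "Z = w \<tau> -` S \<inter> space M" "0 \<le> \<tau>" "\<tau> \<le> t" "S \<in> sets borel"
    using assms by force
  then show "Z \<in> {w \<tau> -` S \<inter> space M | \<tau> S. 0 \<le> \<tau> \<and> \<tau> \<le> t \<and> S \<in> sets borel}"
    by blast
qed

lemma initial_measurable_agents_filtration:
  assumes i: "i \<in> {1..N}"
  shows "x0 i \<in> borel_measurable (agents_filtration M N x0 W t)"
proof (rule measurableI)
  fix S :: "'b set" assume "S \<in> sets borel"
  then have "x0 i -` S \<inter> space M \<in> sets (agent_sigma M (x0 i) (W i) t)"
    unfolding sets_agent_sigma by (intro sigma_sets.Basic) blast
  then show "x0 i -` S \<inter> space (agents_filtration M N x0 W t) \<in> sets (agents_filtration M N x0 W t)"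
    unfolding space_agents_filtration sets_agents_filtration using i by (intro sigma_sets.Basic) blast
qed simp

lemma (in prob_space) filtered_agents:
  assumes x0: "\<And>i. i \<in> {1..N} \<Longrightarrow> x0 i \<in> borel_measurable M"
    and W: "\<And>i \<tau>. i \<in> {1..N} \<Longrightarrow> 0 \<le> \<tau> \<Longrightarrow> W i \<tau> \<in> borel_measurable M"
  shows "filtered_prob_space M (agents_filtration M N x0 W)"
proof
  fix s t :: real
  show "space (agents_filtration M N x0 W t) = space M" by (rule space_agents_filtration)
  show "sets (agents_filtration M N x0 W t) \<subseteq> sets M"
    unfolding sets_agents_filtration
  proof (rule sets.sigma_sets_subset)
    have "sets (agent_sigma M (x0 i) (W i) t) \<subseteq> sets M" if "i \<in> {1..N}" for i
      by (rule agent_sigma_subset[OF x0[OF that] W[OF that]])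
    then show "(\<Union>i\<in>{1..N}. sets (agent_sigma M (x0 i) (W i) t)) \<union> null_sets M \<subseteq> sets M"
      by (intro Un_least UN_least) (auto dest: null_setsD2)
  qed
  show "null_sets M \<subseteq> sets (agents_filtration M N x0 W t)"
    unfolding sets_agents_filtration by auto
  assume "s \<le> t"
  then show "sets (agents_filtration M N x0 W s) \<subseteq> sets (agents_filtration M N x0 W t)"
    unfolding sets_agents_filtration
    by (intro sigma_sets_mono' Un_mono UN_mono order_refl agent_sigma_mono)
qed

section \<open>Solving the closed loop path by path\<close>

context filtered_prob_space
begin

text \<open>At time \<open>t\<close> the solution formula uses \<open>b\<close> up to
  \<open>t\<close> only, so solving path by path does not destroy adaptedness.\<close>

lemma volterra_adapted:
  fixes L \<Psi> \<Phi> :: "real \<Rightarrow> real^'n^'n" and b :: "real \<Rightarrow> 'w \<Rightarrow> real^'n"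
  assumes L: "continuous_on {0..T} L" and \<Psi>: "continuous_on {0..T} \<Psi>"
    and b: "\<And>\<tau>. \<tau> \<in> {0..T} \<Longrightarrow> b \<tau> \<in> borel_measurable (F \<tau>)"
    and cont: "\<And>\<omega>. \<omega> \<in> space M \<Longrightarrow> continuous_on {0..T} (\<lambda>\<tau>. b \<tau> \<omega>)"
    and t: "t \<in> {0..T}"
  shows "(\<lambda>\<omega>. b t \<omega> + \<Phi> t *v integral {0..t} (\<lambda>\<tau>. \<Psi> \<tau> *v (L \<tau> *v b \<tau> \<omega>))) \<in> borel_measurable (F t)"
proof -
  have sub: "continuous_on {0..t} g" if "continuous_on {0..T} g" for g :: "real \<Rightarrow> 'z::topological_space"
    by (rule continuous_on_subset[OF that]) (use t in auto)
  have c: "continuous_on {0..t} (\<lambda>\<tau>. \<Psi> \<tau> *v (L \<tau> *v b \<tau> \<omega>))" if "\<omega> \<in> space M" for \<omega>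
    by (intro sub continuous_intros \<Psi> L cont[OF that])
  have m: "(\<lambda>\<omega>. \<Psi> \<tau> *v (L \<tau> *v b \<tau> \<omega>)) \<in> borel_measurable (F \<tau>)" if "\<tau> \<in> {0..t}" for \<tau>
    by (rule borel_measurable_bounded_bilinear[OF bounded_bilinear_matrix_vector_mult borel_measurable_const
          borel_measurable_bounded_bilinear[OF bounded_bilinear_matrix_vector_mult borel_measurable_const b]])
      (use that t in auto)
  have "(\<lambda>\<omega>. LBINT \<tau>:{0..t}. \<Psi> \<tau> *v (L \<tau> *v b \<tau> \<omega>)) \<in> borel_measurable (F t)"
    by (rule time_integral_measurable[OF m c])
  then have "(\<lambda>\<omega>. integral {0..t} (\<lambda>\<tau>. \<Psi> \<tau> *v (L \<tau> *v b \<tau> \<omega>))) \<in> borel_measurable (F t)"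
    by (rule measurable_cong[THEN iffD1, rotated]) (simp add: integral_eq_LBINT[OF c] space_F)
  then show ?thesis
    by (rule borel_measurable_add[OF b[OF t] borel_measurable_bounded_bilinear[OF
          bounded_bilinear_matrix_vector_mult borel_measurable_const]])
qed

end

context social_control
begin

lemma closed_loop_exists: "\<exists>x. is_state (feedback_of x) x"
proof -
  define S where "S = B ** Ri ** transpose B"
  \<comment> \<open>\<open>L1\<close> governs the average and \<open>L2\<close> the deviations:
    averaging the closed-loop equations adds \<open>G\<close> and \<open>K\<close> to the
    coefficient, while both cancel when the average is subtracted.\<close>
  define L1 where "L1 = (\<lambda>t. A + G - S ** (P t + K t))"
  define L2 where "L2 = (\<lambda>t. A - S ** P t)"
  have L1c: "continuous_on {0..T} L1" and L2c: "continuous_on {0..T} L2"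
    unfolding L1_def L2_def by (intro continuous_intros P_cont K_cont)+
  have T0: "0 \<le> T" using T_pos by simp
  from linear_matrix_ode_inverse[OF T0 L1c] obtain \<Phi>1 \<Psi>1 :: "real \<Rightarrow> real^'n^'n" where 1: "\<forall>t\<in>{0..T}.
      (\<Phi>1 has_vector_derivative L1 t ** \<Phi>1 t) (at t within {0..T}) \<and>
      (\<Psi>1 has_vector_derivative - (\<Psi>1 t ** L1 t)) (at t within {0..T}) \<and>
      \<Phi>1 t ** \<Psi>1 t = mat 1" by (elim exE)
  from linear_matrix_ode_inverse[OF T0 L2c] obtain \<Phi>2 \<Psi>2 :: "real \<Rightarrow> real^'n^'n" where 2: "\<forall>t\<in>{0..T}.
      (\<Phi>2 has_vector_derivative L2 t ** \<Phi>2 t) (at t within {0..T}) \<and>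
      (\<Psi>2 has_vector_derivative - (\<Psi>2 t ** L2 t)) (at t within {0..T}) \<and>
      \<Phi>2 t ** \<Psi>2 t = mat 1" by (elim exE)
  note \<Phi>1 = 1[rule_format, THEN conjunct1] and \<Psi>1 = 1[rule_format, THEN conjunct2, THEN conjunct1]
    and inv1 = 1[rule_format, THEN conjunct2, THEN conjunct2]
  note \<Phi>2 = 2[rule_format, THEN conjunct1] and \<Psi>2 = 2[rule_format, THEN conjunct2, THEN conjunct1]
    and inv2 = 2[rule_format, THEN conjunct2, THEN conjunct2]
  have \<Psi>1c: "continuous_on {0..T} \<Psi>1" and \<Psi>2c: "continuous_on {0..T} \<Psi>2"
    by (rule has_vector_derivative_imp_continuous_on, erule \<Psi>1 \<Psi>2)+
  let ?g = "\<lambda>\<tau>. f \<tau> - S *v s \<tau>"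
  have gc: "continuous_on {0..T} ?g" by (intro continuous_intros f_cont s_cont)
  \<comment> \<open>The forcing is split in the same way: \<open>b1\<close> carries the averaged
    initial state, the drift and the averaged noise, \<open>b2\<close> the deviations of initial
    state and noise, and together they give back the data of one agent.\<close>
  define b1 where "b1 = (\<lambda>t \<omega>. mean (\<lambda>i. x0 i \<omega>) + integral {0..t} ?g + mean (\<lambda>i. noise i t \<omega>))"
  define b2 where "b2 = (\<lambda>i t \<omega>. (x0 i \<omega> - mean (\<lambda>j. x0 j \<omega>)) + (noise i t \<omega> - mean (\<lambda>j. noise j t \<omega>)))"
  define m where "m = (\<lambda>t \<omega>. b1 t \<omega> + \<Phi>1 t *v integral {0..t} (\<lambda>\<tau>. \<Psi>1 \<tau> *v (L1 \<tau> *v b1 \<tau> \<omega>)))"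
  define e where "e = (\<lambda>i t \<omega>. b2 i t \<omega> + \<Phi>2 t *v integral {0..t} (\<lambda>\<tau>. \<Psi>2 \<tau> *v (L2 \<tau> *v b2 i \<tau> \<omega>)))"
  define x where "x = (\<lambda>i t \<omega>. m t \<omega> + e i t \<omega>)"
  have noiseF: "noise i t \<in> borel_measurable (F t)" if "i \<in> {1..N}" "t \<in> {0..T}" for i t
    by (rule L2_adaptedD(2)[OF noise_L2[OF that(1)] that(2)])
  have b1F: "b1 t \<in> borel_measurable (F t)" if "t \<in> {0..T}" for t
    unfolding b1_def
    by (intro borel_measurable_add borel_measurable_scaleR borel_measurable_const borel_measurable_sum
        x0_measurable noiseF that)
  have b2F: "b2 i t \<in> borel_measurable (F t)" if "i \<in> {1..N}" "t \<in> {0..T}" for i t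
    unfolding b2_def
    by (intro borel_measurable_add borel_measurable_diff borel_measurable_scaleR borel_measurable_const
        borel_measurable_sum x0_measurable noiseF that)
  have b1c: "continuous_on {0..T} (\<lambda>t. b1 t \<omega>)" if "\<omega> \<in> space M" for \<omega>
    unfolding b1_def
    by (intro continuous_intros noise(2) that indefinite_integral_continuous_1 integrable_continuous_real gc)
  have b2c: "continuous_on {0..T} (\<lambda>t. b2 i t \<omega>)" if "\<omega> \<in> space M" "i \<in> {1..N}" for \<omega> i
    unfolding b2_def by (intro continuous_intros noise(2) that)
  note m_sol = volterra_solution[OF L1c \<Phi>1 \<Psi>1c inv1 b1c]
  note e_sol = volterra_solution[OF L2c \<Phi>2 \<Psi>2c inv2 b2c]
  have mc: "continuous_on {0..T} (\<lambda>t. m t \<omega>)" if "\<omega> \<in> space M" for \<omega>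
    using m_sol(1)[OF _ _ that] by (simp only: m_def)
  have ec: "continuous_on {0..T} (\<lambda>t. e i t \<omega>)" if "\<omega> \<in> space M" "i \<in> {1..N}" for \<omega> i
    using e_sol(1)[OF _ _ that] by (simp only: e_def)
  have meq: "m t \<omega> = b1 t \<omega> + integral {0..t} (\<lambda>\<tau>. L1 \<tau> *v m \<tau> \<omega>)" if "\<omega> \<in> space M" "t \<in> {0..T}" for t \<omega>
    using m_sol(2)[OF _ _ that(1) that(2)] by (simp only: m_def)
  have eeq: "e i t \<omega> = b2 i t \<omega> + integral {0..t} (\<lambda>\<tau>. L2 \<tau> *v e i \<tau> \<omega>)" if "\<omega> \<in> space M" "i \<in> {1..N}" "t \<in> {0..T}" for i t \<omega>
    using e_sol(2)[OF _ _ that(1,2) that(3)] by (simp only: e_def)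
  have mF: "m t \<in> borel_measurable (F t)" if "t \<in> {0..T}" for t
    unfolding m_def by (rule volterra_adapted[OF L1c \<Psi>1c b1F b1c that])
  have eF: "e i t \<in> borel_measurable (F t)" if "i \<in> {1..N}" "t \<in> {0..T}" for i t
    unfolding e_def by (rule volterra_adapted[OF L2c \<Psi>2c b2F[OF that(1)] b2c[OF _ that(1)] that(2)])
  have xF: "x i t \<in> borel_measurable (F t)" if "i \<in> {1..N}" "t \<in> {0..T}" for i t
    unfolding x_def by (intro borel_measurable_add mF eF that)
  have xc: "continuous_on {0..T} (\<lambda>t. x i t \<omega>)" if "\<omega> \<in> space M" "i \<in> {1..N}" for \<omega> i
    unfolding x_def by (intro continuous_intros mc ec that)
  have mean_b2: "mean (\<lambda>i. b2 i t \<omega>) = 0" for t \<omega>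
    unfolding b2_def mean_add mean_diff mean_const by simp
  have sum_b2: "(\<Sum>i\<in>{1..N}. b2 i t \<omega>) = 0" for t \<omega>
    using agents_sum[OF N_pos, of "\<lambda>i. b2 i t \<omega>"] unfolding mean_b2 by simp
  \<comment> \<open>\<open>m\<close> was constructed without reference to \<open>x\<close>. Each
    deviation depends linearly on its forcing and the forcings sum to zero, so \<open>m\<close> is
    the average of the states and may be used as such in the feedback.\<close>
  have mean_e: "mean (\<lambda>i. e i t \<omega>) = 0" if \<omega>: "\<omega> \<in> space M" and t: "t \<in> {0..T}" for t \<omega>
  proof -
    have sub: "{0..t} \<subseteq> {0..T}" using t by auto
    have "(\<Sum>i\<in>{1..N}. integral {0..t} (\<lambda>\<tau>. \<Psi>2 \<tau> *v (L2 \<tau> *v b2 i \<tau> \<omega>))) =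
        integral {0..t} (\<lambda>\<tau>. \<Sum>i\<in>{1..N}. \<Psi>2 \<tau> *v (L2 \<tau> *v b2 i \<tau> \<omega>))"
      by (rule Henstock_Kurzweil_Integration.integral_sum[symmetric])
        (auto intro!: integrable_continuous_real continuous_on_subset[OF _ sub] continuous_intros \<Psi>2c L2c b2c \<omega>)
    also have "(\<lambda>\<tau>. \<Sum>i\<in>{1..N}. \<Psi>2 \<tau> *v (L2 \<tau> *v b2 i \<tau> \<omega>)) = (\<lambda>\<tau>. 0)"
      by (simp only: bounded_bilinear.sum_right[OF bounded_bilinear_matrix_vector_mult, symmetric] sum_b2
          matrix_vector_mult_0_right)
    finally have "mean (\<lambda>i. integral {0..t} (\<lambda>\<tau>. \<Psi>2 \<tau> *v (L2 \<tau> *v b2 i \<tau> \<omega>))) = 0"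
      by (simp only: Henstock_Kurzweil_Integration.integral_0 scaleR_zero_right)
    then show ?thesis
      unfolding e_def mean_add mean_b2 mean_matrix by (simp only: matrix_vector_mult_0_right add_0)
  qed
  have mean_x: "mean (\<lambda>i. x i t \<omega>) = m t \<omega>" if "\<omega> \<in> space M" "t \<in> {0..T}" for t \<omega>
    unfolding x_def mean_add mean_const mean_e[OF that] by simp
  have eq: "x i t \<omega> = x0 i \<omega> + (LBINT \<tau>:{0..t}. A *v x i \<tau> \<omega> + B *v feedback_of x i \<tau> \<omega>
      + G *v agents_mean N x \<tau> \<omega> + f \<tau>) + noise i t \<omega>"
    if \<omega>: "\<omega> \<in> space M" and i: "i \<in> {1..N}" and t: "t \<in> {0..T}" for i t \<omega>
  proof -
    have sub: "{0..t} \<subseteq> {0..T}" using t by auto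
    have D: "A *v x i \<tau> \<omega> + B *v feedback_of x i \<tau> \<omega> + G *v agents_mean N x \<tau> \<omega> + f \<tau>
        = ?g \<tau> + L1 \<tau> *v m \<tau> \<omega> + L2 \<tau> *v e i \<tau> \<omega>" if "\<tau> \<in> {0..t}" for \<tau>
    proof -
      have \<tau>: "\<tau> \<in> {0..T}" using that t by auto
      show ?thesis
        unfolding feedback_eq agents_mean_def mean_x[OF \<omega> \<tau>]
        by (simp add: x_def L1_def L2_def S_def matrix_vector_simps algebra_simps
            bounded_bilinear.minus_right[OF bounded_bilinear_matrix_vector_mult] del: transpose_matrix_vector)
    qed
    have c1: "continuous_on {0..t} (\<lambda>\<tau>. L1 \<tau> *v m \<tau> \<omega>)" and c2: "continuous_on {0..t} (\<lambda>\<tau>. L2 \<tau> *v e i \<tau> \<omega>)"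
      and c3: "continuous_on {0..t} ?g"
      by (rule continuous_on_subset[OF _ sub], intro continuous_intros L1c L2c mc ec \<omega> i f_cont s_cont)+
    have "(LBINT \<tau>:{0..t}. A *v x i \<tau> \<omega> + B *v feedback_of x i \<tau> \<omega> + G *v agents_mean N x \<tau> \<omega> + f \<tau>)
        = (LBINT \<tau>:{0..t}. ?g \<tau> + L1 \<tau> *v m \<tau> \<omega> + L2 \<tau> *v e i \<tau> \<omega>)"
      by (rule set_lebesgue_integral_cong) (use D in auto)
    also have "\<dots> = integral {0..t} (\<lambda>\<tau>. ?g \<tau> + L1 \<tau> *v m \<tau> \<omega> + L2 \<tau> *v e i \<tau> \<omega>)"
      by (rule integral_eq_LBINT[symmetric]) (intro continuous_on_add c1 c2 c3)
    also have "\<dots> = integral {0..t} ?g + integral {0..t} (\<lambda>\<tau>. L1 \<tau> *v m \<tau> \<omega>) + integral {0..t} (\<lambda>\<tau>. L2 \<tau> *v e i \<tau> \<omega>)"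
      using c1 c2 c3 by (simp add: Henstock_Kurzweil_Integration.integral_add integrable_continuous_real
          Henstock_Kurzweil_Integration.integrable_add)
    finally have I: "(LBINT \<tau>:{0..t}. A *v x i \<tau> \<omega> + B *v feedback_of x i \<tau> \<omega> + G *v agents_mean N x \<tau> \<omega> + f \<tau>)
        = integral {0..t} ?g + integral {0..t} (\<lambda>\<tau>. L1 \<tau> *v m \<tau> \<omega>) + integral {0..t} (\<lambda>\<tau>. L2 \<tau> *v e i \<tau> \<omega>)" .
    have "x i t \<omega> = (b1 t \<omega> + integral {0..t} (\<lambda>\<tau>. L1 \<tau> *v m \<tau> \<omega>)) + (b2 i t \<omega> + integral {0..t} (\<lambda>\<tau>. L2 \<tau> *v e i \<tau> \<omega>))"
      using meq[OF \<omega> t] eeq[OF \<omega> i t] by (simp only: x_def)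
    then show ?thesis unfolding I b1_def b2_def by simp
  qed
  have "is_state (feedback_of x) x"
    unfolding state_process_def
  proof (intro ballI conjI exI)
    fix i assume i: "i \<in> {1..N}"
    show "adapted_process M F T (x i)"
      unfolding adapted_process_def
      using caratheodory_measurable[OF F_measurable_M[OF xF[OF i]] xc[OF _ i]] xF[OF i] by blast
    show "AE \<omega> in M. continuous_on {0..T} (\<lambda>t. x i t \<omega>)"
      by (rule AE_I2) (rule xc[OF _ i])
    show "ito_integral M F T (W i) (\<lambda>t \<omega>. \<sigma> t) (noise i)" by (rule noise(1)[OF i])
    show "AE \<omega> in M. \<forall>t\<in>{0..T}. x i t \<omega> = x0 i \<omega> + (LBINT \<tau>:{0..t}. A *v x i \<tau> \<omega> + B *v feedback_of x i \<tau> \<omega>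
      + G *v agents_mean N x \<tau> \<omega> + f \<tau>) + noise i t \<omega>"
      by (rule AE_I2, rule ballI) (rule eq[OF _ i])
  qed
  then show ?thesis by blast
qed

end

text \<open>A feedback law becomes a control profile only through a state that it generates itself.
  Hence the existence of such a closed-loop state is part of the claim, and optimality is asserted
  for the profile obtained from any of them.\<close>

theorem theorem3p2:
  fixes M :: "'w measure"
    and N :: nat
    and T \<rho> C0 :: real
    and A G \<Gamma> Q :: "real^'n^'n"
    and B :: "real^'r^'n"
    and R :: "real^'r^'r"
    and f \<sigma> \<eta> :: "real \<Rightarrow> real^'n"
    and W :: "nat \<Rightarrow> real \<Rightarrow> 'w \<Rightarrow> real"
    and x0 :: "nat \<Rightarrow> 'w \<Rightarrow> real^'n"
    and xbar0 :: "real^'n"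
    and F :: "real \<Rightarrow> 'w measure"
    and P K :: "real \<Rightarrow> real^'n^'n"
  defines "F \<equiv> agents_filtration M N x0 W"
  assumes "T > 0" and "\<rho> > 0" and "N \<ge> 1"
    and "transpose Q = Q" and "transpose R = R" and "positive_definite R"
    and "f \<in> weighted_C \<rho>" and "\<sigma> \<in> weighted_C \<rho>" and "\<eta> \<in> weighted_C \<rho>"
    and "prob_space M" and "complete_measure M"
    and "\<And>i. i \<in> {1..N} \<Longrightarrow> brownian_motion M F (W i)"
    and "prob_space.indep_vars M (\<lambda>_. PiM {0..} (\<lambda>_. borel)) (\<lambda>i \<omega>. \<lambda>t\<in>{0..}. W i t \<omega>) {1..N}"
    and "prob_space.indep_vars M (\<lambda>_. borel) x0 {1..N}"
    and "\<And>i. i \<in> {1..N} \<Longrightarrow> prob_space.expectation M (x0 i) = xbar0"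
    and "\<And>i. i \<in> {1..N} \<Longrightarrow> (\<integral>\<^sup>+\<omega>. ennreal ((norm (x0 i \<omega>))\<^sup>2) \<partial>M) < ennreal C0"
    and "solves_P T \<rho> A B Q R P"
    and "solves_K T \<rho> A B G \<Gamma> Q R P K"
  shows "(\<exists>s. solves_s T \<rho> A B G \<Gamma> Q R f \<eta> P K s) \<and>
    (\<forall>s. solves_s T \<rho> A B G \<Gamma> Q R f \<eta> P K s \<longrightarrow>
      (\<exists>x. state_process M F T N W x0 A B G f \<sigma> (feedback N B R P K s x) x) \<and>
      (\<forall>x. state_process M F T N W x0 A B G f \<sigma> (feedback N B R P K s x) x \<longrightarrow>
        optimal_control M F T N W x0 A B G f \<sigma> \<rho> \<Gamma> Q R \<eta> (feedback N B R P K s x)))"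
proof -
  interpret prob_space M by fact
  have cont: "continuous_on {0..T} f" "continuous_on {0..T} \<sigma>" "continuous_on {0..T} \<eta>"
    using assms(8-10) by (auto simp: weighted_C_def intro: continuous_on_subset)
  have x0: "x0 i \<in> borel_measurable M" if "i \<in> {1..N}" for i
    using assms(15) that unfolding indep_vars_def by blast
  have W: "W i t \<in> borel_measurable M" if "i \<in> {1..N}" "0 \<le> t" for i t
    using assms(13)[OF that(1)] that(2) unfolding brownian_motion_def by blast
  have x0sq: "square_integrable M (x0 i)" if "i \<in> {1..N}" for i
    using assms(17)[OF that] by (subst square_integrable_iff_nn_integral[OF x0[OF that]]) (auto intro: less_trans)
  interpret filtered_prob_space M F
    unfolding F_def by (rule filtered_agents[OF x0 W])
  have P: "continuous_on {0..T} P"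
    by (rule has_vector_derivative_imp_continuous_on) (rule solves_P_derivative[OF assms(18)])
  have K: "continuous_on {0..T} K"
    by (rule has_vector_derivative_imp_continuous_on) (rule solves_K_derivative[OF assms(19)])
  have sc: "social_control N T \<rho> A G \<Gamma> Q B R f \<eta> s P K M F W x0 \<sigma>"
    if "solves_s T \<rho> A B G \<Gamma> Q R f \<eta> P K s" for s
  proof
    show "x0 i \<in> borel_measurable (F t)" if "i \<in> {1..N}" for i t
      unfolding F_def by (rule initial_measurable_agents_filtration[OF that])
  qed (fact assms that cont | rule x0sq; assumption | rule assms(13); assumption)+
  show ?thesis
  proof (intro conjI allI impI)
    show "\<exists>s. solves_s T \<rho> A B G \<Gamma> Q R f \<eta> P K s"
      using assms(2) by (intro solves_s_exists P K cont) simp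
  next
    fix s assume s: "solves_s T \<rho> A B G \<Gamma> Q R f \<eta> P K s"
    show "\<exists>x. state_process M F T N W x0 A B G f \<sigma> (feedback N B R P K s x) x"
      by (rule social_control.closed_loop_exists[OF sc[OF s]])
    fix x assume "state_process M F T N W x0 A B G f \<sigma> (feedback N B R P K s x) x"
    then show "optimal_control M F T N W x0 A B G f \<sigma> \<rho> \<Gamma> Q R \<eta> (feedback N B R P K s x)"
      by (rule social_control.closed_loop_optimal[OF sc[OF s]])
  qed
qed

end
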